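(* Let $G$ be a cubulated hyperbolic group, i.e. a hyperbolic group admitting a geometric action on some $\mathrm{CAT}(0)$ cube complex. Then the natural action of $G$ on its Gromov boundary $\partial G$ is hyperfinite, i.e. its orbit equivalence relation $\{(a,b)\in\partial G\times\partial G : \exists g\in G,\ ga=b\}$ is a hyperfinite Borel equivalence relation.
   Context: A geodesic metric space is hyperbolic if there is $\delta>0$ such that in every geodesic triangle each side is contained in the $\delta$-neighbourhood of the union of the other two sides. A finitely generated group is hyperbolic if its Cayley graph with respect to some (equivalently any) finite generating set is hyperbolic. The Gromov boundary $\partial G$ of a hyperbolic group $G$ is the Gromov boundary of a Cayley graph of $G$ with respect to a finite generating set (equivalence classes of geodesic rays, two rays being equivalent if they are at finite Hausdorff distance), with its usual compact metrizable topology; the left multiplication action of $G$ on the Cayley graph induces the natural action of $G$ on $\partial G$ by homeomorphisms. A cube complex is obtained by taking a disjoint collection of unit cubes in Euclidean spaces of various dimensions and gluing them isometrically along faces; it carries a piecewise Euclidean metric. It is a $\mathrm{CAT}(0)$ cube complex if it is simply connected (in particular connected) and the link of each vertex is a flag simplicial complex. Groups act on cube complexes by isometries preserving the cube structure. An isometric action of $G$ on $X$ is proper if for every compact $K\subseteq X$ the set $\{g\in G: gK\cap K\ne\emptyset\}$ is finite; cocompact if there is a compact $A\subseteq X$ with $GA=X$; geometric if it is proper and cocompact. A Borel equivalence relation on a standard Borel space $Z$ is an equivalence relation that is a Borel subset of $Z^2$; it is finite if all its classes are finite. A Borel equivalence relation $E$ on $Z$ is hyperfinite if there is a sequence $F_0\subseteq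 F_1\subseteq\cdots$ of finite Borel equivalence relations on $Z$ with $E=\bigcup_n F_n$. An action of a countable group is called hyperfinite if its orbit equivalence relation is hyperfinite. *)

theory Defs
  imports "HOL-Analysis.Analysis" "HOL-Algebra.Group_Action" "HOL-Algebra.Generated_Groups"
begin

section \<open>Hyperfinite Borel equivalence relations\<close>

definition borel_of :: "'a topology \<Rightarrow> 'a measure" where
  "borel_of T = sigma (topspace T) {U. openin T U}"

definition standard_borel :: "'a measure \<Rightarrow> bool" where
  "standard_borel M \<longleftrightarrow>
     (\<exists>T. completely_metrizable_space T \<and> second_countable T \<and>
          space M = topspace T \<and> sets M = sets (borel_of T))"

definition borel_equivalence :: "'a measure \<Rightarrow> ('a \<times> 'a) set \<Rightarrow> bool" where
  "borel_equivalence M E \<longleftrightarrow>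
     standard_borel M \<and> equiv (space M) E \<and> E \<in> sets (M \<Otimes>\<^sub>M M)"

definition finite_borel_equivalence :: "'a measure \<Rightarrow> ('a \<times> 'a) set \<Rightarrow> bool" where
  "finite_borel_equivalence M E \<longleftrightarrow>
     borel_equivalence M E \<and> (\<forall>x \<in> space M. finite (E `` {x}))"

definition hyperfinite :: "'a measure \<Rightarrow> ('a \<times> 'a) set \<Rightarrow> bool" where
  "hyperfinite M E \<longleftrightarrow>
     borel_equivalence M E \<and>
     (\<exists>F :: nat \<Rightarrow> ('a \<times> 'a) set.
        (\<forall>n. finite_borel_equivalence M (F n)) \<and> (\<forall>n. F n \<subseteq> F (Suc n)) \<and> E = (\<Union>n. F n))"

definition orbit_rel :: "('g, 'm) monoid_scheme \<Rightarrow> 'a set \<Rightarrow> ('g \<Rightarrow> 'a \<Rightarrow> 'a) \<Rightarrow> ('a \<times> 'a) set" where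
  "orbit_rel G Z \<phi> = {(a, b) \<in> Z \<times> Z. \<exists>g \<in> carrier G. \<phi> g a = b}"

definition hyperfinite_action ::
    "('g, 'm) monoid_scheme \<Rightarrow> 'a measure \<Rightarrow> ('g \<Rightarrow> 'a \<Rightarrow> 'a) \<Rightarrow> bool" where
  "hyperfinite_action G M \<phi> \<longleftrightarrow> hyperfinite M (orbit_rel G (space M) \<phi>)"


section \<open>Hyperbolic geodesic spaces and their Gromov boundary\<close>

text \<open>\<open>\<gamma>\<close> is an isometric embedding of \<open>[0, d x y]\<close> and \<open>A\<close> is its image.\<close>

definition geodesic_segment :: "'x set \<Rightarrow> ('x \<Rightarrow> 'x \<Rightarrow> real) \<Rightarrow> 'x \<Rightarrow> 'x \<Rightarrow> 'x set \<Rightarrow> bool" where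
  "geodesic_segment M d x y A \<longleftrightarrow>
     (\<exists>\<gamma>. \<gamma> \<in> {0..d x y} \<rightarrow> M \<and> \<gamma> 0 = x \<and> \<gamma> (d x y) = y \<and> A = \<gamma> ` {0..d x y} \<and>
          (\<forall>s \<in> {0..d x y}. \<forall>t \<in> {0..d x y}. d (\<gamma> s) (\<gamma> t) = \<bar>s - t\<bar>))"

definition geodesic_space :: "'x set \<Rightarrow> ('x \<Rightarrow> 'x \<Rightarrow> real) \<Rightarrow> bool" where
  "geodesic_space M d \<longleftrightarrow>
     Metric_space M d \<and> (\<forall>x \<in> M. \<forall>y \<in> M. \<exists>A. geodesic_segment M d x y A)"

definition hyperbolic_space :: "'x set \<Rightarrow> ('x \<Rightarrow> 'x \<Rightarrow> real) \<Rightarrow> bool" where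
  "hyperbolic_space M d \<longleftrightarrow>
     geodesic_space M d \<and>
     (\<exists>\<delta> > 0. \<forall>x \<in> M. \<forall>y \<in> M. \<forall>z \<in> M. \<forall>A B C.
        geodesic_segment M d x y A \<and> geodesic_segment M d y z B \<and> geodesic_segment M d x z C \<longrightarrow>
        (\<forall>a \<in> A. \<exists>b \<in> B \<union> C. d a b < \<delta>) \<and>
        (\<forall>b \<in> B. \<exists>a \<in> A \<union> C. d b a < \<delta>) \<and>
        (\<forall>c \<in> C. \<exists>a \<in> A \<union> B. d c a < \<delta>))"

definition geodesic_rays :: "'x set \<Rightarrow> ('x \<Rightarrow> 'x \<Rightarrow> real) \<Rightarrow> (real \<Rightarrow> 'x) set" where
  "geodesic_rays M d =
     {\<gamma> \<in> {0..} \<rightarrow>\<^sub>E M. \<forall>s \<in> {0..}. \<forall>t \<in> {0..}. d (\<gamma> s) (\<gamma> t) = \<bar>s - t\<bar>}"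

definition finite_hausdorff_dist :: "('x \<Rightarrow> 'x \<Rightarrow> real) \<Rightarrow> 'x set \<Rightarrow> 'x set \<Rightarrow> bool" where
  "finite_hausdorff_dist d A B \<longleftrightarrow>
     (\<exists>D. (\<forall>a \<in> A. \<exists>b \<in> B. d a b \<le> D) \<and> (\<forall>b \<in> B. \<exists>a \<in> A. d a b \<le> D))"

definition asymptotic :: "'x set \<Rightarrow> ('x \<Rightarrow> 'x \<Rightarrow> real) \<Rightarrow> ((real \<Rightarrow> 'x) \<times> (real \<Rightarrow> 'x)) set" where
  "asymptotic M d =
     {(\<gamma>, \<gamma>') \<in> geodesic_rays M d \<times> geodesic_rays M d.
        finite_hausdorff_dist d (\<gamma> ` {0..}) (\<gamma>' ` {0..})}"

definition gromov_boundary :: "'x set \<Rightarrow> ('x \<Rightarrow> 'x \<Rightarrow> real) \<Rightarrow> (real \<Rightarrow> 'x) set set" where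
  "gromov_boundary M d = geodesic_rays M d // asymptotic M d"

text \<open>The quotient topology coming from the rays that start at the base point \<open>b\<close>, with the
  topology of uniform convergence on compact sets. In a proper hyperbolic space every class
  contains a ray from \<open>b\<close> and the topology does not depend on \<open>b\<close>.\<close>

definition gromov_open :: "'x set \<Rightarrow> ('x \<Rightarrow> 'x \<Rightarrow> real) \<Rightarrow> 'x \<Rightarrow> (real \<Rightarrow> 'x) set set \<Rightarrow> bool" where
  "gromov_open M d b U \<longleftrightarrow>
     U \<subseteq> gromov_boundary M d \<and>
     (\<forall>\<gamma> \<in> geodesic_rays M d. \<gamma> 0 = b \<and> asymptotic M d `` {\<gamma>} \<in> U \<longrightarrow>
        (\<exists>T. \<exists>\<epsilon> > 0. \<forall>\<gamma>' \<in> geodesic_rays M d.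
           \<gamma>' 0 = b \<and> (\<forall>t \<in> {0..T}. d (\<gamma> t) (\<gamma>' t) < \<epsilon>) \<longrightarrow> asymptotic M d `` {\<gamma>'} \<in> U))"

definition gromov_topology ::
    "'x set \<Rightarrow> ('x \<Rightarrow> 'x \<Rightarrow> real) \<Rightarrow> 'x \<Rightarrow> (real \<Rightarrow> 'x) set topology" where
  "gromov_topology M d b = topology (gromov_open M d b)"

lemma istopology_gromov_open: "istopology (gromov_open M d b)"
proof -
  let ?c = "\<lambda>\<gamma>. asymptotic M d `` {\<gamma>}"
  define N where "N \<gamma> T \<epsilon> = {\<gamma>' \<in> geodesic_rays M d. \<gamma>' 0 = b \<and> (\<forall>t \<in> {0..T}. d (\<gamma> t) (\<gamma>' t) < \<epsilon>)}"
    for \<gamma> T and \<epsilon> :: real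
  have iff: "gromov_open M d b U \<longleftrightarrow> U \<subseteq> gromov_boundary M d \<and>
      (\<forall>\<gamma> \<in> geodesic_rays M d. \<gamma> 0 = b \<longrightarrow> ?c \<gamma> \<in> U \<longrightarrow> (\<exists>T. \<exists>\<epsilon> > 0. ?c ` N \<gamma> T \<epsilon> \<subseteq> U))" for U
    by (simp add: gromov_open_def N_def image_subset_iff Ball_def imp_conjL)
  have mono: "N \<gamma> (max T T') (min \<epsilon> \<epsilon>') \<subseteq> N \<gamma> T \<epsilon> \<inter> N \<gamma> T' \<epsilon>'" for \<gamma> T T' \<epsilon> \<epsilon>'
    by (auto simp: N_def)
  show ?thesis
    unfolding istopology_def iff
  proof (intro conjI allI impI ballI, goal_cases)
    case (1 U V)
    from 1(1) show ?case by (intro le_infI1) (rule conjunct1)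
  next
    case (2 U V \<gamma>)
    from 2(1) 2(3,4) IntD1[OF 2(5)] obtain T \<epsilon> where U: "\<epsilon> > 0" "?c ` N \<gamma> T \<epsilon> \<subseteq> U" by fast
    from 2(2) 2(3,4) IntD2[OF 2(5)] obtain T' \<epsilon>' where V: "\<epsilon>' > 0" "?c ` N \<gamma> T' \<epsilon>' \<subseteq> V" by fast
    have "?c ` N \<gamma> (max T T') (min \<epsilon> \<epsilon>') \<subseteq> ?c ` N \<gamma> T \<epsilon> \<inter> ?c ` N \<gamma> T' \<epsilon>'"
      using image_mono[OF mono[of \<gamma> T T' \<epsilon> \<epsilon>'], of ?c] image_Int_subset by (rule subset_trans)
    also have "\<dots> \<subseteq> U \<inter> V"
      using U(2) V(2) by (rule Int_mono)
    finally show ?case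
      using U(1) V(1) by (intro exI[of _ "max T T'"] exI[of _ "min \<epsilon> \<epsilon>'"]) simp
  next
    case (3 \<U>)
    then show ?case by (intro Union_least) simp
  next
    case (4 \<U> \<gamma>)
    from 4(4) obtain U where U: "U \<in> \<U>" "?c \<gamma> \<in> U" by (rule UnionE)
    with 4(1-3) obtain T \<epsilon> where T: "\<epsilon> > 0" "?c ` N \<gamma> T \<epsilon> \<subseteq> U" by fast
    from T(2) Union_upper[OF U(1)] have "?c ` N \<gamma> T \<epsilon> \<subseteq> \<Union>\<U>" by (rule subset_trans)
    with T(1) show ?case by (intro exI conjI)
  qed
qed

lemma openin_gromov_topology: "openin (gromov_topology M d b) U \<longleftrightarrow> gromov_open M d b U"
  by (simp add: gromov_topology_def istopology_gromov_open)

lemma topspace_gromov_topology: "topspace (gromov_topology M d b) = gromov_boundary M d"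
proof -
  have "gromov_open M d b (gromov_boundary M d)"
    unfolding gromov_open_def
    by (intro conjI ballI impI exI[of _ 1]) (simp_all add: gromov_boundary_def quotientI)
  then show ?thesis
    by (auto simp: topspace_def openin_gromov_topology gromov_open_def)
qed


section \<open>Cube complexes\<close>

text \<open>The unit cube \<open>[0,1]\<^sup>n\<close>; as in \<^const>\<open>Euclidean_space\<close>, points of Euclidean \<open>n\<close>-space are
  functions on \<^typ>\<open>nat\<close> that vanish from \<open>n\<close> on.\<close>

definition unit_cube :: "nat \<Rightarrow> (nat \<Rightarrow> real) set" where
  "unit_cube n = {u. (\<forall>i < n. 0 \<le> u i \<and> u i \<le> 1) \<and> (\<forall>i \<ge> n. u i = 0)}"

definition edist :: "nat \<Rightarrow> (nat \<Rightarrow> real) \<Rightarrow> (nat \<Rightarrow> real) \<Rightarrow> real" where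
  "edist n u v = L2_set (\<lambda>i. u i - v i) {..<n}"

text \<open>The smallest face of the cube containing \<open>u\<close>, and the relative interior of that face. Every
  face is the support of its barycentre.\<close>

definition supp_face :: "nat \<Rightarrow> (nat \<Rightarrow> real) \<Rightarrow> (nat \<Rightarrow> real) set" where
  "supp_face n u = {v \<in> unit_cube n. \<forall>i < n. u i \<in> {0, 1} \<longrightarrow> v i = u i}"

definition open_face :: "nat \<Rightarrow> (nat \<Rightarrow> real) \<Rightarrow> (nat \<Rightarrow> real) set" where
  "open_face n u = {v \<in> supp_face n u. \<forall>i < n. u i \<notin> {0, 1} \<longrightarrow> v i \<notin> {0, 1}}"

definition euclid_isometry ::
    "nat \<Rightarrow> (nat \<Rightarrow> real) set \<Rightarrow> nat \<Rightarrow> (nat \<Rightarrow> real) set \<Rightarrow> ((nat \<Rightarrow> real) \<Rightarrow> nat \<Rightarrow> real) \<Rightarrow> bool" where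
  "euclid_isometry n A m B h \<longleftrightarrow>
     bij_betw h A B \<and> (\<forall>u \<in> A. \<forall>v \<in> A. edist m (h u) (h v) = edist n u v)"

text \<open>A quotient of a disjoint union of cubes is given by the restrictions of the quotient map to
  the cubes: the cube with index \<open>c\<close> is \<open>[0,1]\<close> to the power \<open>cdim X c\<close>, and \<open>glue X c\<close> maps it
  into the quotient.\<close>

record ('i, 'x) cube_family =
  cubes :: "'i set"
  cdim :: "'i \<Rightarrow> nat"
  glue :: "'i \<Rightarrow> (nat \<Rightarrow> real) \<Rightarrow> 'x"

abbreviation cube_at :: "('i, 'x) cube_family \<Rightarrow> 'i \<Rightarrow> (nat \<Rightarrow> real) set" where
  "cube_at X c \<equiv> unit_cube (cdim X c)"

definition cc_points :: "('i, 'x) cube_family \<Rightarrow> 'x set" where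
  "cc_points X = (\<Union>c \<in> cubes X. glue X c ` cube_at X c)"

text \<open>Gluing by isometries of faces, as in Bridson and Haefliger's definition of polyhedral
  complexes: open faces are embedded, and whenever two points are identified, so are the faces
  supporting them, by an isometry. A cube may have faces glued to each other.\<close>

definition cube_complex :: "('i, 'x) cube_family \<Rightarrow> bool" where
  "cube_complex X \<longleftrightarrow>
     (\<forall>c \<in> cubes X. \<forall>u \<in> cube_at X c. inj_on (glue X c) (open_face (cdim X c) u)) \<and>
     (\<forall>c \<in> cubes X. \<forall>c' \<in> cubes X. \<forall>u \<in> cube_at X c. \<forall>u' \<in> cube_at X c'.
        glue X c u = glue X c' u' \<longrightarrow>
        (\<exists>h. euclid_isometry (cdim X c) (supp_face (cdim X c) u)
                             (cdim X c') (supp_face (cdim X c') u') h \<and>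
             (\<forall>v \<in> supp_face (cdim X c) u. glue X c v = glue X c' (h v))))"

text \<open>The piecewise Euclidean metric is the infimum of the lengths \<open>l\<close> of strings, i.e. of
  concatenations of straight segments each lying in one cube. The value \<open>0\<close> for points not joined
  by a string is a dummy; the distance is only used for complexes without such pairs of points.\<close>

inductive cc_string :: "('i, 'x) cube_family \<Rightarrow> 'x \<Rightarrow> 'x \<Rightarrow> real \<Rightarrow> bool" for X where
  refl: "x \<in> cc_points X \<Longrightarrow> cc_string X x x 0"
| step: "\<lbrakk>cc_string X x (glue X c u) l; c \<in> cubes X; u \<in> cube_at X c; v \<in> cube_at X c\<rbrakk>
         \<Longrightarrow> cc_string X x (glue X c v) (l + edist (cdim X c) u v)"

definition cc_connected :: "('i, 'x) cube_family \<Rightarrow> bool" where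
  "cc_connected X \<longleftrightarrow>
     cc_points X \<noteq> {} \<and> (\<forall>x \<in> cc_points X. \<forall>y \<in> cc_points X. \<exists>l. cc_string X x y l)"

definition cc_dist :: "('i, 'x) cube_family \<Rightarrow> 'x \<Rightarrow> 'x \<Rightarrow> real" where
  "cc_dist X x y = (if \<exists>l. cc_string X x y l then Inf {l. cc_string X x y l} else 0)"

definition cc_topology :: "('i, 'x) cube_family \<Rightarrow> 'x topology" where
  "cc_topology X = Metric_space.mtopology (cc_points X) (cc_dist X)"

text \<open>\<^const>\<open>simply_connected\<close> for abstract topologies; taking constant loops shows that it
  contains path connectedness.\<close>

definition simply_connected_space :: "'x topology \<Rightarrow> bool" where
  "simply_connected_space T \<longleftrightarrow>
     topspace T \<noteq> {} \<and>
     (\<forall>p q. pathin T p \<and> p 1 = p 0 \<and> pathin T q \<and> q 1 = q 0 \<longrightarrow>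
        homotopic_with (\<lambda>r. r 1 = r 0) (top_of_set {0..1}) T p q)"

text \<open>A corner \<open>(c, u)\<close> at \<open>x\<close> is a vertex \<open>u\<close> of the cube \<open>c\<close> glued to \<open>x\<close>. Each set \<open>I\<close> of
  coordinate directions at \<open>u\<close> spans a simplex of the link of \<open>x\<close>. A simplex of the link is
  represented by the part of its open cone that lies near \<open>x\<close>, which is a subset of the complex; in
  this way simplices of different corners are identified exactly when the gluing identifies them
  (and the two ends of an edge that is a loop stay different).\<close>

definition corners_at :: "('i, 'x) cube_family \<Rightarrow> 'x \<Rightarrow> ('i \<times> (nat \<Rightarrow> real)) set" where
  "corners_at X x =
     {(c, u). c \<in> cubes X \<and> u \<in> cube_at X c \<and> (\<forall>i < cdim X c. u i \<in> {0, 1}) \<and> glue X c u = x}"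

definition link_cell :: "('i, 'x) cube_family \<Rightarrow> 'i \<Rightarrow> (nat \<Rightarrow> real) \<Rightarrow> nat set \<Rightarrow> 'x set" where
  "link_cell X c u I =
     glue X c ` {v \<in> cube_at X c. (\<forall>i \<in> I. 0 < \<bar>v i - u i\<bar> \<and> \<bar>v i - u i\<bar> < 1/2) \<and>
                                  (\<forall>i. i \<notin> I \<longrightarrow> v i = u i)}"

definition link_cell_vertices :: "('i, 'x) cube_family \<Rightarrow> 'i \<Rightarrow> (nat \<Rightarrow> real) \<Rightarrow> nat set \<Rightarrow> 'x set set" where
  "link_cell_vertices X c u I = (\<lambda>i. link_cell X c u {i}) ` I"

text \<open>The link is a simplicial complex if its cells are embedded simplices that are determined by
  their vertices.\<close>

definition link_simplicial :: "('i, 'x) cube_family \<Rightarrow> 'x \<Rightarrow> bool" where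
  "link_simplicial X x \<longleftrightarrow>
     (\<forall>(c, u) \<in> corners_at X x. inj_on (\<lambda>i. link_cell X c u {i}) {..<cdim X c}) \<and>
     (\<forall>(c, u) \<in> corners_at X x. \<forall>(c', u') \<in> corners_at X x.
        \<forall>I \<subseteq> {..<cdim X c}. \<forall>I' \<subseteq> {..<cdim X c'}.
          link_cell_vertices X c u I = link_cell_vertices X c' u' I' \<longrightarrow>
          link_cell X c u I = link_cell X c' u' I')"

definition link_simplices :: "('i, 'x) cube_family \<Rightarrow> 'x \<Rightarrow> 'x set set set" where
  "link_simplices X x =
     {link_cell_vertices X c u I | c u I. (c, u) \<in> corners_at X x \<and> I \<subseteq> {..<cdim X c} \<and> I \<noteq> {}}"

definition flag_complex :: "'v set set \<Rightarrow> bool" where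
  "flag_complex K \<longleftrightarrow>
     (\<forall>\<sigma>. finite \<sigma> \<and> \<sigma> \<noteq> {} \<and> (\<forall>a \<in> \<sigma>. \<forall>b \<in> \<sigma>. {a, b} \<in> K) \<longrightarrow> \<sigma> \<in> K)"

definition cc_vertices :: "('i, 'x) cube_family \<Rightarrow> 'x set" where
  "cc_vertices X = {x. corners_at X x \<noteq> {}}"

definition CAT0_cube_complex :: "('i, 'x) cube_family \<Rightarrow> bool" where
  "CAT0_cube_complex X \<longleftrightarrow>
     cube_complex X \<and> cc_connected X \<and> simply_connected_space (cc_topology X) \<and>
     (\<forall>x \<in> cc_vertices X. link_simplicial X x \<and> flag_complex (link_simplices X x))"


section \<open>Geometric actions on cube complexes\<close>

definition cubical_map :: "('i, 'x) cube_family \<Rightarrow> ('x \<Rightarrow> 'x) \<Rightarrow> bool" where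
  "cubical_map X f \<longleftrightarrow>
     (\<forall>c \<in> cubes X. \<exists>c' \<in> cubes X. \<exists>w \<in> cube_at X c'. \<exists>h.
        euclid_isometry (cdim X c) (cube_at X c) (cdim X c') (supp_face (cdim X c') w) h \<and>
        (\<forall>u \<in> cube_at X c. f (glue X c u) = glue X c' (h u)))"

definition cubical_action ::
    "('g, 'm) monoid_scheme \<Rightarrow> ('i, 'x) cube_family \<Rightarrow> ('g \<Rightarrow> 'x \<Rightarrow> 'x) \<Rightarrow> bool" where
  "cubical_action G X \<phi> \<longleftrightarrow>
     group_action G (cc_points X) \<phi> \<and>
     (\<forall>g \<in> carrier G. cubical_map X (\<phi> g) \<and>
        (\<forall>x \<in> cc_points X. \<forall>y \<in> cc_points X. cc_dist X (\<phi> g x) (\<phi> g y) = cc_dist X x y))"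

definition proper_action :: "('g, 'm) monoid_scheme \<Rightarrow> 'x topology \<Rightarrow> ('g \<Rightarrow> 'x \<Rightarrow> 'x) \<Rightarrow> bool" where
  "proper_action G T \<phi> \<longleftrightarrow>
     (\<forall>K. compactin T K \<longrightarrow> finite {g \<in> carrier G. \<phi> g ` K \<inter> K \<noteq> {}})"

definition cocompact_action :: "('g, 'm) monoid_scheme \<Rightarrow> 'x topology \<Rightarrow> ('g \<Rightarrow> 'x \<Rightarrow> 'x) \<Rightarrow> bool" where
  "cocompact_action G T \<phi> \<longleftrightarrow>
     (\<exists>A. compactin T A \<and> (\<Union>g \<in> carrier G. \<phi> g ` A) = topspace T)"

definition geometric_cubical_action ::
    "('g, 'm) monoid_scheme \<Rightarrow> ('i, 'x) cube_family \<Rightarrow> ('g \<Rightarrow> 'x \<Rightarrow> 'x) \<Rightarrow> bool" where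
  "geometric_cubical_action G X \<phi> \<longleftrightarrow>
     cubical_action G X \<phi> \<and>
     proper_action G (cc_topology X) \<phi> \<and> cocompact_action G (cc_topology X) \<phi>"


section \<open>Hyperbolic groups and their boundary\<close>

definition finite_generating_set :: "('g, 'm) monoid_scheme \<Rightarrow> 'g set \<Rightarrow> bool" where
  "finite_generating_set G S \<longleftrightarrow> finite S \<and> S \<subseteq> carrier G \<and> generate G S = carrier G"

text \<open>The Cayley graph as a complex of dimension at most one, with unit edges joining \<open>g\<close> to
  \<open>g s\<close>; the pairs \<open>(g, g)\<close> are the vertices. Points are given by barycentric coordinates, so that
  edges with the same two end points coincide, and loops (\<open>s = 1\<close>) are omitted.\<close>

definition cayley_graph :: "('g, 'm) monoid_scheme \<Rightarrow> 'g set \<Rightarrow> ('g \<times> 'g, 'g \<Rightarrow> real) cube_family" where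
  "cayley_graph G S =
     \<lparr>cubes = {(g, h). g \<in> carrier G \<and> h \<in> carrier G \<and> (h = g \<or> (\<exists>s \<in> S. h = g \<otimes>\<^bsub>G\<^esub> s))},
      cdim = (\<lambda>(g, h). if h = g then 0 else 1),
      glue = (\<lambda>(g, h) u x. (1 - u 0) * indicator {g} x + u 0 * indicator {h} x)\<rparr>"

definition cayley_action :: "('g, 'm) monoid_scheme \<Rightarrow> 'g \<Rightarrow> ('g \<Rightarrow> real) \<Rightarrow> 'g \<Rightarrow> real" where
  "cayley_action G g f = (\<lambda>x. if x \<in> carrier G then f (inv\<^bsub>G\<^esub> g \<otimes>\<^bsub>G\<^esub> x) else 0)"

definition hyperbolic_group :: "('g, 'm) monoid_scheme \<Rightarrow> bool" where
  "hyperbolic_group G \<longleftrightarrow>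
     group G \<and>
     (\<exists>S. finite_generating_set G S \<and>
          hyperbolic_space (cc_points (cayley_graph G S)) (cc_dist (cayley_graph G S)))"

text \<open>The boundary of the Cayley graph for the generating set \<open>S\<close>, with the vertex of the
  neutral element as base point.\<close>

definition group_boundary ::
    "('g, 'm) monoid_scheme \<Rightarrow> 'g set \<Rightarrow> (real \<Rightarrow> 'g \<Rightarrow> real) set topology" where
  "group_boundary G S =
     gromov_topology (cc_points (cayley_graph G S)) (cc_dist (cayley_graph G S)) (indicator {\<one>\<^bsub>G\<^esub>})"

definition boundary_action ::
    "('g, 'm) monoid_scheme \<Rightarrow> 'g \<Rightarrow> (real \<Rightarrow> 'g \<Rightarrow> real) set \<Rightarrow> (real \<Rightarrow> 'g \<Rightarrow> real) set" where
  "boundary_action G g \<xi> = (\<lambda>\<gamma>. restrict (\<lambda>t. cayley_action G g (\<gamma> t)) {0..}) ` \<xi>"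

end

theory Submission
  imports Defs
begin

text \<open>A boundary point is represented by geodesic rays of vertices of the Cayley graph. To every
  boundary point \<open>\<xi>\<close> belongs the lexicographically least ray from the neutral element to \<open>\<xi>\<close>. The map
  \<open>shift\<close> walks along this ray for a fixed number \<open>stride\<close> of steps, up to a vertex \<open>s\<close>, and translates
  back, i.e. \<open>shift \<xi> = s\<inverse> \<xi>\<close>. Thus \<open>shift\<close> moves points inside their orbits, and its iterates at
  \<open>g\<inverse> \<xi>\<close> describe a walk \<open>p\<^sub>0 = g, p\<^sub>1, p\<^sub>2, \<dots>\<close> in the group, each step of which follows some geodesic
  ray towards \<open>\<xi>\<close>.

  The steps are long compared with the hyperbolicity constant, so each of them decreases the distance
  to the far points of any given ray to \<open>\<xi>\<close>. A walk with this property is a quasi-geodesic, and the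
  stability of quasi-geodesics forces it to pass within a uniform distance of all far points of the
  ray (\<open>trajectory_near_ray\<close>). Balls of a given radius have bounded size, so among sufficiently many
  walks towards \<open>\<xi>\<close> two share a point (\<open>trajectories_merge\<close>). Walks that share a point correspond to
  points of the orbit with a common iterate under powers of \<open>shift\<close>. Hence every orbit consists of
  finitely many tail classes of \<open>shift\<close>.

  It remains to prove two facts about Borel equivalence relations. The tail equivalence relation of a
  Borel map is an increasing union of finite Borel equivalence relations (\<open>tail_rel_union\<close>), because
  canonical markers along the orbits synchronise points that merge after different numbers of steps.
  And this property passes to an orbit equivalence relation of a countable group in which it has
  finite index (\<open>finite_index_hyperfinite\<close>).

  That \<open>shift\<close> is Borel and that the boundary is a standard Borel space come from compactness: the
  set of boundary points that are reached by a ray from a given vertex with a given initial segment is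
  closed (\<open>closed_prefix_condition\<close>). Therefore the code of the least ray is a Borel function, and its
  range is a \<open>G\<^sub>\<delta>\<close> set in the space of sequences of natural numbers (\<open>coord_image_polish\<close>).

  The stability of quasi-geodesics (\<open>geodesic_near_qpath\<close>, \<open>qpath_near_geodesic\<close>) has two more uses:
  it carries hyperbolicity from one finite generating set to another, and it replaces the rays of the
  Cayley graph by rays of vertices.\<close>


section \<open>Borel equivalence relations with a countable family of maps\<close>

text \<open>The initial segments of the lexicographically least infinite branch of the tree of all words
  that satisfy \<open>Q\<close>.\<close>

primrec lexmin :: "(nat list \<Rightarrow> bool) \<Rightarrow> nat \<Rightarrow> nat list" where
  "lexmin Q 0 = []"
| "lexmin Q (Suc n) = lexmin Q n @ [LEAST a. Q (lexmin Q n @ [a])]"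

lemma length_lexmin [simp]: "length (lexmin Q n) = n"
  by (induction n) auto

lemma lexmin_holds:
  assumes "Q []" and "\<And>w. Q w \<Longrightarrow> \<exists>a. Q (w @ [a])"
  shows "Q (lexmin Q n)"
proof (induction n)
  case (Suc n)
  then show ?case using LeastI_ex[OF assms(2)[OF Suc]] by simp
qed (use assms in simp)

lemma take_lexmin: "m \<le> n \<Longrightarrow> take m (lexmin Q n) = lexmin Q m"
proof (induction n)
  case (Suc n)
  then show ?case by (cases "m = Suc n") (auto simp: take_append)
qed simp

lemma measurable_lexmin [measurable (raw)]:
  assumes [measurable]: "\<And>w. Measurable.pred M (\<lambda>x. Q x w)"
  shows "(\<lambda>x. lexmin (Q x) n) \<in> measurable M (count_space UNIV)"
proof (induction n)
  case (Suc n)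
  have "(\<lambda>x. w @ [LEAST a. Q x (w @ [a])]) \<in> measurable M (count_space UNIV)" for w
    by measurable
  from measurable_compose_countable[OF this Suc] show ?case by simp
qed simp

lemma pair_pred_sets:
  assumes "Measurable.pred (M \<Otimes>\<^sub>M M) (\<lambda>z. P (fst z) (snd z))"
  shows "{(x, y) \<in> space M \<times> space M. P x y} \<in> sets (M \<Otimes>\<^sub>M M)"
proof -
  have "{(x, y) \<in> space M \<times> space M. P x y} = {z \<in> space (M \<Otimes>\<^sub>M M). P (fst z) (snd z)}"
    by (auto simp: space_pair_measure)
  then show ?thesis using assms by (simp add: pred_def)
qed

lemma equiv_CollectI:
  assumes "\<And>x. x \<in> A \<Longrightarrow> P x x" and "\<And>x y. P x y \<Longrightarrow> P y x"
    and "\<And>x y z. P x y \<Longrightarrow> P y z \<Longrightarrow> P x z"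
  shows "equiv A {(x, y) \<in> A \<times> A. P x y}"
proof (rule equivI)
  show "sym {(x, y) \<in> A \<times> A. P x y}" using assms(2) by (blast intro: symI)
  show "trans {(x, y) \<in> A \<times> A. P x y}" using assms(3) by (blast intro: transI)
qed (use assms(1) in \<open>auto simp: refl_on_def\<close>)

lemma pred_eq_countable:
  fixes a b :: "_ \<Rightarrow> 'c :: countable"
  assumes a: "a \<in> measurable N (count_space UNIV)" and b: "b \<in> measurable N (count_space UNIV)"
  shows "Measurable.pred N (\<lambda>w. a w = b w)"
proof (rule measurable_compose_countable[OF _ a])
  show "Measurable.pred N (\<lambda>w. k = b w)" for k
    using measurable_compose[OF b, of "\<lambda>v. k = v" "count_space UNIV"] by simp
qed

text \<open>The class of \<open>x\<close> consists of the points \<open>\<gamma> j x\<close>, as for an action of a countable group. The code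
  \<open>c\<close> identifies points with sequences of natural numbers. It makes the equality of two Borel maps a
  Borel condition, and since each of its coordinates has a finite range, the pigeonhole principle
  applies to initial segments of codes.\<close>

locale countable_borel_family =
  fixes M :: "'a measure" and \<gamma> :: "nat \<Rightarrow> 'a \<Rightarrow> 'a" and c :: "'a \<Rightarrow> nat \<Rightarrow> nat"
  assumes std: "standard_borel M"
    and \<gamma>_meas [measurable]: "\<And>j. \<gamma> j \<in> measurable M M"
    and c_meas: "\<And>n. (\<lambda>x. c x n) \<in> measurable M (count_space UNIV)"
    and c_inj: "inj_on c (space M)"
    and c_fin: "\<And>n. finite ((\<lambda>x. c x n) ` space M)"
    and equivE: "equiv (space M) {(x, y) \<in> space M \<times> space M. \<exists>j. \<gamma> j x = y}"
begin

definition E :: "('a \<times> 'a) set" where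
  "E = {(x, y) \<in> space M \<times> space M. \<exists>j. \<gamma> j x = y}"

lemma equiv_E: "equiv (space M) E"
  using equivE by (simp add: E_def)

lemma E_refl: "x \<in> space M \<Longrightarrow> (x, x) \<in> E"
  using equiv_E by (meson equiv_def refl_onD)

lemma E_sym: "(x, y) \<in> E \<Longrightarrow> (y, x) \<in> E"
  using equiv_E by (meson equiv_def symD)

lemma E_trans: "(x, y) \<in> E \<Longrightarrow> (y, z) \<in> E \<Longrightarrow> (x, z) \<in> E"
  using equiv_E by (meson equiv_def transD)

lemma \<gamma>_space: "x \<in> space M \<Longrightarrow> \<gamma> j x \<in> space M"
  using measurable_space[OF \<gamma>_meas] .

lemma pred_eq [measurable (raw)]:
  assumes [measurable]: "f \<in> measurable N M" "g \<in> measurable N M"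
  shows "Measurable.pred N (\<lambda>w. f w = g w)"
proof -
  have "Measurable.pred N (\<lambda>w. c (f w) n = c (g w) n)" for n
    by (intro pred_eq_countable measurable_compose[OF assms(1) c_meas] measurable_compose[OF assms(2) c_meas])
  then have "Measurable.pred N (\<lambda>w. \<forall>n. c (f w) n = c (g w) n)"
    by (rule pred_intros_countable)
  moreover have "(f w = g w) = (\<forall>n. c (f w) n = c (g w) n)" if "w \<in> space N" for w
    using c_inj measurable_space[OF assms(1) that] measurable_space[OF assms(2) that]
    by (auto simp: inj_on_def fun_eq_iff)
  ultimately show ?thesis
    by (subst measurable_cong[where g = "\<lambda>w. \<forall>n. c (f w) n = c (g w) n"]) auto
qed

text \<open>The function \<open>r (Suc n)\<close> is coarser than \<open>r n\<close>, and \<open>r n x\<close> can be recovered from \<open>r (Suc n) x\<close> and a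
  natural number, the index \<open>k n x\<close> of a map \<open>\<gamma> j\<close> that leads back. So the first \<open>t\<close> indices together
  with \<open>r t x\<close> determine \<open>x\<close>, and two points are related if and only if their index sequences agree
  eventually and some \<open>r n\<close> identifies them. Eventual equality of sequences of natural numbers is a
  union of finite relations: at stage \<open>t\<close> only the first \<open>t\<close> entries may differ, and where two entries
  differ both have to be less than \<open>t\<close>.\<close>

lemma hypersmooth_union:
  assumes meas [measurable]: "\<And>n. r n \<in> measurable M M"
    and r0: "\<And>x. r 0 x = x"
    and desc: "\<And>n x y. \<lbrakk>x \<in> space M; y \<in> space M; r n x = r n y\<rbrakk> \<Longrightarrow> r (Suc n) x = r (Suc n) y"
    and step: "\<And>n x. x \<in> space M \<Longrightarrow> \<exists>j. \<gamma> j (r (Suc n) x) = r n x"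
  shows "\<exists>F. (\<forall>n. finite_borel_equivalence M (F n)) \<and> (\<forall>n. F n \<subseteq> F (Suc n)) \<and>
    (\<Union>n. F n) = {(x, y) \<in> space M \<times> space M. \<exists>n. r n x = r n y}"
proof -
  define k where "k n x = (LEAST j. \<gamma> j (r (Suc n) x) = r n x)" for n x
  have k: "\<gamma> (k n x) (r (Suc n) x) = r n x" if "x \<in> space M" for n x
    unfolding k_def using LeastI_ex[OF step[OF that]] .
  have k_meas: "k n \<in> measurable M (count_space UNIV)" for n
    unfolding k_def by measurable
  define P where "P t x y \<longleftrightarrow> r t x = r t y \<and> (\<forall>i<t. k i x = k i y \<or> (k i x < t \<and> k i y < t))" for t x y
  define F where "F t = {(x, y) \<in> space M \<times> space M. P t x y}" for t
  have meas_F: "F t \<in> sets (M \<Otimes>\<^sub>M M)" for t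
  proof -
    have [measurable]: "(\<lambda>z. k i (fst z)) \<in> measurable (M \<Otimes>\<^sub>M M) (count_space UNIV)"
      "(\<lambda>z. k i (snd z)) \<in> measurable (M \<Otimes>\<^sub>M M) (count_space UNIV)" for i
      by (rule measurable_compose[OF measurable_fst k_meas], rule measurable_compose[OF measurable_snd k_meas])
    have [measurable]: "Measurable.pred (M \<Otimes>\<^sub>M M) (\<lambda>z. r t (fst z) = r t (snd z))"
      by (intro pred_eq measurable_compose[OF measurable_fst meas] measurable_compose[OF measurable_snd meas])
    have [measurable]: "Measurable.pred (M \<Otimes>\<^sub>M M) (\<lambda>z. k i (fst z) = k i (snd z))" for i
      by (rule pred_eq_countable) measurable
    have "Measurable.pred (M \<Otimes>\<^sub>M M) (\<lambda>z. P t (fst z) (snd z))"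
      unfolding P_def by measurable
    then show ?thesis unfolding F_def by (rule pair_pred_sets)
  qed
  have eq_F: "equiv (space M) (F t)" for t
    unfolding F_def
  proof (rule equiv_CollectI)
    show "P t x z" if "P t x y" "P t y z" for x y z
      using that unfolding P_def by metis
    show "P t y x" if "P t x y" for x y
      using that unfolding P_def by metis
  qed (simp add: P_def)
  have determined: "x = y" if "x \<in> space M" "y \<in> space M" "r t x = r t y" "\<forall>i<t. k i x = k i y" for t x y
    using that(3,4)
  proof (induction t)
    case (Suc t)
    then have "r t x = r t y" using k[OF that(1)] k[OF that(2)] by (metis lessI)
    with Suc show ?case by auto
  qed (simp add: r0)
  have fin_F: "finite (F t `` {x})" if x: "x \<in> space M" for t x
  proof (rule inj_on_finite)
    show "inj_on (\<lambda>y. \<lambda>i\<in>{..<t}. k i y) (F t `` {x})"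
    proof (rule inj_onI)
      fix y z assume yz: "y \<in> F t `` {x}" "z \<in> F t `` {x}" and e: "(\<lambda>i\<in>{..<t}. k i y) = (\<lambda>i\<in>{..<t}. k i z)"
      have "k i y = k i z" if "i < t" for i using fun_cong[OF e, of i] that by simp
      with yz show "y = z" by (intro determined[of y z t]) (auto simp: F_def P_def)
    qed
    show "(\<lambda>y. \<lambda>i\<in>{..<t}. k i y) ` (F t `` {x}) \<subseteq> (\<Pi>\<^sub>E i\<in>{..<t}. insert (k i x) {..<t})"
    proof
      fix g assume "g \<in> (\<lambda>y. \<lambda>i\<in>{..<t}. k i y) ` (F t `` {x})"
      then obtain y where g: "g = (\<lambda>i\<in>{..<t}. k i y)" and y: "P t x y"
        by (auto simp: F_def)
      have "k i y \<in> insert (k i x) {..<t}" if "i < t" for i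
        using y that unfolding P_def by fastforce
      then show "g \<in> (\<Pi>\<^sub>E i\<in>{..<t}. insert (k i x) {..<t})"
        unfolding g by (intro restrict_PiE_iff[THEN iffD2]) simp
    qed
  qed (auto intro!: finite_PiE)
  have mono: "F t \<subseteq> F (Suc t)" for t
  proof -
    have "P (Suc t) x y" if "x \<in> space M" "y \<in> space M" "P t x y" for x y
    proof -
      have "k t x = k t y" using that desc[OF that(1,2)] by (simp add: k_def P_def)
      then show ?thesis using that desc[OF that(1,2)] by (auto simp: P_def less_Suc_eq)
    qed
    then show ?thesis by (auto simp: F_def)
  qed
  have "(\<Union>n. F n) = {(x, y) \<in> space M \<times> space M. \<exists>n. r n x = r n y}"
  proof -
    have "\<exists>t. P t x y" if xy: "x \<in> space M" "y \<in> space M" and n: "r n x = r n y" for x y n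
    proof -
      have later: "m \<ge> n \<Longrightarrow> r m x = r m y" for m
        by (induction m rule: dec_induct) (auto simp: n intro: desc[OF xy])
      then have later': "m \<ge> n \<Longrightarrow> k m x = k m y" for m
        by (simp add: k_def)
      define t where "t = Suc (Max (insert n ((\<lambda>i. k i x) ` {..<n} \<union> (\<lambda>i. k i y) ` {..<n})))"
      have "n < t" unfolding t_def by (auto simp: less_Suc_eq_le)
      moreover have "k i x < t \<and> k i y < t" if "i < n" for i
        unfolding t_def less_Suc_eq_le using that by (intro conjI Max_ge) auto
      ultimately have "P t x y"
        unfolding P_def using later later' by (metis less_imp_le not_le)
      then show ?thesis ..
    qed
    then show ?thesis by (auto simp: F_def P_def)
  qed
  with meas_F eq_F fin_F mono std show ?thesis
    unfolding finite_borel_equivalence_def borel_equivalence_def by blast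
qed

text \<open>The points \<open>\<gamma> i x\<close> with \<open>i < N x\<close> contain \<open>x\<close> and meet every class of the union of the \<open>F n\<close> that lies
  in the \<open>E\<close>-class of \<open>x\<close>. Relate \<open>x\<close> and \<open>y\<close> at stage \<open>n\<close> if their finite sets meet the same classes of
  \<open>F n\<close>. The classes of this relation are finite, since \<open>y\<close> itself has to be \<open>F n\<close>-related to one of the
  points \<open>\<gamma> j x\<close>. Any two \<open>E\<close>-related points are related at all late stages, since there are only
  finitely many pairs of points to be matched.\<close>

lemma finite_index_hyperfinite:
  assumes fin: "\<And>n. finite_borel_equivalence M (F n)" and mono: "\<And>n. F n \<subseteq> F (Suc n)"
    and sub: "(\<Union>n. F n) \<subseteq> E"
    and index: "\<And>x. x \<in> space M \<Longrightarrow>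
      \<exists>W. finite W \<and> W \<subseteq> E `` {x} \<and> (\<forall>y\<in>E `` {x}. \<exists>w\<in>W. (w, y) \<in> (\<Union>n. F n))"
  shows "hyperfinite M E"
proof -
  have F_sets [measurable]: "F n \<in> sets (M \<Otimes>\<^sub>M M)" for n
    using fin by (simp add: finite_borel_equivalence_def borel_equivalence_def)
  have F_equiv: "equiv (space M) (F n)" for n
    using fin by (simp add: finite_borel_equivalence_def borel_equivalence_def)
  have F_fin: "finite (F n `` {x})" if "x \<in> space M" for n x
    using fin that by (simp add: finite_borel_equivalence_def)
  have F_mono: "m \<le> n \<Longrightarrow> F m \<subseteq> F n" for m n
    using mono by (rule lift_Suc_mono_le)
  have [measurable]: "Measurable.pred (M \<Otimes>\<^sub>M M) (\<lambda>z. z \<in> F n)" for n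
    using F_sets by measurable
  have F_sym: "(x, y) \<in> F n \<Longrightarrow> (y, x) \<in> F n" for x y n
    using F_equiv by (meson equiv_def symD)
  have F_trans: "(x, y) \<in> F n \<Longrightarrow> (y, z) \<in> F n \<Longrightarrow> (x, z) \<in> F n" for x y z n
    using F_equiv by (meson equiv_def transD)
  have F_refl: "x \<in> space M \<Longrightarrow> (x, x) \<in> F n" for x n
    using F_equiv by (meson equiv_def refl_onD)
  have F_space: "(x, y) \<in> F n \<Longrightarrow> x \<in> space M \<and> y \<in> space M" for x y n
    using sub by (auto simp: E_def)
  have E_space: "(x, y) \<in> E \<Longrightarrow> x \<in> space M \<and> y \<in> space M" for x y
    by (auto simp: E_def)
  have E_\<gamma>: "x \<in> space M \<Longrightarrow> (x, \<gamma> i x) \<in> E" for x i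
    by (auto simp: E_def \<gamma>_space)
  have E_ex: "(x, y) \<in> E \<Longrightarrow> \<exists>i. \<gamma> i x = y" for x y
    by (auto simp: E_def)
  define full where "full x m \<longleftrightarrow> (\<exists>i<m. \<gamma> i x = x) \<and> (\<forall>j. \<exists>i<m. \<exists>n. (\<gamma> i x, \<gamma> j x) \<in> F n)" for x m
  have full_ex: "\<exists>m. full x m" if x: "x \<in> space M" for x
  proof -
    obtain W where W: "finite W" "W \<subseteq> E `` {x}" "\<forall>y\<in>E `` {x}. \<exists>w\<in>W. (w, y) \<in> (\<Union>n. F n)"
      using index[OF x] by blast
    have "\<exists>i. \<gamma> i x = w" if "w \<in> insert x W" for w
      using that W(2) E_ex equiv_E x by (auto simp: equiv_def refl_on_def)
    then obtain f where f: "\<And>w. w \<in> insert x W \<Longrightarrow> \<gamma> (f w) x = w" by metis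
    define m where "m = Suc (Max (f ` insert x W))"
    have fm: "f w < m" if "w \<in> insert x W" for w
      unfolding m_def less_Suc_eq_le using W(1) that by (intro Max_ge) auto
    have "full x m" unfolding full_def
    proof (intro conjI allI)
      show "\<exists>i<m. \<gamma> i x = x" using f[of x] fm[of x] by blast
      fix j
      have "\<gamma> j x \<in> E `` {x}" using E_\<gamma>[OF x] by auto
      then obtain w where "w \<in> W" "(w, \<gamma> j x) \<in> (\<Union>n. F n)" using W(3) by blast
      then show "\<exists>i<m. \<exists>n. (\<gamma> i x, \<gamma> j x) \<in> F n" using f[of w] fm[of w] by (metis UN_E insertI2)
    qed
    then show ?thesis ..
  qed
  define N where "N x = (LEAST m. full x m)" for x
  have full_N: "full x (N x)" if "x \<in> space M" for x
    unfolding N_def using LeastI_ex[OF full_ex[OF that]] .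
  have [measurable]: "N \<in> measurable M (count_space UNIV)"
    unfolding N_def full_def by measurable
  define C where "C n x y \<longleftrightarrow> (\<forall>i<N x. \<exists>j<N y. (\<gamma> i x, \<gamma> j y) \<in> F n)" for n x y
  define H where "H n = {(x, y) \<in> space M \<times> space M. C n x y \<and> C n y x}" for n
  have meas_H: "H n \<in> sets (M \<Otimes>\<^sub>M M)" for n
    unfolding H_def by (rule pair_pred_sets) (unfold C_def, measurable)
  have C_refl: "C n x x" if "x \<in> space M" for n x
    using F_refl \<gamma>_space[OF that] by (auto simp: C_def)
  have C_trans: "C n x z" if "C n x y" "C n y z" for n x y z
    using that F_trans unfolding C_def by meson
  have eq_H: "equiv (space M) (H n)" for n
    unfolding H_def by (rule equiv_CollectI) (use C_refl C_trans in blast)+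
  have self: "\<exists>i<N x. \<gamma> i x = x" if "x \<in> space M" for x
    using full_N[OF that] by (simp add: full_def)
  have fin_H: "finite (H n `` {x})" if x: "x \<in> space M" for n x
  proof (rule finite_subset)
    show "H n `` {x} \<subseteq> (\<Union>j<N x. F n `` {\<gamma> j x})"
    proof
      fix y assume "y \<in> H n `` {x}"
      then have y: "y \<in> space M" "C n y x" by (auto simp: H_def)
      obtain i where "i < N y" "\<gamma> i y = y" using self[OF y(1)] by blast
      then obtain j where "j < N x" "(y, \<gamma> j x) \<in> F n" using y(2) unfolding C_def by metis
      then show "y \<in> (\<Union>j<N x. F n `` {\<gamma> j x})" using F_sym by blast
    qed
    show "finite (\<Union>j<N x. F n `` {\<gamma> j x})" using F_fin \<gamma>_space[OF x] by auto
  qed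
  have mono_H: "H n \<subseteq> H (Suc n)" for n
    using mono[of n] by (auto simp: H_def C_def) (meson subsetD)+
  have H_E: "H n \<subseteq> E" for n
  proof
    fix z assume "z \<in> H n"
    then obtain x y where z: "z = (x, y)" "x \<in> space M" "y \<in> space M" "C n x y" by (auto simp: H_def)
    obtain i where "i < N x" "\<gamma> i x = x" using self[OF z(2)] by blast
    then obtain j where "(x, \<gamma> j y) \<in> F n" using z(4) unfolding C_def by metis
    then have "(x, \<gamma> j y) \<in> E" using sub by auto
    then show "z \<in> E" using z(1) E_trans E_sym E_\<gamma>[OF z(3)] by blast
  qed
  have C_ex: "\<exists>n. \<forall>n'\<ge>n. C n' x y" if xy: "(x, y) \<in> E" for x y
  proof -
    have sp: "x \<in> space M" "y \<in> space M" using E_space[OF xy] by auto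
    have "\<exists>n. \<exists>j<N y. (\<gamma> i x, \<gamma> j y) \<in> F n" for i
    proof -
      have "(y, \<gamma> i x) \<in> E" using E_trans E_sym xy E_\<gamma>[OF sp(1)] by blast
      then obtain l where l: "\<gamma> l y = \<gamma> i x" using E_ex by blast
      obtain j n where "j < N y" "(\<gamma> j y, \<gamma> l y) \<in> F n"
        using full_N[OF sp(2)] unfolding full_def by blast
      then show ?thesis using l F_sym by metis
    qed
    then obtain f where f: "\<And>i. \<exists>j<N y. (\<gamma> i x, \<gamma> j y) \<in> F (f i)" by metis
    have "C n' x y" if n': "n' \<ge> Max (insert 0 (f ` {..<N x}))" for n'
      unfolding C_def
    proof (intro allI impI)
      fix i assume "i < N x"
      then have "f i \<le> n'" using n' by simp
      then show "\<exists>j<N y. (\<gamma> i x, \<gamma> j y) \<in> F n'" using f[of i] F_mono by blast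
    qed
    then show ?thesis by blast
  qed
  have union: "E = (\<Union>n. H n)"
  proof
    show "E \<subseteq> (\<Union>n. H n)"
    proof
      fix z assume zE: "z \<in> E"
      obtain x y where z: "z = (x, y)" by (cases z)
      obtain n m where "\<forall>n'\<ge>n. C n' x y" "\<forall>n'\<ge>m. C n' y x"
        using C_ex zE E_sym z by metis
      then have "C (max n m) x y" "C (max n m) y x" by auto
      then show "z \<in> (\<Union>n. H n)" using z zE E_space by (auto simp: H_def)
    qed
  qed (use H_E in blast)
  have H_fbe: "finite_borel_equivalence M (H n)" for n
    using meas_H eq_H fin_H std by (auto simp: finite_borel_equivalence_def borel_equivalence_def)
  have "E \<in> sets (M \<Otimes>\<^sub>M M)" unfolding union using meas_H by auto
  then show ?thesis
    using H_fbe mono_H union std equiv_E unfolding hyperfinite_def borel_equivalence_def by blast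
qed

definition tail_rel :: "('a \<Rightarrow> 'a) \<Rightarrow> 'a \<Rightarrow> 'a \<Rightarrow> bool" where
  "tail_rel T x y \<longleftrightarrow> (\<exists>a b. (T ^^ a) x = (T ^^ b) y)"

lemma tail_rel_refl: "tail_rel T x x"
  by (auto simp: tail_rel_def)

lemma tail_rel_sym: "tail_rel T x y \<Longrightarrow> tail_rel T y x"
  by (metis tail_rel_def)

lemma tail_rel_trans:
  assumes "tail_rel T x y" "tail_rel T y z"
  shows "tail_rel T x z"
proof -
  obtain a b c' d where "(T ^^ a) x = (T ^^ b) y" "(T ^^ c') y = (T ^^ d) z"
    using assms by (auto simp: tail_rel_def)
  moreover have "(T ^^ c') ((T ^^ b) y) = (T ^^ b) ((T ^^ c') y)"
    by (metis add.commute comp_apply funpow_add)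
  ultimately have "(T ^^ (c' + a)) x = (T ^^ (b + d)) z"
    by (simp add: funpow_add)
  then show ?thesis unfolding tail_rel_def by blast
qed

lemma tail_rel_funpow: "tail_rel T x ((T ^^ a) x)"
  unfolding tail_rel_def by (rule exI[of _ a], rule exI[of _ 0]) simp

definition prefix_code :: "nat \<Rightarrow> 'a \<Rightarrow> nat list" where
  "prefix_code n x = map (c x) [0..<n]"

lemma prefix_code_Suc: "prefix_code (Suc n) x = prefix_code n x @ [c x n]"
  by (simp add: prefix_code_def)

lemma length_prefix_code [simp]: "length (prefix_code n x) = n"
  by (simp add: prefix_code_def)

lemma take_prefix_code: "m \<le> n \<Longrightarrow> take m (prefix_code n x) = prefix_code m x"
  by (simp add: prefix_code_def take_map)

lemma prefix_code_meas: "prefix_code n \<in> measurable M (count_space UNIV)"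
proof (induction n)
  case 0
  then show ?case by (simp add: prefix_code_def)
next
  case (Suc n)
  have "(\<lambda>x. w @ [c x n]) \<in> measurable M (count_space UNIV)" for w
    using measurable_compose[OF c_meas, of "\<lambda>a. w @ [a]" "count_space UNIV"] by simp
  from measurable_compose_countable[OF this Suc] show ?case
    by (simp add: prefix_code_Suc[abs_def])
qed

lemma prefix_code_inj:
  assumes "x \<in> space M" "y \<in> space M" "\<And>n. prefix_code n x = prefix_code n y"
  shows "x = y"
proof -
  have "c x n = c y n" for n
    using assms(3)[of "Suc n"] by (simp add: prefix_code_Suc)
  then show ?thesis using c_inj assms(1,2) by (auto simp: inj_on_def fun_eq_iff)
qed

text \<open>The relation \<open>T\<^sup>n x = T\<^sup>n y\<close> increases with \<open>n\<close>, but tail equivalent points may need different numbers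
  of steps to merge. Markers take care of the difference. Let \<open>s x n\<close> be the least word of length \<open>n\<close>
  that is an initial segment of the codes of infinitely many points of the orbit of \<open>x\<close>. These words
  depend on the tail class only, and \<open>s x (Suc n)\<close> extends \<open>s x n\<close>. Let \<open>r n\<close> send \<open>x\<close> to the first point
  of its orbit whose code starts with \<open>s x n\<close>. If the hitting times tend to infinity, then they
  eventually exceed the merging times of \<open>x\<close> and \<open>y\<close>, and \<open>r n x = r n y\<close> follows. If they stay bounded,
  then the orbit contains the point whose code is the limit of the words \<open>s x n\<close>. There is at most one
  such point; where it belongs to the tail class of \<open>x\<close>, all functions \<open>r n\<close> with \<open>n > 0\<close> send \<open>x\<close>
  there, even if the orbit of \<open>x\<close> misses it.\<close>

lemma tail_rel_union:
  assumes T [measurable]: "T \<in> measurable M M"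
    and TE: "\<And>x. x \<in> space M \<Longrightarrow> (x, T x) \<in> E"
  shows "\<exists>F. (\<forall>n. finite_borel_equivalence M (F n)) \<and> (\<forall>n. F n \<subseteq> F (Suc n)) \<and>
    (\<Union>n. F n) = {(x, y) \<in> space M \<times> space M. tail_rel T x y}"
proof -
  have Tn: "T ^^ a \<in> measurable M M" for a
  proof (induction a)
    case (Suc a)
    then show ?case using measurable_comp[OF Suc T] by simp
  qed (simp add: id_def)
  have Tn_space: "x \<in> space M \<Longrightarrow> (T ^^ a) x \<in> space M" for x a
    using measurable_space[OF Tn] .
  have Tn_E: "x \<in> space M \<Longrightarrow> (x, (T ^^ a) x) \<in> E" for x a
    by (induction a) (auto intro: E_refl E_trans TE Tn_space)
  have tail_E: "(x, y) \<in> E" if "x \<in> space M" "y \<in> space M" "tail_rel T x y" for x y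
    using that Tn_E E_sym E_trans unfolding tail_rel_def by metis
  define Q where "Q x w \<longleftrightarrow> (\<forall>m. \<exists>i\<ge>m. prefix_code (length w) ((T ^^ i) x) = w)" for x w
  have Q_step: "\<exists>a. Q x (w @ [a])" if x: "x \<in> space M" and w: "Q x w" for x w
  proof -
    define I where "I = {i. prefix_code (length w) ((T ^^ i) x) = w}"
    define f where "f i = c ((T ^^ i) x) (length w)" for i
    have "infinite I"
      using w unfolding I_def Q_def infinite_nat_iff_unbounded_le by simp
    moreover have "finite (f ` I)"
      by (rule finite_subset[OF _ c_fin[of "length w"]]) (auto simp: f_def Tn_space x)
    ultimately obtain i0 where i0: "infinite {i \<in> I. f i = f i0}"
      using pigeonhole_infinite by blast
    have "Q x (w @ [f i0])"
      using i0 unfolding Q_def infinite_nat_iff_unbounded_le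
      by (auto simp: I_def f_def prefix_code_Suc)
    then show ?thesis ..
  qed
  define s where "s x n = lexmin (Q x) n" for x n
  have Q_s: "Q x (s x n)" if "x \<in> space M" for x n
    unfolding s_def by (rule lexmin_holds) (use Q_step[OF that] in \<open>auto simp: Q_def prefix_code_def\<close>)
  have Q_shift: "Q ((T ^^ a) x) = Q x" for a x
  proof
    fix w
    have "(\<forall>m. \<exists>i\<ge>m. R (i + a)) \<longleftrightarrow> (\<forall>m. \<exists>i\<ge>m. R i)" for R :: "nat \<Rightarrow> bool"
    proof
      assume L: "\<forall>m. \<exists>i\<ge>m. R (i + a)"
      show "\<forall>m. \<exists>i\<ge>m. R i" using L by (meson le_add1 le_trans)
    next
      assume R: "\<forall>m. \<exists>i\<ge>m. R i"
      show "\<forall>m. \<exists>i\<ge>m. R (i + a)"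
      proof
        fix m
        obtain i where "i \<ge> m + a" "R i" using R by blast
        then show "\<exists>i\<ge>m. R (i + a)" by (intro exI[of _ "i - a"]) auto
      qed
    qed
    from this[of "\<lambda>i. prefix_code (length w) ((T ^^ i) x) = w"]
    show "Q ((T ^^ a) x) w = Q x w" by (simp add: Q_def funpow_add)
  qed
  have Q_tail: "Q x = Q y" if "tail_rel T x y" for x y
    using that Q_shift unfolding tail_rel_def by metis
  have s_tail: "s x = s y" if "tail_rel T x y" for x y
    by (rule ext) (simp add: s_def Q_tail[OF that])
  define hit where "hit x n = (LEAST i. prefix_code n ((T ^^ i) x) = s x n)" for x n
  have hit_ex: "\<exists>i. prefix_code n ((T ^^ i) x) = s x n" if "x \<in> space M" for x n
    using Q_s[OF that, of n] unfolding Q_def s_def by auto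
  have hit: "prefix_code n ((T ^^ hit x n) x) = s x n" if "x \<in> space M" for x n
    unfolding hit_def using LeastI_ex[OF hit_ex[OF that]] .
  have hit_le: "hit x n \<le> i" if "prefix_code n ((T ^^ i) x) = s x n" for x n i
    unfolding hit_def using that by (rule Least_le)
  have prefix_s: "prefix_code m y = s x m" if "prefix_code n y = s x n" "m \<le> n" for m n x y
    using that by (metis s_def take_lexmin take_prefix_code)
  have hit_mono: "hit x m \<le> hit x n" if "x \<in> space M" "m \<le> n" for x m n
    by (rule hit_le, rule prefix_s[OF hit[OF that(1)] that(2)])
  have hit_add: "hit x n = a + hit ((T ^^ a) x) n" if "x \<in> space M" "a \<le> hit x n" for x a n
  proof (rule antisym)
    have e: "s ((T ^^ a) x) = s x" using s_tail[OF tail_rel_funpow] by metis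
    have "prefix_code n ((T ^^ (hit ((T ^^ a) x) n + a)) x) = s x n"
      using hit[OF Tn_space[OF that(1)], of n a] e by (simp add: funpow_add)
    then show "hit x n \<le> a + hit ((T ^^ a) x) n" using hit_le by (metis add.commute)
    have "prefix_code n ((T ^^ (hit x n - a)) ((T ^^ a) x)) = s ((T ^^ a) x) n"
      using hit[OF that(1), of n] e that(2) by (metis comp_apply funpow_add le_add_diff_inverse2)
    then show "a + hit ((T ^^ a) x) n \<le> hit x n" using hit_le that(2) by fastforce
  qed
  \<comment> \<open>The code of \<open>y\<close> is the limit of the marker words, and \<open>y\<close> lies in the tail class of \<open>x\<close>.\<close>
  define lim where "lim x y \<longleftrightarrow> (\<forall>n. prefix_code n y = s x n) \<and> tail_rel T x y" for x y
  have lim_uniq: "y = z" if "y \<in> space M" "z \<in> space M" "lim x y" "lim x z" for x y z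
    using that by (intro prefix_code_inj) (auto simp: lim_def)
  have lim_tail: "lim x p = lim y p" if "tail_rel T x y" for x y p
    using s_tail[OF that] that tail_rel_trans tail_rel_sym unfolding lim_def by metis
  define L where "L x \<longleftrightarrow> (\<exists>j. lim x (\<gamma> j x))" for x
  define p where "p x = \<gamma> (LEAST j. lim x (\<gamma> j x)) x" for x
  have p: "lim x (p x)" if "L x" for x
    unfolding p_def using LeastI_ex[OF that[unfolded L_def]] .
  have p_space: "x \<in> space M \<Longrightarrow> p x \<in> space M" for x
    by (simp add: p_def \<gamma>_space)
  have limL: "L x" if "x \<in> space M" "q \<in> space M" "lim x q" for x q
    using tail_E[OF that(1,2)] that(3) by (auto simp: L_def lim_def E_def)
  have L_tail: "L y \<and> p x = p y" if "x \<in> space M" "y \<in> space M" "tail_rel T x y" "L x" for x y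
  proof -
    have "lim y (p x)" using p[OF that(4)] lim_tail[OF that(3)] by simp
    moreover from this have "L y" using limL that p_space by blast
    ultimately show ?thesis using lim_uniq p p_space that(1,2) by blast
  qed
  define r where "r n x = (if n = 0 then x else if L x then p x else (T ^^ hit x n) x)" for n x
  have r_tail: "tail_rel T x (r n x)" for n x
    using p[of x] by (auto simp: r_def lim_def tail_rel_refl tail_rel_funpow)
  have r_space: "r n x \<in> space M" if "x \<in> space M" for n x
    using that p_space Tn_space by (auto simp: r_def)
  have s_meas [measurable]: "(\<lambda>x. s x n) \<in> measurable M (count_space UNIV)" for n
    unfolding s_def
  proof (rule measurable_lexmin)
    fix w
    have [measurable]: "Measurable.pred M (\<lambda>x. prefix_code (length w) ((T ^^ i) x) = w)" for i
      using measurable_compose[OF measurable_compose[OF Tn prefix_code_meas], of "\<lambda>v. v = w" "count_space UNIV"]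
      by simp
    show "Measurable.pred M (\<lambda>x. Q x w)"
      unfolding Q_def by measurable
  qed
  have [measurable]: "Measurable.pred M (\<lambda>x. prefix_code n ((T ^^ i) x) = s x n)" for n i
    by (intro pred_eq_countable s_meas measurable_compose[OF Tn prefix_code_meas])
  have [measurable]: "Measurable.pred M (\<lambda>x. prefix_code n (\<gamma> j x) = s x n)" for n j
    by (intro pred_eq_countable s_meas measurable_compose[OF \<gamma>_meas prefix_code_meas])
  have [measurable]: "Measurable.pred M (\<lambda>x. (T ^^ a) x = (T ^^ b) (\<gamma> j x))" for a b j
    by (intro pred_eq Tn measurable_compose[OF \<gamma>_meas Tn])
  have hit_meas: "(\<lambda>x. hit x n) \<in> measurable M (count_space UNIV)" for n
    unfolding hit_def by measurable
  have lim_meas [measurable]: "Measurable.pred M (\<lambda>x. lim x (\<gamma> j x))" for j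
    unfolding lim_def tail_rel_def by measurable
  have [measurable]: "Measurable.pred M L"
    unfolding L_def by measurable
  have Least_meas: "(\<lambda>x. LEAST j. lim x (\<gamma> j x)) \<in> measurable M (count_space UNIV)"
    by measurable
  have p_meas: "p \<in> measurable M M"
    unfolding p_def by (rule measurable_compose_countable[OF \<gamma>_meas Least_meas])
  have r_meas: "r n \<in> measurable M M" for n
  proof (cases "n = 0")
    case False
    have "(\<lambda>x. if L x then p x else (T ^^ hit x n) x) \<in> measurable M M"
      by (rule measurable_If[OF p_meas measurable_compose_countable[OF Tn hit_meas]]) measurable
    then show ?thesis using False by (simp add: r_def[abs_def])
  qed (simp add: r_def[abs_def])
  have tail_of_eq: "tail_rel T x y" if "r n x = r n y" for n x y
    using r_tail[of x n] r_tail[of y n] that tail_rel_sym tail_rel_trans by metis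
  have hit_Suc: "(T ^^ hit x (Suc n)) x = (T ^^ hit (r n x) (Suc n)) (r n x)"
    if "x \<in> space M" "\<not> L x" "n \<noteq> 0" for x n
  proof -
    have rn: "r n x = (T ^^ hit x n) x" using that by (simp add: r_def)
    have "hit x (Suc n) = hit x n + hit (r n x) (Suc n)"
      unfolding rn by (rule hit_add[OF that(1) hit_mono[OF that(1)]]) simp
    then show ?thesis unfolding rn by (metis add.commute comp_apply funpow_add)
  qed
  have desc: "r (Suc n) x = r (Suc n) y" if "x \<in> space M" "y \<in> space M" "r n x = r n y" for n x y
  proof (cases "n = 0")
    case False
    show ?thesis
    proof (cases "L x")
      case True
      then show ?thesis using L_tail[OF that(1,2) tail_of_eq[OF that(3)]] by (simp add: r_def)
    next
      case nL: False
      then have "\<not> L y" using L_tail[OF that(2,1) tail_rel_sym[OF tail_of_eq[OF that(3)]]] by blast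
      then show ?thesis using nL hit_Suc[OF that(1) nL False] hit_Suc[OF that(2) _ False] that(3)
        by (simp add: r_def)
    qed
  qed (use that in \<open>simp add: r_def\<close>)
  have step: "\<exists>j. \<gamma> j (r (Suc n) x) = r n x" if "x \<in> space M" for n x
  proof -
    have "tail_rel T (r (Suc n) x) (r n x)"
      using r_tail tail_rel_sym tail_rel_trans by blast
    then show ?thesis using tail_E r_space[OF that] by (auto simp: E_def)
  qed
  have unbounded: "\<exists>n. a \<le> hit x n" if x: "x \<in> space M" and nL: "\<not> L x" for x a
  proof (rule ccontr)
    assume "\<nexists>n. a \<le> hit x n"
    then have "range (hit x) \<subseteq> {..<a}" by (auto simp: not_le)
    then have fin: "finite (range (hit x))" by (rule finite_subset) simp
    define h where "h = Max (range (hit x))"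
    obtain n0 where n0: "hit x n0 = h" using Max_in[OF fin] unfolding h_def by auto
    have h: "hit x n = h" if "n \<ge> n0" for n
      using hit_mono[OF x that] n0 Max_ge[OF fin, of "hit x n"] unfolding h_def by auto
    have "prefix_code n ((T ^^ h) x) = s x n" for n
    proof (rule prefix_s)
      show "prefix_code (max n n0) ((T ^^ h) x) = s x (max n n0)"
        using hit[OF x, of "max n n0"] h[of "max n n0"] by simp
    qed simp
    then have "lim x ((T ^^ h) x)" by (simp add: lim_def tail_rel_funpow)
    then show False using limL x Tn_space nL by blast
  qed
  have union: "(\<exists>n. r n x = r n y) \<longleftrightarrow> tail_rel T x y" if x: "x \<in> space M" and y: "y \<in> space M" for x y
  proof
    assume t: "tail_rel T x y"
    show "\<exists>n. r n x = r n y"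
    proof (cases "L x")
      case True
      then show ?thesis using L_tail[OF x y t] by (auto simp: r_def intro!: exI[of _ 1])
    next
      case nL: False
      then have nL': "\<not> L y" using L_tail[OF y x tail_rel_sym[OF t]] by blast
      obtain a b where ab: "(T ^^ a) x = (T ^^ b) y" using t by (auto simp: tail_rel_def)
      obtain n m where nm: "a \<le> hit x n" "b \<le> hit y m" using unbounded x y nL nL' by meson
      define k where "k = Suc (max n m)"
      have "a \<le> hit x k" "b \<le> hit y k"
        using le_trans[OF nm(1) hit_mono[OF x, of n k]] le_trans[OF nm(2) hit_mono[OF y, of m k]]
        by (auto simp: k_def)
      then have e: "hit x k = a + hit ((T ^^ a) x) k" "hit y k = b + hit ((T ^^ b) y) k"
        using hit_add x y by blast+
      define h where "h = hit ((T ^^ a) x) k"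
      have "hit x k = h + a" "hit y k = h + b" using e ab by (auto simp: h_def)
      then have "(T ^^ hit x k) x = (T ^^ hit y k) y" using ab by (simp add: funpow_add)
      then have "r k x = r k y" using nL nL' by (simp add: r_def k_def)
      then show ?thesis ..
    qed
  qed (use tail_of_eq in blast)
  have "\<exists>F. (\<forall>n. finite_borel_equivalence M (F n)) \<and> (\<forall>n. F n \<subseteq> F (Suc n)) \<and>
      (\<Union>n. F n) = {(x, y) \<in> space M \<times> space M. \<exists>n. r n x = r n y}"
    by (rule hypersmooth_union) (rule r_meas, simp add: r_def, erule (2) desc, erule step)
  moreover have "{(x, y) \<in> space M \<times> space M. \<exists>n. r n x = r n y} =
      {(x, y) \<in> space M \<times> space M. tail_rel T x y}"
    using union by auto
  ultimately show ?thesis by simp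
qed

theorem hyperfinite_if_finite_tail_index:
  assumes T: "T \<in> measurable M M"
    and TE: "\<And>x. x \<in> space M \<Longrightarrow> (x, T x) \<in> E"
    and index: "\<And>x. x \<in> space M \<Longrightarrow>
      \<exists>W. finite W \<and> W \<subseteq> E `` {x} \<and> (\<forall>y\<in>E `` {x}. \<exists>w\<in>W. tail_rel T w y)"
  shows "hyperfinite M E"
proof -
  obtain F where F: "\<And>n. finite_borel_equivalence M (F n)" "\<And>n. F n \<subseteq> F (Suc n)"
      "(\<Union>n. F n) = {(x, y) \<in> space M \<times> space M. tail_rel T x y}"
    using tail_rel_union[OF T TE] by blast
  have Tn: "x \<in> space M \<Longrightarrow> (T ^^ a) x \<in> space M \<and> (x, (T ^^ a) x) \<in> E" for x a
    by (induction a) (auto intro: E_refl E_trans TE measurable_space[OF T])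
  have "tail_rel T x y \<Longrightarrow> x \<in> space M \<Longrightarrow> y \<in> space M \<Longrightarrow> (x, y) \<in> E" for x y
    using Tn E_sym E_trans unfolding tail_rel_def by metis
  then have sub: "(\<Union>n. F n) \<subseteq> E" unfolding F(3) by auto
  show ?thesis
  proof (rule finite_index_hyperfinite[OF F(1,2) sub])
    fix x assume "x \<in> space M"
    from index[OF this] obtain W where
      W: "finite W" "W \<subseteq> E `` {x}" "\<forall>y\<in>E `` {x}. \<exists>w\<in>W. tail_rel T w y"
      by (elim exE conjE)
    have related: "\<exists>w\<in>W. (w, y) \<in> (\<Union>n. F n)" if y: "y \<in> E `` {x}" for y
    proof -
      from bspec[OF W(3) y] obtain w where w: "w \<in> W" "tail_rel T w y" by (rule bexE)
      have "(x, w) \<in> E" "(x, y) \<in> E" using w(1) W(2) y by blast+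
      then have "w \<in> space M" "y \<in> space M" unfolding E_def by blast+
      then have "(w, y) \<in> (\<Union>n. F n)" unfolding F(3) using w(2) by simp
      then show ?thesis using w(1) by (rule bexI)
    qed
    show "\<exists>W. finite W \<and> W \<subseteq> E `` {x} \<and> (\<forall>y\<in>E `` {x}. \<exists>w\<in>W. (w, y) \<in> (\<Union>n. F n))"
      by (rule exI[of _ W], rule conjI[OF W(1) conjI[OF W(2) ballI]], rule related)
  qed
qed

end

section \<open>Stability of quasi-geodesics\<close>

lemma linear_le_power2: "\<exists>K. \<forall>k\<ge>K. a * k + b \<le> (2::nat) ^ k"
proof -
  define n where "n = 2 * a + b + 1"
  have "a * k + b \<le> 2 ^ k" if "k \<ge> 2 * n" for k
    using that
  proof (induction k rule: dec_induct)
    case base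
    have "a * (2 * n) + b \<le> (n + 1) * (n + 1)" by (simp add: n_def algebra_simps)
    also have "\<dots> \<le> 2 ^ n * 2 ^ n" by (intro mult_le_mono) (simp_all add: Suc_le_eq)
    finally show ?case by (simp add: power_add[symmetric] mult_2)
  next
    case (step k)
    have "1 \<le> k" using step(1) by (simp add: n_def)
    then have "a \<le> a * k" by simp
    then show ?case using step(3) by (simp only: power_Suc mult_Suc_right)
  qed
  then show ?thesis by blast
qed

text \<open>A number that is bounded by the logarithm of a linear function of itself is bounded. In the stability
  of quasi-geodesics, \<open>D\<close> is the largest distance of a point of a geodesic from the quasi-geodesic.\<close>

lemma log_bound:
  fixes A B L :: nat
  shows "\<exists>D0. \<forall>D. (\<forall>k. L * (6 * D + 1) \<le> 2 ^ k \<longrightarrow> D \<le> A + B * k) \<longrightarrow> D \<le> D0"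
proof -
  \<comment> \<open>A positive slope lets \<open>k\<close> be chosen with \<open>A + B' * (k - 1) < D \<le> A + B' * k\<close>.\<close>
  define B' where "B' = B + 1"
  obtain K where K: "\<And>k. k \<ge> K \<Longrightarrow> (6 * L * B') * k + L * (6 * (A + B') + 1) \<le> 2 ^ k"
    using linear_le_power2 by blast
  show ?thesis
  proof (intro exI[of _ "A + B' * K"] allI impI, rule ccontr)
    fix D assume D: "\<forall>k. L * (6 * D + 1) \<le> 2 ^ k \<longrightarrow> D \<le> A + B * k" and big: "\<not> D \<le> A + B' * K"
    have ex: "D \<le> A + B' * D" by (simp add: B'_def)
    define k where "k = (LEAST k. D \<le> A + B' * k)"
    have k: "D \<le> A + B' * k" unfolding k_def using ex by (rule LeastI)
    have "K < k"
    proof (rule ccontr)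
      assume "\<not> K < k"
      then have "B' * k \<le> B' * K" by (intro mult_le_mono2) simp
      then show False using k big by linarith
    qed
    then obtain l where l: "k = Suc l" "K \<le> l" by (metis Suc_le_D Suc_le_mono less_eq_Suc_le)
    have "\<not> D \<le> A + B' * l"
      using not_less_Least[of l "\<lambda>k. D \<le> A + B' * k"] l(1) by (simp add: k_def)
    moreover have "D \<le> A + B * l"
    proof (rule D[rule_format])
      have "L * (6 * D + 1) \<le> L * (6 * (A + B' * Suc l) + 1)"
        using k l(1) by (intro mult_le_mono) auto
      also have "\<dots> = (6 * L * B') * l + L * (6 * (A + B') + 1)" by (simp add: algebra_simps)
      finally show "L * (6 * D + 1) \<le> 2 ^ l" using K[OF l(2)] by linarith
    qed
    ultimately show False by (simp add: B'_def)
  qed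
qed

text \<open>Koenig's lemma: functions that take finitely many values at each place have a limit along smaller and
  smaller infinite sets of indices.\<close>

lemma koenig_diagonal:
  fixes f :: "nat \<Rightarrow> nat \<Rightarrow> 'a"
  assumes "\<And>t. finite (range (\<lambda>n. f n t))"
  shows "\<exists>g. \<forall>t. infinite {n. \<forall>i\<le>t. f n i = g i}"
proof -
  have "\<exists>S :: nat \<Rightarrow> nat set. \<forall>t. infinite (S t) \<and> S (Suc t) \<subseteq> S t \<and> (\<exists>v. \<forall>n\<in>S (Suc t). f n t = v)"
  proof (rule dependent_nat_choice[where P = "\<lambda>_. infinite"
        and Q = "\<lambda>t S S'. S' \<subseteq> S \<and> (\<exists>v. \<forall>n\<in>S'. f n t = v)"])
    fix S :: "nat set" and t
    assume S: "infinite S"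
    have "finite ((\<lambda>n. f n t) ` S)" using assms[of t] by (rule rev_finite_subset) auto
    then obtain n0 where "infinite {n \<in> S. f n t = f n0 t}" using pigeonhole_infinite[OF S] by blast
    then show "\<exists>S'. infinite S' \<and> S' \<subseteq> S \<and> (\<exists>v. \<forall>n\<in>S'. f n t = v)"
      by (intro exI[of _ "{n \<in> S. f n t = f n0 t}"]) auto
  qed (auto intro: exI[of _ UNIV])
  then obtain S where S: "\<And>t. infinite (S t)" "\<And>t. S (Suc t) \<subseteq> S t" "\<And>t. \<exists>v. \<forall>n\<in>S (Suc t). f n t = v"
    by blast
  then obtain g where g: "\<And>t. \<forall>n\<in>S (Suc t). f n t = g t" by metis
  have mono: "i \<le> t \<Longrightarrow> S t \<subseteq> S i" for i t
    using S(2) by (rule lift_Suc_antimono_le)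
  have "S (Suc t) \<subseteq> {n. \<forall>i\<le>t. f n i = g i}" for t
  proof
    fix n assume n: "n \<in> S (Suc t)"
    have "f n i = g i" if "i \<le> t" for i
      using g[of i] mono[of "Suc i" "Suc t"] n that by auto
    then show "n \<in> {n. \<forall>i\<le>t. f n i = g i}" by blast
  qed
  then have "infinite {n. \<forall>i\<le>t. f n i = g i}" for t
    by (rule infinite_super) (rule S(1))
  then show ?thesis by (intro exI allI)
qed

text \<open>The vertices of a connected graph with the path metric. Distances are natural numbers, which keeps
  the estimates within linear arithmetic.\<close>

locale discrete_geodesic =
  fixes V :: "'v set" and d :: "'v \<Rightarrow> 'v \<Rightarrow> nat"
  assumes d_refl [simp]: "d x x = 0"
    and d_zero: "\<lbrakk>x \<in> V; y \<in> V; d x y = 0\<rbrakk> \<Longrightarrow> x = y"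
    and d_sym: "d x y = d y x"
    and tri: "\<lbrakk>x \<in> V; y \<in> V; z \<in> V\<rbrakk> \<Longrightarrow> d x z \<le> d x y + d y z"
    and geod: "\<lbrakk>x \<in> V; y \<in> V\<rbrakk> \<Longrightarrow> \<exists>f. f 0 = x \<and> f (d x y) = y \<and> (\<forall>i\<le>d x y. f i \<in> V) \<and>
      (\<forall>i j. i \<le> j \<longrightarrow> j \<le> d x y \<longrightarrow> d (f i) (f j) = j - i)"
begin

definition btw :: "'v \<Rightarrow> 'v \<Rightarrow> 'v \<Rightarrow> bool" where
  "btw x w z \<longleftrightarrow> w \<in> V \<and> d x w + d w z = d x z"

text \<open>Thin triangles are stated for points between the corners instead of points on chosen geodesic sides.
  So no paths have to be chosen, and the condition covers all geodesics between the corners.\<close>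

definition thin_triangles :: "nat \<Rightarrow> bool" where
  "thin_triangles \<delta> \<longleftrightarrow> (\<forall>x\<in>V. \<forall>y\<in>V. \<forall>z\<in>V. \<forall>w. btw x w z \<longrightarrow> (\<exists>u. (btw x u y \<or> btw y u z) \<and> d w u \<le> \<delta>))"

text \<open>Quasi-geodesics with \<open>m\<close> jumps of size at most \<open>J\<close>. The summand \<open>1\<close> permits points with
  different indices to coincide.\<close>

definition qpath :: "nat \<Rightarrow> nat \<Rightarrow> nat \<Rightarrow> (nat \<Rightarrow> 'v) \<Rightarrow> bool" where
  "qpath J L m c \<longleftrightarrow> (\<forall>i\<le>m. c i \<in> V) \<and> (\<forall>i<m. d (c i) (c (Suc i)) \<le> J) \<and>
     (\<forall>i j. i \<le> j \<longrightarrow> j \<le> m \<longrightarrow> j - i \<le> L * (d (c i) (c j) + 1))"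

lemma btw_V: "btw x w z \<Longrightarrow> w \<in> V"
  by (simp add: btw_def)

lemma btw_sym: "btw x w z \<Longrightarrow> btw z w x"
  by (simp add: btw_def d_sym add.commute)

lemma btw_self: "x \<in> V \<Longrightarrow> btw x u x \<Longrightarrow> u = x"
  using d_zero[of x u] by (simp add: btw_def)

lemma thinD: "thin_triangles \<delta> \<Longrightarrow> btw x w z \<Longrightarrow> x \<in> V \<Longrightarrow> y \<in> V \<Longrightarrow> z \<in> V \<Longrightarrow>
    \<exists>u. (btw x u y \<or> btw y u z) \<and> d w u \<le> \<delta>"
  by (simp add: thin_triangles_def)

lemma point_at:
  assumes "x \<in> V" "y \<in> V" "t \<le> d x y"
  shows "\<exists>u. btw x u y \<and> d x u = t"
proof -
  obtain f where f: "f 0 = x" "f (d x y) = y" "\<And>i. i \<le> d x y \<Longrightarrow> f i \<in> V"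
      "\<And>i j. i \<le> j \<Longrightarrow> j \<le> d x y \<Longrightarrow> d (f i) (f j) = j - i"
    using geod[OF assms(1,2)] by blast
  have "d x (f t) = t" "d (f t) y = d x y - t"
    using f(4)[of 0 t] f(4)[of t "d x y"] f(1,2) assms(3) by auto
  then show ?thesis using f(3)[of t] assms(3) by (intro exI[of _ "f t"]) (simp add: btw_def)
qed

text \<open>The distance of a geodesic from a path with the same ends grows at most logarithmically with the
  number of jumps: halving the path replaces the geodesic by one of two shorter geodesics at the cost
  of \<open>\<delta>\<close>.\<close>

lemma btw_near_path:
  assumes thin_triangles: "thin_triangles \<delta>"
  shows "\<lbrakk>\<forall>i\<le>m. c i \<in> V; \<forall>i<m. d (c i) (c (Suc i)) \<le> J; m \<le> 2 ^ k; btw (c 0) w (c m)\<rbrakk>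
    \<Longrightarrow> \<exists>i\<le>m. d w (c i) \<le> \<delta> * k + J"
proof (induction k arbitrary: m c w)
  case 0
  show ?case
  proof (cases "m = 0")
    case True
    then show ?thesis using 0 btw_self[of "c 0" w] by auto
  next
    case False
    then have m: "m = 1" using 0 by simp
    have "d (c 0) w \<le> d (c 0) (c 1)" using 0(4) m by (auto simp: btw_def)
    also have "\<dots> \<le> J" using 0(2) m by simp
    finally show ?thesis using d_sym[of w "c 0"] by (intro exI[of _ 0]) simp
  qed
next
  case (Suc k)
  define h where "h = m div 2"
  have h: "h \<le> m" "h \<le> 2 ^ k" "m - h \<le> 2 ^ k" using Suc.prems(3) by (auto simp: h_def)
  obtain u where u: "btw (c 0) u (c h) \<or> btw (c h) u (c m)" "d w u \<le> \<delta>"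
    using thinD[OF thin_triangles Suc.prems(4), of "c h"] Suc.prems(1) h(1) by auto
  have "\<exists>i\<le>m. d u (c i) \<le> \<delta> * k + J"
    using u(1)
  proof
    assume "btw (c 0) u (c h)"
    moreover have "\<forall>i\<le>h. c i \<in> V" "\<forall>i<h. d (c i) (c (Suc i)) \<le> J" using Suc.prems(1,2) h(1) by auto
    ultimately obtain i where "i \<le> h" "d u (c i) \<le> \<delta> * k + J" using Suc.IH h(2) by blast
    then show ?thesis using h(1) by (intro exI[of _ i]) auto
  next
    assume "btw (c h) u (c m)"
    then have "btw (c (h + 0)) u (c (h + (m - h)))" using h(1) by simp
    from Suc.IH[of "m - h" "\<lambda>i. c (h + i)" u, OF _ _ h(3)] this Suc.prems(1,2) h(1)
    obtain i where "i \<le> m - h" "d u (c (h + i)) \<le> \<delta> * k + J" by auto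
    then show ?thesis using h(1) by (intro exI[of _ "h + i"]) auto
  qed
  then obtain i where i: "i \<le> m" "d u (c i) \<le> \<delta> * k + J" by blast
  have "d w (c i) \<le> d w u + d u (c i)"
    using tri btw_V Suc.prems(1,4) u(1) i(1) by blast
  then show ?case using i u(2) by (intro exI[of _ i]) auto
qed

lemma path_length:
  assumes "\<forall>i\<le>m. c i \<in> V" "\<forall>i<m. d (c i) (c (Suc i)) \<le> J" "i \<le> j" "j \<le> m"
  shows "d (c i) (c j) \<le> J * (j - i)"
  using assms(3,4)
proof (induction j rule: dec_induct)
  case (step n)
  have "d (c i) (c (Suc n)) \<le> d (c i) (c n) + d (c n) (c (Suc n))"
    using step assms(1) by (intro tri) auto
  also have "\<dots> \<le> J * (n - i) + J"
    using step assms(2) by (intro add_mono) auto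
  also have "\<dots> = J * (Suc n - i)" using step(1) by (simp add: Suc_diff_le)
  finally show ?case .
qed simp

text \<open>Let \<open>w\<close> be a point of the geodesic at the largest distance \<open>D\<close> from the path. From the points \<open>y\<close> and
  \<open>z\<close> of the geodesic at distance \<open>2 D\<close> on both sides of \<open>w\<close> (or from the ends of the geodesic, if these
  are closer) one reaches points \<open>c i\<close> and \<open>c j\<close> of the path within distance \<open>D\<close>. The connections stay at
  distance at least \<open>D\<close> from \<open>w\<close>, so unless \<open>D \<le> 2 \<delta>\<close> the point \<open>w\<close> is close to a geodesic between \<open>c i\<close>
  and \<open>c j\<close>. Since \<open>c i\<close> and \<open>c j\<close> are at distance at most \<open>6 D\<close>, the part of the path between them has a
  number of jumps that is linear in \<open>D\<close>, and \<open>btw_near_path\<close> bounds \<open>D\<close> by the logarithm of that number.\<close>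

lemma geodesic_near_qpath:
  assumes thin_triangles: "thin_triangles \<delta>"
  shows "\<exists>D. \<forall>m c w. qpath J L m c \<longrightarrow> btw (c 0) w (c m) \<longrightarrow> (\<exists>i\<le>m. d w (c i) \<le> D)"
proof -
  obtain D0 where D0: "\<And>D. (\<And>k. L * (6 * D + 1) \<le> 2 ^ k \<Longrightarrow> D \<le> (2 * \<delta> + J) + \<delta> * k) \<Longrightarrow> D \<le> D0"
    using log_bound[of L "2 * \<delta> + J" \<delta>] by blast
  show ?thesis
  proof (rule exI[of _ D0], intro allI impI)
    fix m c w0
    assume q: "qpath J L m c" and w0: "btw (c 0) w0 (c m)"
    have cV: "i \<le> m \<Longrightarrow> c i \<in> V" for i using q by (simp add: qpath_def)
    have cJ: "\<forall>i<m. d (c i) (c (Suc i)) \<le> J" using q by (simp add: qpath_def)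
    have cL: "i \<le> j \<Longrightarrow> j \<le> m \<Longrightarrow> j - i \<le> L * (d (c i) (c j) + 1)" for i j
      using q by (simp add: qpath_def)
    \<comment> \<open>The distance of \<open>w\<close> from the path.\<close>
    define \<rho> where "\<rho> w = (LEAST n. \<exists>i\<le>m. d w (c i) \<le> n)" for w
    have \<rho>: "\<exists>i\<le>m. d w (c i) \<le> \<rho> w" for w
      unfolding \<rho>_def by (rule LeastI[of _ "d w (c 0)"]) blast
    have \<rho>_le: "\<rho> w \<le> d w (c i)" if "i \<le> m" for w i
      unfolding \<rho>_def by (rule Least_le) (use that in blast)
    have "\<exists>w. btw (c 0) w (c m) \<and> (\<forall>y. btw (c 0) y (c m) \<longrightarrow> \<rho> y \<le> \<rho> w)"
    proof (rule ex_has_greatest_nat[where P = "\<lambda>w. btw (c 0) w (c m)" and f = \<rho>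
          and k = w0 and b = "Suc (d (c 0) (c m))"])
      show "\<forall>y. btw (c 0) y (c m) \<longrightarrow> \<rho> y < Suc (d (c 0) (c m))"
      proof (intro allI impI)
        fix y assume "btw (c 0) y (c m)"
        then have "d y (c 0) \<le> d (c 0) (c m)" by (simp add: btw_def d_sym[of y])
        then show "\<rho> y < Suc (d (c 0) (c m))" using \<rho>_le[of 0 y] by simp
      qed
    qed (rule w0)
    then obtain w where w: "btw (c 0) w (c m)" and wmax: "\<And>y. btw (c 0) y (c m) \<Longrightarrow> \<rho> y \<le> \<rho> w" by blast
    define D where "D = \<rho> w"
    have wV: "w \<in> V" using w by (rule btw_V)
    have side: "\<exists>y i. btw w y e \<and> i \<le> m \<and> d y (c i) \<le> D \<and> d w y \<le> 2 * D \<and> (\<forall>u. btw y u (c i) \<longrightarrow> D \<le> d w u)"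
      if e: "e \<in> V" "e = c i0" "i0 \<le> m" and onto: "\<And>y. btw w y e \<Longrightarrow> btw (c 0) y (c m)" for e i0
    proof (cases "2 * D \<le> d w e")
      case True
      then obtain y where y: "btw w y e" "d w y = 2 * D" using point_at wV e(1) by blast
      then obtain i where i: "i \<le> m" "d y (c i) \<le> \<rho> y" using \<rho> by blast
      then have i': "d y (c i) \<le> D" using wmax[OF onto[OF y(1)]] by (simp add: D_def)
      have "D \<le> d w u" if u: "btw y u (c i)" for u
      proof -
        have "d w y \<le> d w u + d u y" using tri wV btw_V[OF u] btw_V[OF y(1)] by blast
        moreover have "d y u \<le> D" using u i' by (simp add: btw_def)
        ultimately show ?thesis using y(2) d_sym[of u y] by linarith
      qed
      with y i i' show ?thesis by (intro exI[of _ y] exI[of _ i]) auto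
    next
      case False
      have "D \<le> d w u" if u: "btw e u (c i0)" for u
        using btw_self u e \<rho>_le[of i0 w] by (auto simp: D_def)
      moreover have "btw w e e" using e(1) by (simp add: btw_def)
      ultimately show ?thesis using False e by (intro exI[of _ e] exI[of _ i0]) auto
    qed
    have on1: "btw (c 0) y (c m)" if "btw w y (c 0)" for y
    proof -
      have "d y (c m) \<le> d y w + d w (c m)" "d (c 0) (c m) \<le> d (c 0) y + d y (c m)"
        using tri wV btw_V[OF that] cV by auto
      then show ?thesis using that w d_sym[of w y] d_sym[of y "c 0"] d_sym[of w "c 0"] by (simp add: btw_def)
    qed
    have on2: "btw (c 0) y (c m)" if "btw w y (c m)" for y
    proof -
      have "d (c 0) y \<le> d (c 0) w + d w y" "d (c 0) (c m) \<le> d (c 0) y + d y (c m)"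
        using tri wV btw_V[OF that] cV by auto
      then show ?thesis using that w by (simp add: btw_def)
    qed
    obtain y i where y: "btw w y (c 0)" "i \<le> m" "d y (c i) \<le> D" "d w y \<le> 2 * D"
        "\<And>u. btw y u (c i) \<Longrightarrow> D \<le> d w u"
      using side[of "c 0" 0] cV on1 by auto
    obtain z j where z: "btw w z (c m)" "j \<le> m" "d z (c j) \<le> D" "d w z \<le> 2 * D"
        "\<And>u. btw z u (c j) \<Longrightarrow> D \<le> d w u"
      using side[of "c m" m] cV on2 by auto
    have yV: "y \<in> V" and zV: "z \<in> V" using y z btw_V by auto
    have wyz: "btw y w z"
    proof -
      have "d (c 0) (c m) \<le> d (c 0) y + d y (c m)" "d y (c m) \<le> d y z + d z (c m)" "d y z \<le> d y w + d w z"
        using tri wV yV zV cV by auto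
      then show ?thesis using y(1) z(1) w wV d_sym[of w y] d_sym[of y "c 0"] d_sym[of w "c 0"]
        by (simp add: btw_def)
    qed
    have dij: "d (c i) (c j) \<le> 6 * D"
    proof -
      have "d (c i) (c j) \<le> d (c i) y + d y (c j)" "d y (c j) \<le> d y z + d z (c j)" "d y z \<le> d y w + d w z"
        using tri wV yV zV cV y(2) z(2) by auto
      then show ?thesis using y(3,4) z(3,4) d_sym[of y w] d_sym[of "c i" y] by linarith
    qed
    have "D \<le> D0"
    proof (rule D0)
      fix k assume k: "L * (6 * D + 1) \<le> 2 ^ k"
      obtain u where u: "btw y u (c i) \<or> btw (c i) u z" "d w u \<le> \<delta>"
        using thinD[OF thin_triangles wyz yV cV[OF y(2)] zV] by blast
      show "D \<le> (2 * \<delta> + J) + \<delta> * k"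
        using u(1)
      proof
        assume "btw y u (c i)"
        then show ?thesis using y(5) u(2) by fastforce
      next
        assume u1: "btw (c i) u z"
        obtain u' where u': "btw (c i) u' (c j) \<or> btw (c j) u' z" "d u u' \<le> \<delta>"
          using thinD[OF thin_triangles u1 cV[OF y(2)] cV[OF z(2)] zV] by blast
        have u'V: "u' \<in> V" using u'(1) btw_V by blast
        have wu': "d w u' \<le> 2 * \<delta>"
          using tri[OF wV btw_V[OF u1] u'V] u(2) u'(2) by linarith
        show ?thesis using u'(1)
        proof
          assume "btw (c j) u' z"
          then have "D \<le> d w u'" using z(5) btw_sym by blast
          then show ?thesis using wu' by linarith
        next
          assume b: "btw (c i) u' (c j)"
          define a b' where "a = min i j" and "b' = max i j"
          have ab: "a \<le> b'" "b' \<le> m" using y(2) z(2) by (auto simp: a_def b'_def)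
          have b2: "btw (c a) u' (c b')"
            using b btw_sym by (auto simp: a_def b'_def min_def max_def)
          have dab: "d (c a) (c b') \<le> 6 * D"
            using dij d_sym by (auto simp: a_def b'_def min_def max_def)
          have "b' - a \<le> L * (d (c a) (c b') + 1)" using cL ab by blast
          also have "\<dots> \<le> L * (6 * D + 1)" using dab by simp
          finally have "b' - a \<le> 2 ^ k" using k by linarith
          from btw_near_path[OF thin_triangles, of "b' - a" "\<lambda>l. c (a + l)" J k u', OF _ _ this] b2 ab cV cJ
          obtain l where l: "l \<le> b' - a" "d u' (c (a + l)) \<le> \<delta> * k + J" by auto
          then have lm: "a + l \<le> m" using ab by linarith
          have "D \<le> d w (c (a + l))" using \<rho>_le[OF lm] by (simp add: D_def)
          also have "\<dots> \<le> d w u' + d u' (c (a + l))" using tri wV u'V cV[OF lm] by blast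
          finally show ?thesis using l(2) wu' by linarith
        qed
      qed
    qed
    then show "\<exists>i\<le>m. d w0 (c i) \<le> D0"
      using \<rho>[of w0] wmax[OF w0] unfolding D_def by (meson le_trans)
  qed
qed

text \<open>Every point of the geodesic is close to some point of the path. Moving along the geodesic there is a
  place where these points of the path change from before \<open>c i\<close> to after \<open>c i\<close>. At this place two points
  of the path on different sides of \<open>c i\<close> are close to each other, so only boundedly many jumps lie
  between them and \<open>c i\<close> is close to the geodesic, too.\<close>

lemma qpath_near_geodesic:
  assumes thin_triangles: "thin_triangles \<delta>"
  shows "\<exists>D. \<forall>m c i. qpath J L m c \<longrightarrow> i \<le> m \<longrightarrow> (\<exists>w. btw (c 0) w (c m) \<and> d (c i) w \<le> D)"
proof -
  obtain D where D: "\<And>m c w. qpath J L m c \<Longrightarrow> btw (c 0) w (c m) \<Longrightarrow> \<exists>i\<le>m. d w (c i) \<le> D"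
    using geodesic_near_qpath[OF thin_triangles] by blast
  define D2 where "D2 = D + J * (L * (2 * D + 2))"
  show ?thesis
  proof (rule exI[of _ D2], intro allI impI)
    fix m c i assume q: "qpath J L m c" and i: "i \<le> m"
    have cV: "i \<le> m \<Longrightarrow> c i \<in> V" for i using q by (simp add: qpath_def)
    have cJ: "d (c i) (c j) \<le> J * (j - i)" if "i \<le> j" "j \<le> m" for i j
      using path_length[of m c J i j] q that by (simp add: qpath_def)
    have cL: "i \<le> j \<Longrightarrow> j \<le> m \<Longrightarrow> j - i \<le> L * (d (c i) (c j) + 1)" for i j
      using q by (simp add: qpath_def)
    define l where "l = d (c 0) (c m)"
    obtain g where g: "g 0 = c 0" "g l = c m" "\<And>j. j \<le> l \<Longrightarrow> g j \<in> V"
        "\<And>i j. i \<le> j \<Longrightarrow> j \<le> l \<Longrightarrow> d (g i) (g j) = j - i"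
      using geod[OF cV[of 0] cV[of m]] unfolding l_def by auto
    have gb: "btw (c 0) (g j) (c m)" if "j \<le> l" for j
      using g(4)[of 0 j] g(4)[of j l] g(1-3) that by (simp add: btw_def l_def)
    have near: "\<exists>s\<le>m. d (g j) (c s) \<le> D" if "j \<le> l" for j
      using D[OF q gb[OF that]] .
    \<comment> \<open>The point \<open>g j\<close> is close to a point of the path after \<open>c i\<close>.\<close>
    define P where "P j \<longleftrightarrow> j \<le> l \<and> (\<exists>s\<ge>i. s \<le> m \<and> d (g j) (c s) \<le> D)" for j
    define j where "j = (LEAST j. P j)"
    have "P l" unfolding P_def using g(2) i by (intro conjI exI[of _ m]) auto
    then have Pj: "P j" unfolding j_def by (rule LeastI)
    then obtain s where s: "i \<le> s" "s \<le> m" "d (g j) (c s) \<le> D" and jl: "j \<le> l" unfolding P_def by blast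
    have "\<exists>t\<le>i. \<exists>h\<le>l. d (g h) (c t) \<le> D \<and> d (g h) (g j) \<le> 1"
    proof (cases j)
      case 0
      then show ?thesis using g(1) by (intro exI[of _ 0] conjI) auto
    next
      case (Suc h)
      obtain t where t: "t \<le> m" "d (g h) (c t) \<le> D" using near[of h] jl Suc by auto
      have "\<not> P h" using not_less_Least[of h P] Suc by (simp add: j_def)
      then have "t < i" unfolding P_def using t jl Suc by auto
      then show ?thesis using t g(4)[of h j] jl Suc by (intro exI[of _ t] conjI exI[of _ h]) auto
    qed
    then obtain t h where t: "t \<le> i" "h \<le> l" "d (g h) (c t) \<le> D" "d (g h) (g j) \<le> 1" by blast
    have tm: "t \<le> m" "t \<le> s" using t(1) i s by auto
    have "d (c t) (c s) \<le> d (c t) (g h) + d (g h) (c s)" "d (g h) (c s) \<le> d (g h) (g j) + d (g j) (c s)"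
      using tri cV tm s g(3) jl t(2) by auto
    then have "d (c t) (c s) \<le> 2 * D + 1" using t s d_sym[of "c t" "g h"] by linarith
    then have "s - t \<le> L * (2 * D + 2)"
      using cL[OF tm(2) s(2)] mult_le_mono2[of "d (c t) (c s) + 1" "2 * D + 2" L] by linarith
    then have "i - t \<le> L * (2 * D + 2)" using s(1) by linarith
    then have "d (c t) (c i) \<le> J * (L * (2 * D + 2))"
      using cJ[OF t(1) i] mult_le_mono2 le_trans by blast
    moreover have "d (c i) (g h) \<le> d (c i) (c t) + d (c t) (g h)"
      using tri cV tm i g(3)[OF t(2)] by auto
    ultimately have "d (c i) (g h) \<le> D2"
      using t(3) d_sym[of "c i" "c t"] d_sym[of "c t" "g h"] by (simp add: D2_def)
    then show "\<exists>w. btw (c 0) w (c m) \<and> d (c i) w \<le> D2" using gb[OF t(2)] by blast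
  qed
qed

lemma btw_on_geodesic:
  assumes "x \<in> V" "z \<in> V" "btw x w z"
  shows "\<exists>f k. f 0 = x \<and> f (d x z) = z \<and> k \<le> d x z \<and> f k = w \<and> (\<forall>i\<le>d x z. f i \<in> V) \<and>
      (\<forall>i j. i \<le> j \<longrightarrow> j \<le> d x z \<longrightarrow> d (f i) (f j) = j - i)"
proof -
  have wV: "w \<in> V" using assms(3) by (rule btw_V)
  define k where "k = d x w"
  have len: "d x z = k + d w z" using assms(3) by (simp add: btw_def k_def)
  obtain g where g: "g 0 = x" "g k = w" "\<And>i. i \<le> k \<Longrightarrow> g i \<in> V"
      "\<And>i j. i \<le> j \<Longrightarrow> j \<le> k \<Longrightarrow> d (g i) (g j) = j - i"
    using geod[OF assms(1) wV] unfolding k_def by blast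
  obtain h where h: "h 0 = w" "h (d w z) = z" "\<And>i. i \<le> d w z \<Longrightarrow> h i \<in> V"
      "\<And>i j. i \<le> j \<Longrightarrow> j \<le> d w z \<Longrightarrow> d (h i) (h j) = j - i"
    using geod[OF wV assms(2)] by blast
  define f where "f i = (if i \<le> k then g i else h (i - k))" for i
  have fV: "f i \<in> V" if "i \<le> d x z" for i
    using that g(3) h(3) len by (auto simp: f_def)
  have f0: "f 0 = x" "f (d x z) = z" "f k = w"
    using g h len by (auto simp: f_def)
  have dist: "d (f i) (f j) = j - i" if ij: "i \<le> j" "j \<le> d x z" for i j
  proof (cases "j \<le> k \<or> k < i")
    case True
    then show ?thesis
    proof
      assume "k < i"
      then have "d (h (i - k)) (h (j - k)) = (j - k) - (i - k)" using ij len by (intro h(4)) auto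
      then show ?thesis using \<open>k < i\<close> ij by (simp add: f_def)
    qed (use ij g(4) in \<open>auto simp: f_def\<close>)
  next
    case False
    then have fi: "f i = g i" and fj: "f j = h (j - k)" by (auto simp: f_def)
    have 1: "d x (g i) = i" "d (g i) w = k - i" "d w (h (j - k)) = j - k" "d (h (j - k)) z = d w z - (j - k)"
      using g(4)[of 0 i] g(4)[of i k] h(4)[of 0 "j - k"] h(4)[of "j - k" "d w z"] g(1,2) h(1,2) False ij len
      by auto
    have V: "g i \<in> V" "h (j - k) \<in> V" using g(3) h(3) False ij len by auto
    have "d (g i) (h (j - k)) \<le> d (g i) w + d w (h (j - k))"
      "d x z \<le> d x (g i) + d (g i) z" "d (g i) z \<le> d (g i) (h (j - k)) + d (h (j - k)) z"
      using tri V wV assms(1,2) by auto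
    then show ?thesis unfolding fi fj using 1 len False ij by linarith
  qed
  show ?thesis using f0 fV dist len by (intro exI[of _ f] exI[of _ k]) auto
qed

text \<open>Geodesics for \<open>d\<close> are quasi-geodesics for \<open>d'\<close>. A point of a side for \<open>d\<close> is close to the corresponding
  side for \<open>d'\<close>, hence to one of the other sides for \<open>d'\<close>, hence to one of the other sides for \<open>d\<close>.\<close>

lemma thin_bilipschitz:
  assumes D': "discrete_geodesic V d'" and thin_triangles': "discrete_geodesic.thin_triangles V d' \<delta>'"
    and L: "\<And>x y. x \<in> V \<Longrightarrow> y \<in> V \<Longrightarrow> d' x y \<le> L * d x y"
    and L': "\<And>x y. x \<in> V \<Longrightarrow> y \<in> V \<Longrightarrow> d x y \<le> L * d' x y"
  shows "\<exists>\<delta>. thin_triangles \<delta>"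
proof -
  interpret D': discrete_geodesic V d' by (rule D')
  obtain D1 where D1: "\<And>m c w. D'.qpath L L m c \<Longrightarrow> D'.btw (c 0) w (c m) \<Longrightarrow> \<exists>i\<le>m. d' w (c i) \<le> D1"
    using D'.geodesic_near_qpath[OF thin_triangles'] by blast
  obtain D2 where D2: "\<And>m c i. D'.qpath L L m c \<Longrightarrow> i \<le> m \<Longrightarrow> \<exists>w. D'.btw (c 0) w (c m) \<and> d' (c i) w \<le> D2"
    using D'.qpath_near_geodesic[OF thin_triangles'] by blast
  have qp: "D'.qpath L L (d x z) f"
    if "\<And>i. i \<le> d x z \<Longrightarrow> f i \<in> V" "\<And>i j. i \<le> j \<Longrightarrow> j \<le> d x z \<Longrightarrow> d (f i) (f j) = j - i" for x z f
    unfolding D'.qpath_def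
  proof (intro conjI allI impI)
    fix i assume "i < d x z"
    then show "d' (f i) (f (Suc i)) \<le> L"
      using L[of "f i" "f (Suc i)"] that(1)[of i] that(1)[of "Suc i"] that(2)[of i "Suc i"] by simp
  next
    fix i j assume ij: "i \<le> j" "j \<le> d x z"
    then have "j - i \<le> L * d' (f i) (f j)"
      using L'[of "f i" "f j"] that(1)[of i] that(1)[of j] that(2)[of i j] by simp
    then show "j - i \<le> L * (d' (f i) (f j) + 1)" by simp
  qed (use that in simp)
  have near: "\<exists>v. btw x v y \<and> d' u v \<le> D1" if xy: "x \<in> V" "y \<in> V" and u: "D'.btw x u y" for x y u
  proof -
    obtain f where f: "f 0 = x" "f (d x y) = y" "\<And>i. i \<le> d x y \<Longrightarrow> f i \<in> V"
        "\<And>i j. i \<le> j \<Longrightarrow> j \<le> d x y \<Longrightarrow> d (f i) (f j) = j - i"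
      using geod[OF xy] by blast
    obtain i where i: "i \<le> d x y" "d' u (f i) \<le> D1"
      using D1[OF qp[of x y f, OF f(3,4)]] u f(1,2) by auto
    moreover have "btw x (f i) y"
      using f(4)[of 0 i] f(4)[of i "d x y"] f(1-3) i(1) by (simp add: btw_def)
    ultimately show ?thesis by blast
  qed
  show ?thesis
    unfolding thin_triangles_def
  proof (intro exI[of _ "L * (D2 + \<delta>' + D1)"] ballI allI impI)
    fix x y z w assume V: "x \<in> V" "y \<in> V" "z \<in> V" and w: "btw x w z"
    obtain f k where f: "f 0 = x" "f (d x z) = z" "k \<le> d x z" "f k = w" "\<And>i. i \<le> d x z \<Longrightarrow> f i \<in> V"
        "\<And>i j. i \<le> j \<Longrightarrow> j \<le> d x z \<Longrightarrow> d (f i) (f j) = j - i"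
      using btw_on_geodesic[OF V(1,3) w] by blast
    obtain w' where w': "D'.btw x w' z" "d' w w' \<le> D2"
      using D2[OF qp[of x z f, OF f(5,6)] f(3)] f(1,2,4) by auto
    obtain u where u: "D'.btw x u y \<or> D'.btw y u z" "d' w' u \<le> \<delta>'"
      using D'.thinD[OF thin_triangles' w'(1) V(1,2,3)] by blast
    obtain v where v: "btw x v y \<or> btw y v z" "d' u v \<le> D1"
      using u(1) near V by blast
    have mem: "w \<in> V" "w' \<in> V" "u \<in> V" "v \<in> V"
      using w w'(1) u(1) v(1) btw_V D'.btw_V by blast+
    have "d' w v \<le> d' w w' + d' w' v" "d' w' v \<le> d' w' u + d' u v"
      using D'.tri mem by auto
    then have "d' w v \<le> D2 + \<delta>' + D1" using w'(2) u(2) v(2) by linarith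
    then have "d w v \<le> L * (D2 + \<delta>' + D1)" using L'[OF mem(1,4)] mult_le_mono2 le_trans by blast
    then show "\<exists>u. (btw x u y \<or> btw y u z) \<and> d w u \<le> L * (D2 + \<delta>' + D1)" using v(1) by blast
  qed
qed

end

section \<open>Geodesic rays in hyperbolic graphs\<close>

locale hyperbolic_graph = discrete_geodesic V d for V :: "'v set" and d +
  fixes \<delta> :: nat
  assumes thin_triangles: "thin_triangles \<delta>"
    and finite_ball: "x \<in> V \<Longrightarrow> finite {y \<in> V. d x y \<le> n}"
    and ball_bound: "\<exists>K. \<forall>x\<in>V. card {y \<in> V. d x y \<le> n} \<le> K"
begin

definition ray :: "(nat \<Rightarrow> 'v) \<Rightarrow> bool" where
  "ray r \<longleftrightarrow> (\<forall>i. r i \<in> V) \<and> (\<forall>i j. i \<le> j \<longrightarrow> d (r i) (r j) = j - i)"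

definition asym :: "(nat \<Rightarrow> 'v) \<Rightarrow> (nat \<Rightarrow> 'v) \<Rightarrow> bool" where
  "asym r r' \<longleftrightarrow> (\<exists>K. \<forall>t. d (r t) (r' t) \<le> K)"

lemma rayD: "ray r \<Longrightarrow> r i \<in> V" "ray r \<Longrightarrow> i \<le> j \<Longrightarrow> d (r i) (r j) = j - i"
  by (auto simp: ray_def)

lemma asym_sym: "asym r r' \<Longrightarrow> asym r' r"
  by (auto simp: asym_def d_sym)

text \<open>The triangle with the corners \<open>x\<close>, \<open>w'\<close> and \<open>z\<close> is degenerate, and the distance from \<open>x\<close> or \<open>z\<close>
  determines the position of a point on its sides.\<close>

lemma bigon:
  assumes V: "x \<in> V" "z \<in> V" and w: "btw x w z" "btw x w' z" and eq: "d x w = d x w'"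
  shows "d w w' \<le> 2 * \<delta>"
proof -
  have wV: "w \<in> V" "w' \<in> V" using w btw_V by auto
  obtain u where u: "btw x u w' \<or> btw w' u z" "d w u \<le> \<delta>"
    using thinD[OF thin_triangles w(1) V(1) wV(2) V(2)] by blast
  have uV: "u \<in> V" using u(1) btw_V by blast
  have "d x w \<le> d x u + d u w" "d w z \<le> d w u + d u z" "d w w' \<le> d w u + d u w'"
    using tri V wV uV by auto
  then show ?thesis using u w eq d_sym[of u w] d_sym[of u w'] unfolding btw_def by linarith
qed

lemma near_ray:
  assumes r: "ray r" and u: "btw (r 0) u (r n)"
  shows "d u (r (d (r 0) u)) \<le> 2 * \<delta> \<and> d (r 0) u \<le> n"
proof -
  have n: "d (r 0) (r n) = n" using rayD(2)[OF r, of 0 n] by simp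
  then have le: "d (r 0) u \<le> n" using u by (simp add: btw_def)
  have "btw (r 0) (r (d (r 0) u)) (r n)"
    using rayD[OF r] le n by (simp add: btw_def)
  then have "d u (r (d (r 0) u)) \<le> 2 * \<delta>"
    using bigon[OF rayD(1)[OF r] rayD(1)[OF r] u] rayD(2)[OF r] by simp
  with le show ?thesis by simp
qed

text \<open>Two triangles move \<open>r t\<close> to a point between \<open>r' 0\<close> and \<open>r' n\<close> for a large \<open>n\<close>, because \<open>r t\<close> is far from
  both short sides of the quadrilateral \<open>r 0\<close>, \<open>r n\<close>, \<open>r' n\<close>, \<open>r' 0\<close>. This costs \<open>2 \<delta>\<close>, and another \<open>2 \<delta>\<close>
  leads to the ray \<open>r'\<close>.\<close>

lemma asym_meets:
  assumes r: "ray r" and r': "ray r'" and a: "asym r r'" and t: "t > d (r 0) (r' 0) + 2 * \<delta>"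
  shows "\<exists>s. d (r t) (r' s) \<le> 4 * \<delta>"
proof -
  note V = rayD(1)[OF r] rayD(1)[OF r']
  obtain K where K: "\<And>t. d (r t) (r' t) \<le> K" using a by (auto simp: asym_def)
  define n where "n = t + K + \<delta> + 1"
  have tn: "d (r 0) (r t) = t" "d (r t) (r n) = n - t" using rayD(2)[OF r] by (auto simp: n_def)
  have "btw (r 0) (r t) (r n)" using V tn rayD(2)[OF r, of 0 n] by (simp add: btw_def n_def)
  then obtain u where u: "btw (r 0) u (r' n) \<or> btw (r' n) u (r n)" "d (r t) u \<le> \<delta>"
    using thinD[OF thin_triangles _ V(1) V(2) V(1)] by blast
  have "\<not> btw (r' n) u (r n)"
  proof
    assume b: "btw (r' n) u (r n)"
    have "d (r t) (r n) \<le> d (r t) u + d u (r n)" using tri V btw_V[OF b] by blast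
    moreover have "d u (r n) \<le> K" using b K[of n] d_sym[of "r n" "r' n"] unfolding btw_def by linarith
    ultimately show False using u(2) tn by (simp add: n_def)
  qed
  then have u1: "btw (r 0) u (r' n)" using u by blast
  obtain v where v: "btw (r 0) v (r' 0) \<or> btw (r' 0) v (r' n)" "d u v \<le> \<delta>"
    using thinD[OF thin_triangles u1 V(1) V(2) V(2)] by blast
  have uv: "u \<in> V" "v \<in> V" using u1 v(1) btw_V by blast+
  have tv: "d (r t) v \<le> 2 * \<delta>" using tri[OF V(1)[of t] uv] u(2) v(2) by linarith
  have "\<not> btw (r 0) v (r' 0)"
  proof
    assume "btw (r 0) v (r' 0)"
    then have "d (r 0) v \<le> d (r 0) (r' 0)" by (simp add: btw_def)
    moreover have "d (r 0) (r t) \<le> d (r 0) v + d v (r t)" using tri V uv by blast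
    ultimately show False using tv t tn d_sym[of v "r t"] by linarith
  qed
  then have "d v (r' (d (r' 0) v)) \<le> 2 * \<delta>" using near_ray[OF r'] v(1) by blast
  then have "d (r t) (r' (d (r' 0) v)) \<le> 4 * \<delta>"
    using tri[OF V(1)[of t] uv(2) V(2)[of "d (r' 0) v"]] tv by linarith
  then show ?thesis by blast
qed

text \<open>The bound is independent of the constant in \<open>asym\<close>. So asymptotic rays remain asymptotic in the limit,
  and this is what makes conditions on boundary points closed.\<close>

lemma asym_fellow:
  assumes r: "ray r" and r': "ray r'" and a: "asym r r'"
  shows "d (r t) (r' t) \<le> 3 * d (r 0) (r' 0) + 8 * \<delta>"
proof -
  note V = rayD(1)[OF r] rayD(1)[OF r']
  have t: "d (r 0) (r t) = t" "d (r' 0) (r' t) = t" using rayD(2)[OF r] rayD(2)[OF r'] by auto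
  show ?thesis
  proof (cases "t > d (r 0) (r' 0) + 2 * \<delta>")
    case True
    then obtain s where s: "d (r t) (r' s) \<le> 4 * \<delta>" using asym_meets[OF r r' a] by blast
    have s0: "d (r' 0) (r' s) = s" using rayD(2)[OF r'] by simp
    have "d (r 0) (r t) \<le> d (r 0) (r' 0) + d (r' 0) (r t)" "d (r' 0) (r t) \<le> d (r' 0) (r' s) + d (r' s) (r t)"
      "d (r' 0) (r' s) \<le> d (r' 0) (r 0) + d (r 0) (r' s)" "d (r 0) (r' s) \<le> d (r 0) (r t) + d (r t) (r' s)"
      using tri V by blast+
    then have "t \<le> s + 4 * \<delta> + d (r 0) (r' 0)" "s \<le> t + 4 * \<delta> + d (r 0) (r' 0)"
      using t s s0 d_sym[of "r' s" "r t"] d_sym[of "r' 0" "r 0"] by linarith+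
    moreover have "d (r' s) (r' t) = (t - s) + (s - t)"
      using rayD(2)[OF r'] d_sym[of "r' s" "r' t"] by (cases "s \<le> t") auto
    moreover have "d (r t) (r' t) \<le> d (r t) (r' s) + d (r' s) (r' t)" using tri V by blast
    ultimately show ?thesis using s by linarith
  next
    case False
    have "d (r t) (r' t) \<le> d (r t) (r 0) + d (r 0) (r' t)" "d (r 0) (r' t) \<le> d (r 0) (r' 0) + d (r' 0) (r' t)"
      using tri V by blast+
    then show ?thesis using t False d_sym[of "r t" "r 0"] by linarith
  qed
qed

lemma ray_limit:
  assumes q: "q \<in> V" and v: "\<And>n. v n \<in> V" and far: "\<And>n. n \<le> C + d q (v n)"
  shows "\<exists>r. ray r \<and> r 0 = q \<and> (\<forall>t. \<exists>n. btw q (r t) (v n))"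
proof -
  have "\<exists>f. \<forall>n. f n 0 = q \<and> f n (d q (v n)) = v n \<and> (\<forall>i\<le>d q (v n). f n i \<in> V) \<and>
      (\<forall>i j. i \<le> j \<longrightarrow> j \<le> d q (v n) \<longrightarrow> d (f n i) (f n j) = j - i)"
    using geod[OF q v] by (intro choice allI)
  then obtain f where f: "\<And>n. f n 0 = q" "\<And>n. f n (d q (v n)) = v n" "\<And>n i. i \<le> d q (v n) \<Longrightarrow> f n i \<in> V"
      "\<And>n i j. i \<le> j \<Longrightarrow> j \<le> d q (v n) \<Longrightarrow> d (f n i) (f n j) = j - i" by blast
  \<comment> \<open>Beyond its end the geodesic is continued by the default value \<open>q\<close>, to keep the ranges finite.\<close>
  define h where "h n i = (if i \<le> d q (v n) then f n i else q)" for n i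
  have "finite (range (\<lambda>n. h n t))" for t
  proof (rule finite_subset[OF _ finite_ball[OF q, of t]])
    show "range (\<lambda>n. h n t) \<subseteq> {y \<in> V. d q y \<le> t}"
      using f(3) f(4)[of 0 t] f(1) q by (auto simp: h_def)
  qed
  from koenig_diagonal[of h, OF this] obtain g where g: "\<And>t. infinite {n. \<forall>i\<le>t. h n i = g i}" by blast
  have ex: "\<exists>n\<ge>C + t. \<forall>i\<le>t. h n i = g i" for t
    using g[of t] unfolding infinite_nat_iff_unbounded_le by blast
  have ex': "\<exists>n. t \<le> d q (v n) \<and> (\<forall>i\<le>t. f n i = g i)" for t
  proof -
    obtain n where n: "n \<ge> C + t" "\<forall>i\<le>t. h n i = g i" using ex by blast
    then have "t \<le> d q (v n)" using far[of n] by linarith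
    then show ?thesis using n(2) by (intro exI[of _ n]) (auto simp: h_def)
  qed
  have "ray g"
    unfolding ray_def
  proof (intro conjI allI impI)
    fix i
    obtain n where "i \<le> d q (v n)" "\<forall>l\<le>i. f n l = g l" using ex' by blast
    then show "g i \<in> V" using f(3)[of i n] by auto
  next
    fix i j :: nat assume ij: "i \<le> j"
    obtain n where "j \<le> d q (v n)" "\<forall>l\<le>j. f n l = g l" using ex' by blast
    then show "d (g i) (g j) = j - i" using f(4)[OF ij, of n] ij by auto
  qed
  moreover have "g 0 = q" using ex'[of 0] f(1) by auto
  moreover have "\<exists>n. btw q (g t) (v n)" for t
  proof -
    obtain n where n: "t \<le> d q (v n)" "\<forall>l\<le>t. f n l = g l" using ex' by blast
    have "btw q (f n t) (v n)"
      using f(3)[OF n(1)] f(4)[of 0 t n] f(4)[of t "d q (v n)" n] f(1,2) n(1) by (simp add: btw_def)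
    then show ?thesis using n(2) by auto
  qed
  ultimately show ?thesis by blast
qed

text \<open>The ray is a limit of geodesics from \<open>q\<close> to \<open>v n\<close>, which the stability of quasi-geodesics keeps close
  to \<open>v\<close>. The constant depends on \<open>B\<close> and \<open>C\<close> only. Rays of the Cayley graph that may run through inner
  points of edges yield such sequences \<open>v\<close> with \<open>B = 2\<close>, by passing to nearby vertices.\<close>

lemma quasi_ray_shadowed:
  "\<exists>K. \<forall>q v. q \<in> V \<longrightarrow> (\<forall>n. v n \<in> V) \<longrightarrow> d q (v 0) \<le> C \<longrightarrow>
    (\<forall>i j. i \<le> j \<longrightarrow> d (v i) (v j) \<le> (j - i) + B \<and> j - i \<le> d (v i) (v j) + B) \<longrightarrow>
    (\<exists>r. ray r \<and> r 0 = q \<and> (\<forall>t. d (r t) (v t) \<le> K))"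
proof -
  obtain D where D: "\<And>m c w. qpath (B + 1) (B + 1) m c \<Longrightarrow> btw (c 0) w (c m) \<Longrightarrow> \<exists>i\<le>m. d w (c i) \<le> D"
    using geodesic_near_qpath[OF thin_triangles] by blast
  define K0 where "K0 = \<delta> + C + D"
  have "\<exists>r. ray r \<and> r 0 = q \<and> (\<forall>t. d (r t) (v t) \<le> K0 + (C + B + K0) + B)"
    if q: "q \<in> V" and v: "\<And>n. v n \<in> V" and C: "d q (v 0) \<le> C"
      and B: "\<And>i j. i \<le> j \<Longrightarrow> d (v i) (v j) \<le> (j - i) + B" "\<And>i j. i \<le> j \<Longrightarrow> j - i \<le> d (v i) (v j) + B" for q v
  proof -
    have qp: "qpath (B + 1) (B + 1) m v" for m
      unfolding qpath_def
    proof (intro conjI allI impI)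
      fix i j :: nat assume "i \<le> j"
      then show "j - i \<le> (B + 1) * (d (v i) (v j) + 1)" using B(2)[of i j] by (simp add: algebra_simps)
    next
      fix i show "d (v i) (v (Suc i)) \<le> B + 1" using B(1)[of i "Suc i"] by simp
    qed (rule v)
    have "n \<le> (B + d q (v 0)) + d q (v n)" for n
      using B(2)[of 0 n] tri[OF v[of 0] q v[of n]] d_sym[of q "v 0"] by simp
    from ray_limit[OF q v this] obtain r where r: "ray r" "r 0 = q" "\<And>t. \<exists>n. btw q (r t) (v n)" by blast
    have near: "\<exists>i. d (r t) (v i) \<le> K0" for t
    proof -
      obtain n where n: "btw q (r t) (v n)" using r(3) by blast
      obtain u where u: "btw q u (v 0) \<or> btw (v 0) u (v n)" "d (r t) u \<le> \<delta>"
        using thinD[OF thin_triangles n q v v] by blast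
      have uV: "u \<in> V" using u(1) btw_V by blast
      have "\<exists>i. d u (v i) \<le> C + D"
        using u(1)
      proof
        assume "btw q u (v 0)"
        then have "d u (v 0) \<le> C" using C by (simp add: btw_def)
        then show ?thesis by (intro exI[of _ 0]) simp
      next
        assume "btw (v 0) u (v n)"
        from D[OF qp this] show ?thesis by (auto intro: trans_le_add2)
      qed
      then obtain i where "d u (v i) \<le> C + D" ..
      then show ?thesis using tri[OF rayD(1)[OF r(1)] uV v[of i], of t] u(2)
        by (intro exI[of _ i]) (simp add: K0_def)
    qed
    have "d (r t) (v t) \<le> K0 + (C + B + K0) + B" for t
    proof -
      obtain i where i: "d (r t) (v i) \<le> K0" using near by blast
      have t: "d q (r t) = t" using rayD(2)[OF r(1), of 0 t] r(2) by simp
      have "d q (r t) \<le> d q (v i) + d (v i) (r t)" "d q (v i) \<le> d q (v 0) + d (v 0) (v i)"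
        "d (v 0) (v i) \<le> d (v 0) q + d q (v i)" "d q (v i) \<le> d q (r t) + d (r t) (v i)"
        using tri q v rayD(1)[OF r(1)] by blast+
      then have "t \<le> i + (C + B + K0)" "i \<le> t + (C + B + K0)"
        using t i C B(1)[of 0 i] B(2)[of 0 i] d_sym[of "v i" "r t"] d_sym[of "v 0" q] by linarith+
      moreover have "d (v i) (v t) \<le> ((i - t) + (t - i)) + B"
        using B(1)[of i t] B(1)[of t i] d_sym[of "v i" "v t"] by (cases "i \<le> t") auto
      moreover have "d (r t) (v t) \<le> d (r t) (v i) + d (v i) (v t)"
        using tri v rayD(1)[OF r(1)] by blast
      ultimately show ?thesis using i by linarith
    qed
    then show ?thesis using r(1,2) by blast
  qed
  then show ?thesis by (intro exI[of _ "K0 + (C + B + K0) + B"]) blast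
qed

text \<open>A step of length \<open>n\<close> along one ray decreases the distance to the far points of an asymptotic ray by at
  least \<open>n - 8 \<delta>\<close>. This is the least length for which the estimate gives a decrease.\<close>

definition stride :: nat where "stride = 8 * \<delta> + 1"

text \<open>A far point \<open>r s\<close> is \<open>4 \<delta>\<close>-close to a point of \<open>q\<close>, from which the distances to \<open>q 0\<close> and \<open>q stride\<close>
  differ by exactly \<open>stride\<close>.\<close>

lemma step_towards:
  assumes q: "ray q" and r: "ray r" and a: "asym q r"
  shows "\<exists>s0. \<forall>s\<ge>s0. d (q stride) (r s) + 1 \<le> d (q 0) (r s)"
proof (intro exI allI impI)
  fix s assume s: "s \<ge> stride + 2 * d (q 0) (r 0) + 6 * \<delta> + 1"
  note V = rayD(1)[OF q] rayD(1)[OF r]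
  obtain l where l: "d (r s) (q l) \<le> 4 * \<delta>"
    using asym_meets[OF r q asym_sym[OF a], of s] s d_sym[of "q 0" "r 0"] by auto
  have l0: "d (q 0) (q l) = l" "d (r 0) (r s) = s" using rayD(2)[OF q] rayD(2)[OF r] by auto
  have "d (r 0) (r s) \<le> d (r 0) (q 0) + d (q 0) (r s)" "d (q 0) (r s) \<le> d (q 0) (q l) + d (q l) (r s)"
    "d (q 0) (q l) \<le> d (q 0) (r s) + d (r s) (q l)"
    using tri V by blast+
  then have "stride \<le> l" "l \<le> d (q 0) (r s) + 4 * \<delta>"
    using l l0 s d_sym[of "q l" "r s"] d_sym[of "q 0" "r 0"] by linarith+
  moreover have "d (q stride) (r s) \<le> d (q stride) (q l) + d (q l) (r s)" using tri V by blast
  moreover have "d (q stride) (q l) = l - stride" using rayD(2)[OF q] calculation(1) by simp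
  ultimately show "d (q stride) (r s) + 1 \<le> d (q 0) (r s)"
    using l d_sym[of "q l" "r s"] unfolding stride_def by linarith
qed

text \<open>The rays \<open>q\<close> for different \<open>k\<close> are unrelated except for their common point at infinity. In particular
  their concatenation need not be geodesic.\<close>

definition trajectory :: "(nat \<Rightarrow> 'v) \<Rightarrow> (nat \<Rightarrow> 'v) \<Rightarrow> bool" where
  "trajectory r p \<longleftrightarrow> (\<forall>k. \<exists>q. ray q \<and> q 0 = p k \<and> q stride = p (Suc k) \<and> asym q r)"

text \<open>A path that approaches \<open>z\<close> with each jump cannot turn back: by the triangle inequality its points are
  at least as far apart as their distances to \<open>z\<close> differ.\<close>

lemma descending_qpath:
  assumes V: "\<And>i. i \<le> m \<Longrightarrow> c i \<in> V" and J: "\<And>i. i < m \<Longrightarrow> d (c i) (c (Suc i)) \<le> J"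
    and z: "z \<in> V" and desc: "\<And>i. i < m \<Longrightarrow> d (c (Suc i)) z + 1 \<le> d (c i) z"
  shows "qpath J 1 m c" and "\<And>i j. i \<le> j \<Longrightarrow> j \<le> m \<Longrightarrow> j - i \<le> d (c i) (c j)"
proof -
  have *: "(j - i) + d (c j) z \<le> d (c i) z" if "i \<le> j" "j \<le> m" for i j
    using that
  proof (induction j rule: dec_induct)
    case (step j)
    then show ?case using desc[of j] by simp
  qed simp
  show **: "j - i \<le> d (c i) (c j)" if "i \<le> j" "j \<le> m" for i j
    using *[OF that] tri[of "c i" "c j" z] V that z by fastforce
  show "qpath J 1 m c"
    unfolding qpath_def using V J ** by fastforce
qed

text \<open>A sufficiently far point \<open>r S\<close> of the ray is approached by the first \<open>k\<close> steps of the trajectory.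
  Completing these by a geodesic to \<open>r S\<close> gives a quasi-geodesic with constants that depend on \<open>\<delta>\<close> only,
  and \<open>r s\<close> is close to the geodesic from \<open>p 0\<close> to \<open>r S\<close>, hence to this quasi-geodesic. The points on the
  added geodesic have distance at least \<open>k\<close> from \<open>p 0\<close>, so for large \<open>k\<close> the point close to \<open>r s\<close> belongs to
  the trajectory.\<close>

lemma trajectory_near_ray:
  "\<exists>D. \<forall>r p. ray r \<longrightarrow> trajectory r p \<longrightarrow> (\<exists>s0. \<forall>s\<ge>s0. \<exists>k. d (r s) (p k) \<le> D)"
proof -
  obtain D1 where D1: "\<And>m c w. qpath stride 1 m c \<Longrightarrow> btw (c 0) w (c m) \<Longrightarrow> \<exists>i\<le>m. d w (c i) \<le> D1"
    using geodesic_near_qpath[OF thin_triangles] by blast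
  define D where "D = \<delta> + D1"
  have "\<exists>k. d (r s) (p k) \<le> D" if r: "ray r" and p: "trajectory r p" and s: "s > \<delta> + d (r 0) (p 0)" for r p s
  proof -
    note rV = rayD(1)[OF r]
    obtain q where q: "\<And>k. ray (q k)" "\<And>k. q k 0 = p k" "\<And>k. q k stride = p (Suc k)" "\<And>k. asym (q k) r"
      using p unfolding trajectory_def by metis
    have pV: "p k \<in> V" for k using rayD(1)[OF q(1), of k 0] q(2) by simp
    have pstep: "d (p k) (p (Suc k)) = stride" for k
      using rayD(2)[OF q(1), of 0 stride k] q(2,3) by simp
    have "\<exists>s0. \<forall>s\<ge>s0. d (p (Suc k)) (r s) + 1 \<le> d (p k) (r s)" for k
      using step_towards[OF q(1) r q(4), of k] q(2,3) by simp
    then obtain s0 where s0: "\<And>k s. s \<ge> s0 k \<Longrightarrow> d (p (Suc k)) (r s) + 1 \<le> d (p k) (r s)" by metis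
    \<comment> \<open>Large enough for the points on the added geodesic to be too far from \<open>p 0\<close>.\<close>
    define k where "k = d (r s) (p 0) + D + 1"
    define S where "S = Max (insert s (s0 ` {..<k}))"
    have S: "S \<ge> s" "\<And>i. i < k \<Longrightarrow> S \<ge> s0 i" unfolding S_def by auto
    define l where "l = d (p k) (r S)"
    obtain h where h: "h 0 = p k" "h l = r S" "\<And>i. i \<le> l \<Longrightarrow> h i \<in> V"
        "\<And>i j. i \<le> j \<Longrightarrow> j \<le> l \<Longrightarrow> d (h i) (h j) = j - i"
      using geod[OF pV[of k] rV[of S]] unfolding l_def by blast
    define c where "c i = (if i \<le> k then p i else h (i - k))" for i
    define m where "m = k + l"
    have c_h: "c i = h (i - k)" if "k \<le> i" for i
      using that h(1) by (auto simp: c_def)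
    have cV: "c i \<in> V" if "i \<le> m" for i
      using that pV h(3) by (auto simp: c_def m_def)
    have step: "d (c i) (c (Suc i)) \<le> stride \<and> d (c (Suc i)) (r S) + 1 \<le> d (c i) (r S)" if i: "i < m" for i
    proof (cases "i < k")
      case True
      then show ?thesis using pstep s0 S(2) by (auto simp: c_def)
    next
      case False
      then have "k \<le> i" by simp
      then have e: "c i = h (i - k)" "c (Suc i) = h (Suc (i - k))"
        using c_h[of i] c_h[of "Suc i"] by (auto simp: Suc_diff_le)
      have "Suc (i - k) \<le> l" using i False by (auto simp: m_def)
      then show ?thesis unfolding e
        using h(4)[of "i - k" "Suc (i - k)"] h(4)[of "i - k" l] h(4)[of "Suc (i - k)" l] h(2)
        by (auto simp: stride_def Suc_diff_Suc)
    qed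
    have c0: "c 0 = p 0" "c m = r S" using h(2) c_h[of m] by (auto simp: c_def m_def)
    have qp: "qpath stride 1 m c" and far: "\<And>i j. i \<le> j \<Longrightarrow> j \<le> m \<Longrightarrow> j - i \<le> d (c i) (c j)"
      using descending_qpath[of m c stride "r S"] cV step rV by blast+
    have dS: "d (r 0) (r s) = s" using rayD(2)[OF r] by simp
    have "btw (r 0) (r s) (r S)" using rayD[OF r] S(1) by (simp add: btw_def)
    then obtain u where u: "btw (r 0) u (p 0) \<or> btw (p 0) u (r S)" "d (r s) u \<le> \<delta>"
      using thinD[OF thin_triangles _ rV pV rV] by blast
    have uV: "u \<in> V" using u(1) btw_V by blast
    have "\<not> btw (r 0) u (p 0)"
    proof
      assume "btw (r 0) u (p 0)"
      then have "d (r 0) u \<le> d (r 0) (p 0)" by (simp add: btw_def)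
      moreover have "d (r 0) (r s) \<le> d (r 0) u + d u (r s)" using tri rV uV by blast
      ultimately show False using s u(2) dS d_sym[of u "r s"] by linarith
    qed
    then obtain i where i: "i \<le> m" "d u (c i) \<le> D1" using D1[OF qp] u(1) c0 by auto
    have si: "d (r s) (c i) \<le> D"
      using tri[OF rV[of s] uV cV[OF i(1)]] u(2) i(2) unfolding D_def by linarith
    have "i \<le> d (c 0) (c i)" using far[of 0 i] i(1) by simp
    also have "\<dots> \<le> d (p 0) (r s) + d (r s) (c i)" using tri[OF pV[of 0] rV[of s] cV[OF i(1)]] c0 by simp
    also have "\<dots> < k" using si d_sym[of "p 0" "r s"] by (simp add: k_def)
    finally have "c i = p i" by (simp add: c_def)
    then show ?thesis using si by auto
  qed
  then show ?thesis by (meson Suc_le_lessD)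
qed

text \<open>All trajectories pass through the ball of radius \<open>D\<close> around a far point of the ray, and the size of
  this ball is bounded.\<close>

lemma trajectories_merge:
  "\<exists>K. \<forall>r P. ray r \<longrightarrow> finite P \<longrightarrow> (\<forall>p\<in>P. trajectory r p) \<longrightarrow> K < card P \<longrightarrow>
    (\<exists>p\<in>P. \<exists>p'\<in>P. p \<noteq> p' \<and> (\<exists>i j. p i = p' j))"
proof -
  obtain D where D: "\<And>r p. ray r \<Longrightarrow> trajectory r p \<Longrightarrow> \<exists>s0. \<forall>s\<ge>s0. \<exists>k. d (r s) (p k) \<le> D"
    using trajectory_near_ray by blast
  obtain K where K: "\<And>x. x \<in> V \<Longrightarrow> card {y \<in> V. d x y \<le> D} \<le> K" using ball_bound by blast
  have "\<exists>p\<in>P. \<exists>p'\<in>P. p \<noteq> p' \<and> (\<exists>i j. p i = p' j)"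
    if r: "ray r" and P: "finite P" "\<forall>p\<in>P. trajectory r p" "K < card P" for r P
  proof -
    have "\<forall>p\<in>P. \<exists>s0. \<forall>s\<ge>s0. \<exists>k. d (r s) (p k) \<le> D" using D[OF r] P(2) by blast
    then obtain s0 where s0: "\<And>p s. p \<in> P \<Longrightarrow> s \<ge> s0 p \<Longrightarrow> \<exists>k. d (r s) (p k) \<le> D" by metis
    define s where "s = Max (insert 0 (s0 ` P))"
    have "\<And>p. p \<in> P \<Longrightarrow> s \<ge> s0 p" unfolding s_def using P(1) by auto
    then have "\<forall>p\<in>P. \<exists>k. d (r s) (p k) \<le> D" using s0 by blast
    then obtain k where k: "\<And>p. p \<in> P \<Longrightarrow> d (r s) (p (k p)) \<le> D" by metis
    have pV: "p i \<in> V" if "p \<in> P" for p i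
    proof -
      obtain q where "ray q" "q 0 = p i" using P(2) \<open>p \<in> P\<close> unfolding trajectory_def by blast
      then show ?thesis using rayD(1)[of q 0] by simp
    qed
    have "(\<lambda>p. p (k p)) ` P \<subseteq> {y \<in> V. d (r s) y \<le> D}" using k pV by auto
    then have "card ((\<lambda>p. p (k p)) ` P) \<le> K"
      using card_mono[OF finite_ball[OF rayD(1)[OF r]]] K[OF rayD(1)[OF r]] le_trans by blast
    then have "\<not> inj_on (\<lambda>p. p (k p)) P" using P(3) card_image by force
    then show ?thesis unfolding inj_on_def by blast
  qed
  then show ?thesis by blast
qed

end

section \<open>Word metrics\<close>

definition graph_dist :: "('v \<times> 'v) set \<Rightarrow> 'v \<Rightarrow> 'v \<Rightarrow> nat" where
  "graph_dist A x y = (LEAST n. (x, y) \<in> A ^^ n)"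

lemma graph_dist_le: "(x, y) \<in> A ^^ n \<Longrightarrow> graph_dist A x y \<le> n"
  unfolding graph_dist_def by (rule Least_le)

lemma graph_dist_attained:
  assumes "(x, y) \<in> A\<^sup>*"
  shows "(x, y) \<in> A ^^ graph_dist A x y"
  unfolding graph_dist_def using LeastI_ex[of "\<lambda>n. (x, y) \<in> A ^^ n"] assms by (simp add: rtrancl_power)

lemma sym_relpow: "sym A \<Longrightarrow> sym (A ^^ n)"
proof (induction n)
  case (Suc n)
  show ?case
  proof (rule symI)
    fix x z assume "(x, z) \<in> A ^^ Suc n"
    then obtain y where "(x, y) \<in> A ^^ n" "(y, z) \<in> A" by auto
    then have "(y, x) \<in> A ^^ n" "(z, y) \<in> A" using Suc by (auto dest: symD)
    then show "(z, x) \<in> A ^^ Suc n" by (rule relpow_Suc_I2[rotated])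
  qed
qed (auto simp: sym_def)

lemma discrete_geodesic_graph_dist:
  assumes "A \<subseteq> V \<times> V" and "sym A" and conn: "\<And>x y. x \<in> V \<Longrightarrow> y \<in> V \<Longrightarrow> (x, y) \<in> A\<^sup>*"
  shows "discrete_geodesic V (graph_dist A)"
proof
  note att = graph_dist_attained[OF conn]
  show "graph_dist A x x = 0" for x using graph_dist_le[of x x 0 A] by simp
  show "x = y" if "x \<in> V" "y \<in> V" "graph_dist A x y = 0" for x y
    using att[OF that(1,2)] that(3) by simp
  show "graph_dist A x y = graph_dist A y x" for x y
    using sym_relpow[OF assms(2)] unfolding graph_dist_def sym_def by metis
  show tri: "graph_dist A x z \<le> graph_dist A x y + graph_dist A y z" if "x \<in> V" "y \<in> V" "z \<in> V" for x y z
    by (rule graph_dist_le) (use att that in \<open>auto simp: relpow_add\<close>)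
  show "\<exists>f. f 0 = x \<and> f (graph_dist A x y) = y \<and> (\<forall>i\<le>graph_dist A x y. f i \<in> V) \<and>
      (\<forall>i j. i \<le> j \<longrightarrow> j \<le> graph_dist A x y \<longrightarrow> graph_dist A (f i) (f j) = j - i)"
    if xy: "x \<in> V" "y \<in> V" for x y
  proof -
    define n where "n = graph_dist A x y"
    obtain f where f: "f 0 = x" "f n = y" "\<And>i. i < n \<Longrightarrow> (f i, f (Suc i)) \<in> A"
      using att[OF xy] unfolding n_def relpow_fun_conv by blast
    have fV: "f i \<in> V" if "i \<le> n" for i
    proof (cases i)
      case (Suc l)
      then have "(f l, f i) \<in> A" using f(3)[of l] that by simp
      then show ?thesis using assms(1) by auto
    qed (use f(1) xy in simp)
    have le: "graph_dist A (f i) (f j) \<le> j - i" if "i \<le> j" "j \<le> n" for i j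
    proof (rule graph_dist_le)
      show "(f i, f j) \<in> A ^^ (j - i)"
        unfolding relpow_fun_conv using that f(3) by (intro exI[of _ "\<lambda>l. f (i + l)"]) auto
    qed
    have "graph_dist A (f i) (f j) = j - i" if ij: "i \<le> j" "j \<le> n" for i j
    proof -
      have "n \<le> graph_dist A (f 0) (f i) + graph_dist A (f i) (f n)"
        "graph_dist A (f i) (f n) \<le> graph_dist A (f i) (f j) + graph_dist A (f j) (f n)"
        unfolding n_def using tri fV ij f(1,2) xy n_def by auto
      then show ?thesis using le[of 0 i] le[of i j] le[of j n] ij by linarith
    qed
    then show ?thesis using f fV unfolding n_def by (intro exI[of _ f]) auto
  qed
qed

lemma graph_ball_bound:
  assumes conn: "\<And>x y. x \<in> V \<Longrightarrow> y \<in> V \<Longrightarrow> (x, y) \<in> A\<^sup>*" and AV: "A \<subseteq> V \<times> V"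
    and fin: "\<And>x. x \<in> V \<Longrightarrow> finite (A `` {x}) \<and> card (A `` {x}) \<le> N" and x: "x \<in> V"
  shows "finite {y \<in> V. graph_dist A x y \<le> n} \<and> card {y \<in> V. graph_dist A x y \<le> n} \<le> (\<Sum>m\<le>n. N ^ m)"
proof -
  have sphere: "(A ^^ m) `` {x} \<subseteq> V \<and> finite ((A ^^ m) `` {x}) \<and> card ((A ^^ m) `` {x}) \<le> N ^ m" for m
  proof (induction m)
    case (Suc m)
    have e: "(A ^^ Suc m) `` {x} = (\<Union>y\<in>(A ^^ m) `` {x}. A `` {y})" by auto
    have "card (\<Union>y\<in>(A ^^ m) `` {x}. A `` {y}) \<le> (\<Sum>y\<in>(A ^^ m) `` {x}. card (A `` {y}))"
      using Suc by (intro card_UN_le) auto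
    also have "\<dots> \<le> (\<Sum>y\<in>(A ^^ m) `` {x}. N)" using Suc fin by (intro sum_mono) auto
    also have "\<dots> \<le> N ^ m * N" using Suc by simp
    finally have "card ((A ^^ Suc m) `` {x}) \<le> N ^ Suc m" unfolding e by (simp add: mult.commute)
    moreover have "finite ((A ^^ Suc m) `` {x})" unfolding e using Suc fin by blast
    moreover have "(A ^^ Suc m) `` {x} \<subseteq> V" using AV by auto
    ultimately show ?case by blast
  qed (use x in auto)
  have sub: "{y \<in> V. graph_dist A x y \<le> n} \<subseteq> (\<Union>m\<le>n. (A ^^ m) `` {x})"
    using graph_dist_attained[OF conn[OF x]] by auto
  have fin': "finite (\<Union>m\<le>n. (A ^^ m) `` {x})" using sphere by auto
  have "card {y \<in> V. graph_dist A x y \<le> n} \<le> card (\<Union>m\<le>n. (A ^^ m) `` {x})"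
    using card_mono[OF fin' sub] .
  also have "\<dots> \<le> (\<Sum>m\<le>n. card ((A ^^ m) `` {x}))" by (rule card_UN_le) simp
  also have "\<dots> \<le> (\<Sum>m\<le>n. N ^ m)" using sphere by (intro sum_mono) auto
  finally show ?thesis using finite_subset[OF sub fin'] by blast
qed

definition adj :: "('g, 'm) monoid_scheme \<Rightarrow> 'g set \<Rightarrow> ('g \<times> 'g) set" where
  "adj G S = {(g, h) \<in> carrier G \<times> carrier G. \<exists>s\<in>S. h = g \<otimes>\<^bsub>G\<^esub> s \<or> g = h \<otimes>\<^bsub>G\<^esub> s}"

abbreviation word_dist :: "('g, 'm) monoid_scheme \<Rightarrow> 'g set \<Rightarrow> 'g \<Rightarrow> 'g \<Rightarrow> nat" where
  "word_dist G S \<equiv> graph_dist (adj G S)"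

locale finitely_generated = group G for G :: "('g, 'm) monoid_scheme" (structure) +
  fixes S :: "'g set"
  assumes fgs: "finite_generating_set G S"
begin

lemma S_carrier: "s \<in> S \<Longrightarrow> s \<in> carrier G" and S_finite: "finite S"
  using fgs by (auto simp: finite_generating_set_def)

lemma adj_sub: "adj G S \<subseteq> carrier G \<times> carrier G"
  by (auto simp: adj_def)

lemma adj_sym: "sym (adj G S)"
  by (auto simp: adj_def sym_def)

lemma adj_connected:
  assumes "x \<in> carrier G" "y \<in> carrier G"
  shows "(x, y) \<in> (adj G S)\<^sup>*"
proof -
  have "\<forall>x\<in>carrier G. (x, x \<otimes> g) \<in> (adj G S)\<^sup>*" if "g \<in> generate G S" for g
    using that
  proof induction
    case (incl s)
    have "(x, x \<otimes> s) \<in> adj G S" if "x \<in> carrier G" for x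
      using that incl S_carrier by (auto simp: adj_def)
    then show ?case by blast
  next
    case (inv s)
    have "(x, x \<otimes> inv s) \<in> adj G S" if "x \<in> carrier G" for x
    proof -
      have "x = (x \<otimes> inv s) \<otimes> s" using that inv S_carrier by (simp add: m_assoc)
      then show ?thesis using that inv S_carrier unfolding adj_def by blast
    qed
    then show ?case by blast
  next
    case (eng h1 h2)
    have "h1 \<in> carrier G" "h2 \<in> carrier G" using eng(1,2) fgs by (auto simp: finite_generating_set_def)
    then show ?case using eng(3,4) by (metis m_assoc m_closed rtrancl_trans)
  qed simp
  moreover have "inv x \<otimes> y \<in> generate G S" using assms fgs by (simp add: finite_generating_set_def)
  moreover have "x \<otimes> (inv x \<otimes> y) = y" using assms by (simp add: m_assoc[symmetric])
  ultimately show ?thesis using assms by metis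
qed

sublocale W: discrete_geodesic "carrier G" "word_dist G S"
  by (rule discrete_geodesic_graph_dist[OF adj_sub adj_sym adj_connected])

lemma word_ball_bound:
  assumes "x \<in> carrier G"
  shows "finite {y \<in> carrier G. word_dist G S x y \<le> n}"
    and "card {y \<in> carrier G. word_dist G S x y \<le> n} \<le> (\<Sum>m\<le>n. (card S + card S) ^ m)"
proof -
  have "finite (adj G S `` {g}) \<and> card (adj G S `` {g}) \<le> card S + card S" if g: "g \<in> carrier G" for g
  proof -
    have "adj G S `` {g} \<subseteq> (\<lambda>s. g \<otimes> s) ` S \<union> (\<lambda>s. g \<otimes> inv s) ` S"
    proof
      fix h assume "h \<in> adj G S `` {g}"
      then obtain s where h: "h \<in> carrier G" "s \<in> S" "h = g \<otimes> s \<or> g = h \<otimes> s" by (auto simp: adj_def)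
      then have "h = g \<otimes> s \<or> h = g \<otimes> inv s" using S_carrier inv_solve_right' g by metis
      then show "h \<in> (\<lambda>s. g \<otimes> s) ` S \<union> (\<lambda>s. g \<otimes> inv s) ` S" using h(2) by blast
    qed
    moreover have "card ((\<lambda>s. g \<otimes> s) ` S \<union> (\<lambda>s. g \<otimes> inv s) ` S) \<le> card S + card S"
      by (rule le_trans[OF card_Un_le add_mono]) (rule card_image_le[OF S_finite])+
    moreover have "finite ((\<lambda>s. g \<otimes> s) ` S \<union> (\<lambda>s. g \<otimes> inv s) ` S)" using S_finite by simp
    ultimately show ?thesis using card_mono finite_subset le_trans by metis
  qed
  from graph_ball_bound[OF adj_connected adj_sub this assms]
  show "finite {y \<in> carrier G. word_dist G S x y \<le> n}"
    and "card {y \<in> carrier G. word_dist G S x y \<le> n} \<le> (\<Sum>m\<le>n. (card S + card S) ^ m)" by auto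
qed

lemma adj_mult: "g \<in> carrier G \<Longrightarrow> (x, y) \<in> adj G S \<Longrightarrow> (g \<otimes> x, g \<otimes> y) \<in> adj G S"
  using S_carrier by (auto simp: adj_def m_assoc)

lemma word_dist_mult:
  assumes "g \<in> carrier G" "x \<in> carrier G" "y \<in> carrier G"
  shows "word_dist G S (g \<otimes> x) (g \<otimes> y) = word_dist G S x y"
proof -
  have le: "word_dist G S (g \<otimes> x) (g \<otimes> y) \<le> word_dist G S x y"
    if g: "g \<in> carrier G" "x \<in> carrier G" "y \<in> carrier G" for g x y
  proof (rule graph_dist_le)
    obtain f where "f 0 = x" "f (word_dist G S x y) = y" "\<forall>i<word_dist G S x y. (f i, f (Suc i)) \<in> adj G S"
      using graph_dist_attained[OF adj_connected[OF g(2,3)]] unfolding relpow_fun_conv by blast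
    then show "(g \<otimes> x, g \<otimes> y) \<in> adj G S ^^ word_dist G S x y"
      unfolding relpow_fun_conv using adj_mult[OF g(1)] by (intro exI[of _ "\<lambda>i. g \<otimes> f i"]) auto
  qed
  show ?thesis
    using le[OF assms] le[of "inv g" "g \<otimes> x" "g \<otimes> y"] assms by (simp add: m_assoc[symmetric])
qed

lemma word_dist_adj: "(x, y) \<in> adj G S \<Longrightarrow> word_dist G S x y \<le> 1"
  using graph_dist_le[of x y 1 "adj G S"] by simp

lemma word_dist_Lipschitz:
  assumes "finite_generating_set G S'"
  shows "\<exists>L. \<forall>x\<in>carrier G. \<forall>y\<in>carrier G. word_dist G S' x y \<le> L * word_dist G S x y"
proof -
  interpret S': finitely_generated G S' by unfold_locales (rule assms)
  define L where "L = Max (insert 0 ((\<lambda>s. word_dist G S' \<one> s) ` S))"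
  have gen: "word_dist G S' \<one> s \<le> L" if "s \<in> S" for s
    unfolding L_def using S_finite that by simp
  have edge: "word_dist G S' x y \<le> L" if xy: "(x, y) \<in> adj G S" for x y
  proof -
    have e: "word_dist G S' z (z \<otimes> s) \<le> L" if "z \<in> carrier G" "s \<in> S" for z s
      using S'.word_dist_mult[of z \<one> s] gen[OF that(2)] S_carrier that by simp
    obtain s where "x \<in> carrier G" "y \<in> carrier G" "s \<in> S" "y = x \<otimes> s \<or> x = y \<otimes> s"
      using xy by (auto simp: adj_def)
    then show ?thesis using e S'.W.d_sym[of x y] by metis
  qed
  have "word_dist G S' x y \<le> L * word_dist G S x y" if xy: "x \<in> carrier G" "y \<in> carrier G" for x y
  proof -
    define n where "n = word_dist G S x y"
    obtain f where f: "f 0 = x" "f n = y" "\<forall>i<n. (f i, f (Suc i)) \<in> adj G S"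
      using graph_dist_attained[OF adj_connected[OF xy]] unfolding relpow_fun_conv n_def by blast
    have fV: "f i \<in> carrier G" if "i \<le> n" for i
    proof (cases i)
      case (Suc l)
      then have "(f l, f i) \<in> adj G S" using f(3) that by simp
      then show ?thesis using adj_sub by auto
    qed (use f(1) xy in simp)
    show ?thesis
      using S'.W.path_length[of n f L 0 n] fV edge f by (simp add: n_def)
  qed
  then show ?thesis by blast
qed

end

section \<open>The metric of the Cayley graph\<close>

definition edge_point :: "'g \<Rightarrow> 'g \<Rightarrow> real \<Rightarrow> 'g \<Rightarrow> real" where
  "edge_point g h a = (\<lambda>x. (1 - a) * indicator {g} x + a * indicator {h} x)"

abbreviation vertex :: "'g \<Rightarrow> 'g \<Rightarrow> real" where
  "vertex g \<equiv> indicator {g}"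

lemma edge_point_0 [simp]: "edge_point g h 0 = vertex g" and edge_point_1 [simp]: "edge_point g h 1 = vertex h"
  and edge_point_same [simp]: "edge_point g g a = vertex g"
  by (auto simp: edge_point_def fun_eq_iff algebra_simps indicator_def)

lemma edge_point_swap: "edge_point g h a = edge_point h g (1 - a)"
  by (auto simp: edge_point_def)

lemma edist_nonneg: "0 \<le> edist n u v"
  by (simp add: edist_def L2_set_nonneg)

lemma edist_sym: "edist n u v = edist n v u"
  by (simp add: edist_def L2_set_def power2_commute)

lemma edist_1: "edist 1 u v = \<bar>u 0 - v 0\<bar>"
  by (simp add: edist_def L2_set_def)

lemma cc_string_points: "cc_string X x y l \<Longrightarrow> x \<in> cc_points X \<and> y \<in> cc_points X"
  by (induction rule: cc_string.induct) (auto simp: cc_points_def)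

lemma cc_string_nonneg: "cc_string X x y l \<Longrightarrow> 0 \<le> l"
  by (induction rule: cc_string.induct) (auto simp: edist_nonneg)

lemma cc_string_append: "cc_string X y z m \<Longrightarrow> cc_string X x y l \<Longrightarrow> cc_string X x z (l + m)"
proof (induction rule: cc_string.induct)
  case (step x' c u l' v)
  then show ?case using cc_string.step[of X x c u "l + l'" v] by (simp add: add.assoc)
qed simp

lemma cc_string_segment:
  assumes "c \<in> cubes X" "u \<in> cube_at X c" "v \<in> cube_at X c"
  shows "cc_string X (glue X c u) (glue X c v) (edist (cdim X c) u v)"
  using cc_string.step[OF cc_string.refl assms] assms by (auto simp: cc_points_def)

lemma cc_string_sym: "cc_string X x y l \<Longrightarrow> cc_string X y x l"
proof (induction rule: cc_string.induct)
  case (step x c u l v)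
  then show ?case
    using cc_string_append[OF step.IH cc_string_segment[of c X v u]] by (simp add: edist_sym add.commute)
qed (rule cc_string.refl)

lemma cc_dist_le: "cc_string X x y l \<Longrightarrow> cc_dist X x y \<le> l"
proof -
  assume l: "cc_string X x y l"
  have "bdd_below {l. cc_string X x y l}" using cc_string_nonneg by (intro bdd_belowI[of _ 0]) auto
  then have "Inf {l. cc_string X x y l} \<le> l" using l by (intro cInf_lower) auto
  then show ?thesis using l by (auto simp: cc_dist_def)
qed

lemma cc_dist_ge:
  assumes "cc_string X x y l0" and "\<And>l. cc_string X x y l \<Longrightarrow> b \<le> l"
  shows "b \<le> cc_dist X x y"
  using assms by (auto simp: cc_dist_def intro!: cInf_greatest)

lemma cc_dist_sym: "cc_dist X x y = cc_dist X y x"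
proof -
  have "cc_string X x y = cc_string X y x" by (intro ext iffI) (rule cc_string_sym, assumption)+
  then show ?thesis by (simp add: cc_dist_def)
qed

lemma cc_dist_nonneg: "0 \<le> cc_dist X x y"
  using cc_string_nonneg by (auto simp: cc_dist_def intro!: cInf_greatest)

lemma cc_dist_refl: "x \<in> cc_points X \<Longrightarrow> cc_dist X x x = 0"
  using cc_dist_le[OF cc_string.refl] cc_dist_nonneg by (metis antisym)

lemma cc_dist_triangle:
  assumes "cc_string X x y l0" "cc_string X y z m0"
  shows "cc_dist X x z \<le> cc_dist X x y + cc_dist X y z"
proof -
  have "cc_dist X x z - m \<le> cc_dist X x y" if "cc_string X y z m" for m
    by (rule cc_dist_ge[OF assms(1)]) (use cc_dist_le[OF cc_string_append[OF that]] in fastforce)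
  then have "cc_dist X x z - cc_dist X x y \<le> m" if "cc_string X y z m" for m
    using that by fastforce
  from cc_dist_ge[OF assms(2) this] show ?thesis by linarith
qed

lemma cc_string_Lipschitz:
  assumes "\<And>c u v. \<lbrakk>c \<in> cubes X; u \<in> cube_at X c; v \<in> cube_at X c\<rbrakk>
      \<Longrightarrow> F (glue X c v) \<le> F (glue X c u) + edist (cdim X c) u v"
    and "cc_string X x y l"
  shows "F y \<le> F x + (l :: real)"
  using assms(2) by induction (use assms(1) in fastforce)+

context finitely_generated
begin

abbreviation "CG \<equiv> cayley_graph G S"
abbreviation "CP \<equiv> cc_points CG"
abbreviation "CD \<equiv> cc_dist CG"
abbreviation "dist_S \<equiv> word_dist G S"

lemma cayley_cube_cases:
  assumes "c \<in> cubes CG"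
  obtains (vertex) g where "c = (g, g)" "g \<in> carrier G" "cdim CG c = 0" "\<And>u. glue CG c u = vertex g"
  | (edge) g h where "c = (g, h)" "g \<noteq> h" "(g, h) \<in> adj G S" "cdim CG c = 1"
      "\<And>u. glue CG c u = edge_point g h (u 0)"
proof -
  obtain g h where c: "c = (g, h)" by (cases c)
  have gh: "g \<in> carrier G" "h \<in> carrier G" "h = g \<or> (\<exists>s\<in>S. h = g \<otimes> s)"
    using assms by (auto simp: cayley_graph_def c)
  have glue: "glue CG c u = edge_point g h (u 0)" for u
    by (simp add: cayley_graph_def c edge_point_def)
  show thesis
  proof (cases "h = g")
    case True
    then show ?thesis using vertex[of g] gh glue by (simp add: c cayley_graph_def)
  next
    case False
    then have "(g, h) \<in> adj G S" using gh by (auto simp: adj_def)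
    then show ?thesis using edge[of g h] False glue by (auto simp: c cayley_graph_def)
  qed
qed

lemma vertex_in_CP: "g \<in> carrier G \<Longrightarrow> vertex g \<in> CP"
  unfolding cc_points_def
  by (rule UN_I[of "(g, g)"], simp add: cayley_graph_def, rule image_eqI[of _ _ "\<lambda>_. 0"])
    (auto simp: cayley_graph_def unit_cube_def fun_eq_iff)

lemma edge_string:
  assumes "(g, h) \<in> adj G S" "0 \<le> a" "a \<le> 1" "0 \<le> b" "b \<le> 1"
  shows "\<exists>l\<le>\<bar>a - b\<bar>. cc_string CG (edge_point g h a) (edge_point g h b) l"
proof -
  have gen: "\<exists>l\<le>\<bar>a - b\<bar>. cc_string CG (edge_point g h a) (edge_point g h b) l"
    if gh: "g \<in> carrier G" "h \<in> carrier G" "s \<in> S" "h = g \<otimes> s"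
      and ab: "0 \<le> a" "a \<le> 1" "0 \<le> b" "b \<le> 1" for g h s a b
  proof (cases "g = h")
    case True
    then show ?thesis using cc_string.refl[OF vertex_in_CP] gh by (intro exI[of _ 0]) auto
  next
    case False
    define u :: "real \<Rightarrow> nat \<Rightarrow> real" where "u t = (\<lambda>i. if i = 0 then t else 0)" for t
    have c: "(g, h) \<in> cubes CG" "cdim CG (g, h) = 1" using gh False by (auto simp: cayley_graph_def)
    have g: "glue CG (g, h) (u t) = edge_point g h t" for t
      by (simp add: cayley_graph_def u_def edge_point_def)
    have "u a \<in> cube_at CG (g, h)" "u b \<in> cube_at CG (g, h)"
      using ab c by (auto simp: unit_cube_def u_def)
    from cc_string_segment[OF c(1) this] have "cc_string CG (edge_point g h a) (edge_point g h b) \<bar>a - b\<bar>"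
      unfolding g c(2) edist_1 by (simp add: u_def)
    then show ?thesis by blast
  qed
  obtain s where s: "s \<in> S" "h = g \<otimes> s \<or> g = h \<otimes> s" "g \<in> carrier G" "h \<in> carrier G"
    using assms(1) by (auto simp: adj_def)
  then show ?thesis
  proof (cases "h = g \<otimes> s")
    case False
    then have "\<exists>l\<le>\<bar>(1 - a) - (1 - b)\<bar>. cc_string CG (edge_point h g (1 - a)) (edge_point h g (1 - b)) l"
      using gen[of h g s "1 - a" "1 - b"] s assms by auto
    then show ?thesis by (simp add: edge_point_swap[of g h] abs_minus_commute)
  qed (use gen s assms in blast)
qed

lemma edge_point_in_CP: "(g, h) \<in> adj G S \<Longrightarrow> 0 \<le> a \<Longrightarrow> a \<le> 1 \<Longrightarrow> edge_point g h a \<in> CP"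
  using edge_string[of g h a a] cc_string_points[of CG] by auto

lemma CP_cases:
  assumes "p \<in> CP"
  obtains g h a where "g \<in> carrier G" "h \<in> carrier G" "p = edge_point g h a"
    "0 \<le> a" "a \<le> 1" "g = h \<or> (g, h) \<in> adj G S"
proof -
  obtain c u where c: "c \<in> cubes CG" "u \<in> cube_at CG c" "p = glue CG c u"
    using assms by (auto simp: cc_points_def)
  show thesis
    using c(1)
  proof (cases rule: cayley_cube_cases)
    case (vertex g)
    then show ?thesis using that[of g g 0] c by simp
  next
    case (edge g h)
    then show ?thesis using that[of g h "u 0"] c adj_sub by (auto simp: unit_cube_def)
  qed
qed

lemma near_vertex:
  assumes "p \<in> CP"
  shows "\<exists>g\<in>carrier G. \<exists>l\<le>1. cc_string CG p (vertex g) l"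
proof -
  obtain g h a where p: "g \<in> carrier G" "p = edge_point g h a" "0 \<le> a" "a \<le> 1" "g = h \<or> (g, h) \<in> adj G S"
    using CP_cases[OF assms] by metis
  show ?thesis
    using p(5)
  proof
    assume "g = h"
    then show ?thesis using p cc_string.refl[OF vertex_in_CP[OF p(1)]] by (intro bexI[of _ g] exI[of _ 0]) auto
  next
    assume "(g, h) \<in> adj G S"
    from edge_string[OF this p(3,4), of 0] p(2,3) obtain l where
      "l \<le> a" "cc_string CG p (vertex g) l" by auto
    then show ?thesis using p(1,4) by (intro bexI[of _ g] exI[of _ l]) auto
  qed
qed

lemma vertex_string:
  assumes x: "x \<in> carrier G" and y: "y \<in> carrier G"
  shows "\<exists>l\<le>real (dist_S x y). cc_string CG (vertex x) (vertex y) l"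
proof -
  have "\<exists>l\<le>real n. cc_string CG (vertex x) (vertex y) l" if "(x, y) \<in> adj G S ^^ n" for n y
    using that
  proof (induction n arbitrary: y)
    case 0
    then show ?case using cc_string.refl[OF vertex_in_CP[OF x]] by auto
  next
    case (Suc n)
    then obtain z where z: "(x, z) \<in> adj G S ^^ n" "(z, y) \<in> adj G S" by auto
    obtain l where l: "l \<le> real n" "cc_string CG (vertex x) (vertex z) l" using Suc.IH[OF z(1)] by blast
    obtain m where "m \<le> 1" "cc_string CG (vertex z) (vertex y) m" using edge_string[OF z(2), of 0 1] by auto
    then show ?case using cc_string_append[OF _ l(2)] l(1) by (intro exI[of _ "l + m"]) auto
  qed
  then show ?thesis using graph_dist_attained[OF adj_connected[OF x y]] by blast
qed

lemma CP_connected: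
  assumes "p \<in> CP" "q \<in> CP"
  shows "\<exists>l. cc_string CG p q l"
proof -
  obtain g h l m k where "cc_string CG p (vertex g) l" "cc_string CG q (vertex h) m" "cc_string CG (vertex g) (vertex h) k"
    using near_vertex[OF assms(1)] near_vertex[OF assms(2)] vertex_string by meson
  then show ?thesis using cc_string_append cc_string_sym by meson
qed

lemma CD_tri: "p \<in> CP \<Longrightarrow> q \<in> CP \<Longrightarrow> r \<in> CP \<Longrightarrow> CD p r \<le> CD p q + CD q r"
  using CP_connected cc_dist_triangle by metis

text \<open>The distance of the vertex \<open>g\<close> from a point \<open>p\<close>: the support of \<open>p\<close> consists of the ends of an edge
  or of one vertex, and the distance from \<open>p\<close> to such a vertex \<open>x\<close> is \<open>1 - p x\<close>. This function is \<open>1\<close>-Lipschitz on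
  every edge and therefore bounds the length of strings from below.\<close>

definition height :: "'g \<Rightarrow> ('g \<Rightarrow> real) \<Rightarrow> real" where
  "height g p = Min ((\<lambda>x. real (dist_S g x) + (1 - p x)) ` {x. p x \<noteq> 0})"

lemma height_vertex: "height g (vertex x) = real (dist_S g x)"
proof -
  have "{y. vertex x y \<noteq> (0::real)} = {x}" by (auto simp: indicator_def)
  then show ?thesis by (simp add: height_def)
qed

lemma height_edge:
  assumes g: "g \<in> carrier G" and xy: "(x, y) \<in> adj G S" "x \<noteq> y" and a: "0 \<le> a" "a \<le> 1"
  shows "height g (edge_point x y a) = min (real (dist_S g x) + a) (real (dist_S g y) + (1 - a))"
proof -
  have V: "x \<in> carrier G" "y \<in> carrier G" using xy adj_sub by auto
  have "dist_S g x \<le> dist_S g y + dist_S y x" "dist_S g y \<le> dist_S g x + dist_S x y"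
    using W.tri g V by auto
  then have close: "dist_S g x \<le> dist_S g y + 1" "dist_S g y \<le> dist_S g x + 1"
    using word_dist_adj[OF xy(1)] W.d_sym[of x y] by linarith+
  consider "a = 0" | "a = 1" | "0 < a" "a < 1" using a by linarith
  then show ?thesis
  proof cases
    case 3
    then have "{z. edge_point x y a z \<noteq> 0} = {x, y}" using xy(2) by (auto simp: edge_point_def indicator_def)
    then show ?thesis using xy(2) by (simp add: height_def) (simp add: edge_point_def)
  qed (use close in \<open>auto simp: height_vertex\<close>)
qed

lemma height_Lipschitz:
  assumes g: "g \<in> carrier G" and s: "cc_string CG p q l"
  shows "height g q \<le> height g p + l"
proof (rule cc_string_Lipschitz[OF _ s])
  fix c u v assume c: "c \<in> cubes CG" "u \<in> cube_at CG c" "v \<in> cube_at CG c"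
  show "height g (glue CG c v) \<le> height g (glue CG c u) + edist (cdim CG c) u v"
    using c(1)
  proof (cases rule: cayley_cube_cases)
    case (vertex h)
    then show ?thesis by (simp add: edist_nonneg)
  next
    case (edge x y)
    then have "0 \<le> u 0" "u 0 \<le> 1" "0 \<le> v 0" "v 0 \<le> 1" using c by (auto simp: unit_cube_def)
    then have "height g (edge_point x y (u 0)) = min (real (dist_S g x) + u 0) (real (dist_S g y) + (1 - u 0))"
      "height g (edge_point x y (v 0)) = min (real (dist_S g x) + v 0) (real (dist_S g y) + (1 - v 0))"
      using height_edge[OF g edge(3,2)] by auto
    then show ?thesis unfolding edge(4,5) edist_1 by (auto simp: min_def)
  qed
qed

lemma CD_vertex:
  assumes "g \<in> carrier G" "h \<in> carrier G"
  shows "CD (vertex g) (vertex h) = real (dist_S g h)"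
proof (rule antisym)
  obtain l where l: "l \<le> real (dist_S g h)" "cc_string CG (vertex g) (vertex h) l"
    using vertex_string[OF assms] by blast
  then show "CD (vertex g) (vertex h) \<le> real (dist_S g h)" using cc_dist_le by fastforce
  show "real (dist_S g h) \<le> CD (vertex g) (vertex h)"
    by (rule cc_dist_ge[OF l(2)]) (use height_Lipschitz[OF assms(1)] in \<open>fastforce simp: height_vertex\<close>)
qed

lemma CD_near_vertex:
  assumes "p \<in> CP"
  shows "\<exists>g\<in>carrier G. CD p (vertex g) \<le> 1"
  using near_vertex[OF assms] cc_dist_le order_trans by meson

definition interp :: "(nat \<Rightarrow> 'g) \<Rightarrow> real \<Rightarrow> 'g \<Rightarrow> real" where
  "interp f t = edge_point (f (nat \<lfloor>t\<rfloor>)) (f (Suc (nat \<lfloor>t\<rfloor>))) (t - of_int \<lfloor>t\<rfloor>)"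

lemma interp_of_nat [simp]: "interp f (real n) = vertex (f n)"
  by (simp add: interp_def)

lemma interp_0 [simp]: "interp f 0 = vertex (f 0)"
  by (simp add: interp_def)

lemma interp_on_edge:
  assumes "real a \<le> t" "t \<le> real (Suc a)"
  shows "interp f t = edge_point (f a) (f (Suc a)) (t - real a)"
proof (cases "t = real (Suc a)")
  case True
  then show ?thesis using interp_of_nat[of f "Suc a"] by simp
next
  case False
  then have "\<lfloor>t\<rfloor> = int a" using assms by (intro floor_unique) auto
  then show ?thesis by (simp add: interp_def)
qed

definition geodesic_upto :: "nat \<Rightarrow> (nat \<Rightarrow> 'g) \<Rightarrow> bool" where
  "geodesic_upto n f \<longleftrightarrow> (\<forall>i\<le>n. f i \<in> carrier G) \<and> (\<forall>i j. i \<le> j \<longrightarrow> j \<le> n \<longrightarrow> dist_S (f i) (f j) = j - i)"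

lemma geodesic_upto_adj:
  assumes "geodesic_upto n f" "i < n"
  shows "(f i, f (Suc i)) \<in> adj G S"
proof -
  have "dist_S (f i) (f (Suc i)) = 1" "f i \<in> carrier G" "f (Suc i) \<in> carrier G"
    using assms by (auto simp: geodesic_upto_def)
  then show ?thesis using graph_dist_attained[OF adj_connected, of "f i" "f (Suc i)"] by simp
qed

lemma interp_upper:
  assumes "geodesic_upto n f"
  shows "0 \<le> s \<Longrightarrow> s \<le> t \<Longrightarrow> t \<le> real n \<Longrightarrow>
    interp f s \<in> CP \<and> interp f t \<in> CP \<and> CD (interp f s) (interp f t) \<le> t - s"
  using assms
proof (induction n arbitrary: s t)
  case 0
  then have st: "s = 0" "t = 0" and "f 0 \<in> carrier G" by (auto simp: geodesic_upto_def)
  have v: "vertex (f 0) \<in> CP" by (rule vertex_in_CP) fact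
  show ?case unfolding st interp_0 using cc_dist_refl[OF v] v by simp
next
  case (Suc n)
  have gn: "geodesic_upto n f" using Suc.prems(4) by (auto simp: geodesic_upto_def)
  have a: "(f n, f (Suc n)) \<in> adj G S" using geodesic_upto_adj[OF Suc.prems(4)] by simp
  have edge: "interp f s' \<in> CP \<and> interp f t' \<in> CP \<and> CD (interp f s') (interp f t') \<le> t' - s'"
    if st: "real n \<le> s'" "s' \<le> t'" "t' \<le> real (Suc n)" for s' t'
  proof -
    have e: "interp f s' = edge_point (f n) (f (Suc n)) (s' - real n)"
      "interp f t' = edge_point (f n) (f (Suc n)) (t' - real n)"
      using st by (auto intro: interp_on_edge)
    obtain l where l: "l \<le> \<bar>(s' - real n) - (t' - real n)\<bar>" "cc_string CG (interp f s') (interp f t') l"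
      unfolding e using edge_string[OF a, of "s' - real n" "t' - real n"] st by auto
    then show ?thesis using cc_string_points[OF l(2)] cc_dist_le[OF l(2)] st by auto
  qed
  consider "t \<le> real n" | "real n \<le> s" | "s < real n" "real n < t" by linarith
  then show ?case
  proof cases
    case 1
    then show ?thesis using Suc.IH[OF Suc.prems(1,2) _ gn] by simp
  next
    case 2
    then show ?thesis using edge Suc.prems by simp
  next
    case 3
    have "interp f s \<in> CP \<and> interp f (real n) \<in> CP \<and> CD (interp f s) (interp f (real n)) \<le> real n - s"
      using Suc.IH[of s "real n", OF Suc.prems(1) _ _ gn] 3 by simp
    moreover have "interp f t \<in> CP \<and> CD (interp f (real n)) (interp f t) \<le> t - real n"
      using edge[of "real n" t] 3 Suc.prems by simp
    ultimately show ?thesis using CD_tri[of "interp f s" "interp f (real n)" "interp f t"] by linarith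
  qed
qed

text \<open>The upper bound adds up segments of edges. The lower bound follows from it, because the distance of
  the two ends of the path is its length \<open>n\<close>.\<close>

lemma interp_dist:
  assumes f: "geodesic_upto n f" and st: "0 \<le> s" "s \<le> t" "t \<le> real n"
  shows "interp f s \<in> CP" "interp f t \<in> CP" "CD (interp f s) (interp f t) = t - s"
proof -
  have 1: "interp f s \<in> CP \<and> interp f t \<in> CP \<and> CD (interp f s) (interp f t) \<le> t - s"
    using interp_upper[OF f st] .
  have 2: "CD (interp f 0) (interp f s) \<le> s" "CD (interp f t) (interp f (real n)) \<le> real n - t"
    using interp_upper[OF f, of 0 s] interp_upper[OF f, of t "real n"] st by auto
  have ends: "f 0 \<in> carrier G" "f n \<in> carrier G" "dist_S (f 0) (f n) = n"
    using f by (auto simp: geodesic_upto_def)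
  then have "CD (interp f 0) (interp f (real n)) = real n" "interp f 0 \<in> CP" "interp f (real n) \<in> CP"
    using CD_vertex vertex_in_CP by auto
  then have "real n \<le> CD (interp f 0) (interp f s) + (CD (interp f s) (interp f t) + CD (interp f t) (interp f (real n)))"
    using CD_tri[of "interp f 0" "interp f s" "interp f (real n)"]
      CD_tri[of "interp f s" "interp f t" "interp f (real n)"] 1 by linarith
  then show "interp f s \<in> CP" "interp f t \<in> CP" "CD (interp f s) (interp f t) = t - s"
    using 1 2 by auto
qed

lemma interp_geodesic_segment:
  assumes f: "geodesic_upto (dist_S x y) f" "f 0 = x" "f (dist_S x y) = y"
  shows "geodesic_segment CP CD (vertex x) (vertex y) (interp f ` {0..real (dist_S x y)})"
proof -
  have V: "x \<in> carrier G" "y \<in> carrier G" using f by (auto simp: geodesic_upto_def)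
  have "CD (interp f s) (interp f t) = \<bar>s - t\<bar>"
    if "s \<in> {0..real (dist_S x y)}" "t \<in> {0..real (dist_S x y)}" for s t
    using that interp_dist(3)[OF f(1), of s t] interp_dist(3)[OF f(1), of t s]
      cc_dist_sym[of CG "interp f s" "interp f t"] by (cases "s \<le> t") auto
  moreover have "interp f \<in> {0..real (dist_S x y)} \<rightarrow> CP"
    using interp_dist(1)[OF f(1)] by auto
  ultimately show ?thesis
    unfolding geodesic_segment_def CD_vertex[OF V] using f(2,3)
    by (intro exI[of _ "interp f"]) auto
qed

text \<open>Paths of vertices interpolate to geodesic segments. The point of the other sides that thinness
  provides is rounded to a vertex, which costs at most \<open>1\<close>.\<close>

lemma thin_of_hyperbolic_space:
  assumes "hyperbolic_space CP CD"
  shows "\<exists>\<delta>. W.thin_triangles \<delta>"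
proof -
  obtain \<epsilon> where thin: "\<And>x y z A B C c. \<lbrakk>x \<in> CP; y \<in> CP; z \<in> CP; geodesic_segment CP CD x y A;
      geodesic_segment CP CD y z B; geodesic_segment CP CD x z C; c \<in> C\<rbrakk> \<Longrightarrow> \<exists>a\<in>A \<union> B. CD c a < \<epsilon>"
    using assms unfolding hyperbolic_space_def by meson
  define \<delta> where "\<delta> = nat \<lceil>\<epsilon> + 1\<rceil>"
  have "\<exists>u. (W.btw x u y \<or> W.btw y u z) \<and> dist_S w u \<le> \<delta>"
    if V: "x \<in> carrier G" "y \<in> carrier G" "z \<in> carrier G" and w: "W.btw x w z" for x y z w
  proof -
    have geo: "\<exists>f. geodesic_upto (dist_S x y) f \<and> f 0 = x \<and> f (dist_S x y) = y"
      if "x \<in> carrier G" "y \<in> carrier G" for x y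
      using W.geod[OF that] unfolding geodesic_upto_def by blast
    obtain f k where f: "geodesic_upto (dist_S x z) f" "f 0 = x" "f (dist_S x z) = z" "k \<le> dist_S x z" "f k = w"
      using W.btw_on_geodesic[OF V(1,3) w] unfolding geodesic_upto_def by blast
    obtain g where g: "geodesic_upto (dist_S x y) g" "g 0 = x" "g (dist_S x y) = y" using geo V by blast
    obtain h where h: "geodesic_upto (dist_S y z) h" "h 0 = y" "h (dist_S y z) = z" using geo V by blast
    have "interp f (real k) \<in> interp f ` {0..real (dist_S x z)}" using f(4) by (intro imageI) simp
    then have "vertex w \<in> interp f ` {0..real (dist_S x z)}" using f(5) by simp
    from thin[OF vertex_in_CP[OF V(1)] vertex_in_CP[OF V(2)] vertex_in_CP[OF V(3)]
        interp_geodesic_segment[OF g] interp_geodesic_segment[OF h] interp_geodesic_segment[OF f(1-3)] this]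
    obtain p where p: "p \<in> interp g ` {0..real (dist_S x y)} \<union> interp h ` {0..real (dist_S y z)}"
        "CD (vertex w) p < \<epsilon>" by blast
    have wV: "w \<in> carrier G" using w by (rule W.btw_V)
    have side: "\<exists>u. W.btw a u b \<and> dist_S w u \<le> \<delta>"
      if q: "geodesic_upto (dist_S a b) q" "q 0 = a" "q (dist_S a b) = b"
        and p': "p \<in> interp q ` {0..real (dist_S a b)}" for a b q
    proof -
      obtain t where t: "0 \<le> t" "t \<le> real (dist_S a b)" "p = interp q t" using p' by auto
      define m where "m = nat \<lfloor>t\<rfloor>"
      have m: "real m \<le> t" "t \<le> real m + 1" "m \<le> dist_S a b" using t unfolding m_def by linarith+
      have "dist_S (q 0) (q m) = m" "dist_S (q m) (q (dist_S a b)) = dist_S a b - m" "q m \<in> carrier G"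
        using q(1) m(3) by (auto simp: geodesic_upto_def)
      then have u: "W.btw a (q m) b" using q(2,3) m(3) by (simp add: W.btw_def)
      have "CD (interp q (real m)) (interp q t) = t - real m" using interp_dist(3)[OF q(1) _ m(1) t(2)] by simp
      then have "CD p (vertex (q m)) \<le> 1" using m t(3) cc_dist_sym[of CG p] by simp
      moreover have "p \<in> CP" using interp_dist(2)[OF q(1) _ m(1) t(2)] t(3) by simp
      ultimately have "CD (vertex w) (vertex (q m)) \<le> \<epsilon> + 1"
        using CD_tri[of "vertex w" p "vertex (q m)"] vertex_in_CP wV W.btw_V[OF u] p(2) by fastforce
      then have "real (dist_S w (q m)) \<le> \<epsilon> + 1" using CD_vertex[OF wV W.btw_V[OF u]] by simp
      then have "dist_S w (q m) \<le> \<delta>" unfolding \<delta>_def by linarith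
      then show ?thesis using u by blast
    qed
    show ?thesis using p(1) side[OF g] side[OF h] by blast
  qed
  then show ?thesis unfolding W.thin_triangles_def by blast
qed

lemma act_edge_point:
  assumes "g \<in> carrier G" "x \<in> carrier G" "y \<in> carrier G"
  shows "cayley_action G g (edge_point x y a) = edge_point (g \<otimes> x) (g \<otimes> y) a"
proof
  fix z
  have "inv g \<otimes> z = v \<longleftrightarrow> z = g \<otimes> v" if "z \<in> carrier G" "v \<in> carrier G" for v
    using assms(1) that inv_solve_left' by metis
  moreover have "z \<noteq> g \<otimes> v" if "z \<notin> carrier G" "v \<in> carrier G" for v
    using assms(1) that by auto
  ultimately show "cayley_action G g (edge_point x y a) z = edge_point (g \<otimes> x) (g \<otimes> y) a z"
    using assms by (auto simp: cayley_action_def edge_point_def indicator_def)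
qed

lemma act_CP: "g \<in> carrier G \<Longrightarrow> p \<in> CP \<Longrightarrow> cayley_action G g p \<in> CP"
proof -
  assume g: "g \<in> carrier G" and p: "p \<in> CP"
  from p obtain x y a where xy: "x \<in> carrier G" "y \<in> carrier G" "p = edge_point x y a"
    "0 \<le> a" "a \<le> 1" "x = y \<or> (x, y) \<in> adj G S" by (rule CP_cases)
  have v: "vertex (g \<otimes> x) \<in> CP" using vertex_in_CP[OF m_closed[OF g xy(1)]] .
  have "edge_point (g \<otimes> x) (g \<otimes> y) a \<in> CP" if "(x, y) \<in> adj G S"
    using edge_point_in_CP[OF adj_mult[OF g that] xy(4,5)] .
  then show "cayley_action G g p \<in> CP" unfolding xy(3) act_edge_point[OF g xy(1,2)]
    using v xy(6) by (metis edge_point_same)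
qed

lemma act_inv: "g \<in> carrier G \<Longrightarrow> p \<in> CP \<Longrightarrow> cayley_action G (inv g) (cayley_action G g p) = p"
  by (erule CP_cases) (simp add: act_edge_point m_assoc[symmetric])

lemma act_string:
  assumes g: "g \<in> carrier G" and s: "cc_string CG p q l"
  shows "cc_string CG (cayley_action G g p) (cayley_action G g q) l"
  using s
proof induction
  case (refl p)
  then show ?case using act_CP[OF g] by (intro cc_string.refl)
next
  case (step p c u l v)
  obtain x y where c: "c = (x, y)" by (cases c)
  have xy: "x \<in> carrier G" "y \<in> carrier G" "y = x \<or> (\<exists>s\<in>S. y = x \<otimes> s)"
    using step.hyps(2) by (auto simp: cayley_graph_def c)
  define c' where "c' = (g \<otimes> x, g \<otimes> y)"
  have c': "c' \<in> cubes CG" using xy g S_carrier by (auto simp: c'_def cayley_graph_def m_assoc)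
  have dim: "cdim CG c' = cdim CG c" using xy g by (simp add: c'_def c cayley_graph_def)
  have glue: "cayley_action G g (glue CG c w) = glue CG c' w" for w
    using act_edge_point[OF g xy(1,2), of "w 0"] by (simp add: c c'_def cayley_graph_def edge_point_def)
  show ?case
    using cc_string.step[of CG "cayley_action G g p" c' u l v] step c' unfolding glue dim by simp
qed

lemma act_CD:
  assumes g: "g \<in> carrier G" and p: "p \<in> CP" and q: "q \<in> CP"
  shows "CD (cayley_action G g p) (cayley_action G g q) = CD p q"
proof -
  have le: "CD (cayley_action G g p) (cayley_action G g q) \<le> CD p q"
    if g: "g \<in> carrier G" and p: "p \<in> CP" and q: "q \<in> CP" for g p q
  proof -
    obtain l0 where "cc_string CG p q l0" using CP_connected[OF p q] by blast
    then show ?thesis by (rule cc_dist_ge) (rule cc_dist_le[OF act_string[OF g]])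
  qed
  show ?thesis
    using le[OF assms] le[of "inv g" "cayley_action G g p" "cayley_action G g q"] act_inv[OF g] act_CP[OF g] assms
    by simp
qed

end

section \<open>Boundary points as classes of rays of vertices\<close>

locale hyperbolic_cayley = finitely_generated G S for G :: "('g, 'm) monoid_scheme" (structure) and S +
  fixes \<delta> :: nat
  assumes thin_\<delta>: "W.thin_triangles \<delta>"
begin

sublocale H: hyperbolic_graph "carrier G" "word_dist G S" \<delta>
  by unfold_locales (use thin_\<delta> word_ball_bound in blast)+

abbreviation "Rays \<equiv> geodesic_rays CP CD"
abbreviation "Asym \<equiv> asymptotic CP CD"
abbreviation "Z \<equiv> gromov_boundary CP CD"

lemma real_ray_CP: "\<gamma> \<in> Rays \<Longrightarrow> 0 \<le> t \<Longrightarrow> \<gamma> t \<in> CP"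
  by (auto simp: geodesic_rays_def PiE_def Pi_def)

lemma real_ray_dist: "\<gamma> \<in> Rays \<Longrightarrow> 0 \<le> s \<Longrightarrow> 0 \<le> t \<Longrightarrow> CD (\<gamma> s) (\<gamma> t) = \<bar>s - t\<bar>"
  by (auto simp: geodesic_rays_def)

text \<open>Rays are parametrised by arc length, so points of two rays that are close to each other have parameters
  that differ by a bounded amount.\<close>

lemma asymptotic_iff:
  "(\<gamma>, \<gamma>') \<in> Asym \<longleftrightarrow> \<gamma> \<in> Rays \<and> \<gamma>' \<in> Rays \<and> (\<exists>K. \<forall>t\<ge>0. CD (\<gamma> t) (\<gamma>' t) \<le> K)"
proof (intro iffI conjI)
  assume a: "(\<gamma>, \<gamma>') \<in> Asym"
  then show g: "\<gamma> \<in> Rays" "\<gamma>' \<in> Rays" by (auto simp: asymptotic_def)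
  obtain D where D: "\<forall>a\<in>\<gamma> ` {0..}. \<exists>b\<in>\<gamma>' ` {0..}. CD a b \<le> D"
    using a by (auto simp: asymptotic_def finite_hausdorff_dist_def)
  have "CD (\<gamma> t) (\<gamma>' t) \<le> 2 * D + CD (\<gamma> 0) (\<gamma>' 0)" if t: "0 \<le> t" for t
  proof -
    have "\<gamma> t \<in> \<gamma> ` {0..}" using t by simp
    with D obtain s where s: "0 \<le> s" "CD (\<gamma> t) (\<gamma>' s) \<le> D" by fastforce
    note CP = real_ray_CP[OF g(1) t] real_ray_CP[OF g(2) t] real_ray_CP[OF g(2) s(1)]
      real_ray_CP[OF g(1), of 0, simplified] real_ray_CP[OF g(2), of 0, simplified]
    have "t = CD (\<gamma> 0) (\<gamma> t)" "s = CD (\<gamma>' 0) (\<gamma>' s)"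
      using real_ray_dist[OF g(1), of 0 t] real_ray_dist[OF g(2), of 0 s] t s by auto
    moreover have "CD (\<gamma> 0) (\<gamma> t) \<le> CD (\<gamma> 0) (\<gamma>' 0) + CD (\<gamma>' 0) (\<gamma> t)"
      "CD (\<gamma>' 0) (\<gamma> t) \<le> CD (\<gamma>' 0) (\<gamma>' s) + CD (\<gamma>' s) (\<gamma> t)"
      "CD (\<gamma>' 0) (\<gamma>' s) \<le> CD (\<gamma>' 0) (\<gamma> 0) + CD (\<gamma> 0) (\<gamma>' s)"
      "CD (\<gamma> 0) (\<gamma>' s) \<le> CD (\<gamma> 0) (\<gamma> t) + CD (\<gamma> t) (\<gamma>' s)"
      using CD_tri CP by blast+
    moreover have "CD (\<gamma>' s) (\<gamma> t) = CD (\<gamma> t) (\<gamma>' s)" "CD (\<gamma>' 0) (\<gamma> 0) = CD (\<gamma> 0) (\<gamma>' 0)"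
      by (rule cc_dist_sym)+
    ultimately have "\<bar>s - t\<bar> \<le> D + CD (\<gamma> 0) (\<gamma>' 0)" using s by linarith
    moreover have "CD (\<gamma> t) (\<gamma>' t) \<le> CD (\<gamma> t) (\<gamma>' s) + CD (\<gamma>' s) (\<gamma>' t)" using CD_tri CP by blast
    ultimately show ?thesis using real_ray_dist[OF g(2) s(1) t] s(2) by linarith
  qed
  then show "\<exists>K. \<forall>t\<ge>0. CD (\<gamma> t) (\<gamma>' t) \<le> K" by blast
next
  assume a: "\<gamma> \<in> Rays \<and> \<gamma>' \<in> Rays \<and> (\<exists>K. \<forall>t\<ge>0. CD (\<gamma> t) (\<gamma>' t) \<le> K)"
  then obtain K where K: "\<forall>t\<ge>0. CD (\<gamma> t) (\<gamma>' t) \<le> K" by blast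
  then have "finite_hausdorff_dist CD (\<gamma> ` {0..}) (\<gamma>' ` {0..})"
    unfolding finite_hausdorff_dist_def by (intro exI[of _ K]) auto
  then show "(\<gamma>, \<gamma>') \<in> Asym" using a by (auto simp: asymptotic_def)
qed

lemma equiv_asymptotic: "equiv Rays Asym"
proof (rule equivI)
  show "refl_on Rays Asym"
    using cc_dist_refl[OF real_ray_CP] by (fastforce simp: refl_on_def asymptotic_iff)
  show "sym Asym" by (auto simp: sym_def asymptotic_iff cc_dist_sym)
  show "trans Asym"
  proof (rule transI)
    fix \<alpha> \<beta> \<gamma> assume ab: "(\<alpha>, \<beta>) \<in> Asym" "(\<beta>, \<gamma>) \<in> Asym"
    then obtain K L where KL: "\<forall>t\<ge>0. CD (\<alpha> t) (\<beta> t) \<le> K" "\<forall>t\<ge>0. CD (\<beta> t) (\<gamma> t) \<le> L"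
      and r: "\<alpha> \<in> Rays" "\<beta> \<in> Rays" "\<gamma> \<in> Rays" by (auto simp: asymptotic_iff)
    have "CD (\<alpha> t) (\<gamma> t) \<le> K + L" if "0 \<le> t" for t
      using CD_tri[OF real_ray_CP[OF r(1) that] real_ray_CP[OF r(2) that] real_ray_CP[OF r(3) that]] KL that
      by fastforce
    then show "(\<alpha>, \<gamma>) \<in> Asym" using r by (auto simp: asymptotic_iff)
  qed
qed (auto simp: asymptotic_def)

lemma class_eq_iff: "\<gamma> \<in> Rays \<Longrightarrow> \<gamma>' \<in> Rays \<Longrightarrow> Asym `` {\<gamma>} = Asym `` {\<gamma>'} \<longleftrightarrow> (\<gamma>, \<gamma>') \<in> Asym"
  by (rule eq_equiv_class_iff[OF equiv_asymptotic])

definition lift :: "(nat \<Rightarrow> 'g) \<Rightarrow> real \<Rightarrow> 'g \<Rightarrow> real" where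
  "lift r = restrict (interp r) {0..}"

definition endpoint :: "(nat \<Rightarrow> 'g) \<Rightarrow> (real \<Rightarrow> 'g \<Rightarrow> real) set" where
  "endpoint r = Asym `` {lift r}"

lemma ray_geodesic_upto: "H.ray r \<Longrightarrow> geodesic_upto n r"
  by (auto simp: H.ray_def geodesic_upto_def)

lemma lift_of_nat [simp]: "lift r (real n) = vertex (r n)"
  by (simp add: lift_def)

lemma lift_0 [simp]: "lift r 0 = vertex (r 0)"
  by (simp add: lift_def)

lemma lift_ray:
  assumes r: "H.ray r"
  shows "lift r \<in> Rays"
proof -
  have d: "interp r s \<in> CP \<and> CD (interp r s) (interp r t) = t - s" if "0 \<le> s" "s \<le> t" for s t
  proof -
    have "t \<le> real (nat \<lceil>t\<rceil>)" by linarith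
    from interp_dist[OF ray_geodesic_upto[OF r] that this] show ?thesis by simp
  qed
  have "CD (lift r s) (lift r t) = \<bar>s - t\<bar>" if "0 \<le> s" "0 \<le> t" for s t
    using d[of s t] d[of t s] that cc_dist_sym[of CG "interp r s" "interp r t"]
    by (cases "s \<le> t") (auto simp: lift_def)
  moreover have "lift r \<in> {0..} \<rightarrow>\<^sub>E CP" using d by (auto simp: lift_def)
  ultimately show ?thesis by (simp add: geodesic_rays_def)
qed

lemma vertex_ray_CP: "H.ray r \<Longrightarrow> vertex (r n) \<in> CP"
  using vertex_in_CP H.rayD(1) by blast

lemma asymptotic_lift_iff:
  assumes g: "\<gamma> \<in> Rays" and r: "H.ray r"
  shows "(\<gamma>, lift r) \<in> Asym \<longleftrightarrow> (\<exists>K. \<forall>n. CD (\<gamma> (real n)) (vertex (r n)) \<le> K)"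
proof
  assume "(\<gamma>, lift r) \<in> Asym"
  then obtain K where "\<forall>t\<ge>0. CD (\<gamma> t) (lift r t) \<le> K" by (auto simp: asymptotic_iff)
  then have "CD (\<gamma> (real n)) (lift r (real n)) \<le> K" for n by (simp del: lift_of_nat)
  then show "\<exists>K. \<forall>n. CD (\<gamma> (real n)) (vertex (r n)) \<le> K" by auto
next
  assume "\<exists>K. \<forall>n. CD (\<gamma> (real n)) (vertex (r n)) \<le> K"
  then obtain K where K: "\<And>n. CD (\<gamma> (real n)) (vertex (r n)) \<le> K" by blast
  have "CD (\<gamma> t) (lift r t) \<le> K + 2" if t: "0 \<le> t" for t
  proof -
    define n where "n = nat \<lfloor>t\<rfloor>"
    have n: "\<bar>t - real n\<bar> \<le> 1" using t unfolding n_def by linarith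
    note l = lift_ray[OF r]
    have "CD (\<gamma> t) (\<gamma> (real n)) \<le> 1" "CD (lift r (real n)) (lift r t) \<le> 1"
      using real_ray_dist[OF g t, of "real n"] real_ray_dist[OF l _ t, of "real n"] n by auto
    moreover have "CD (\<gamma> t) (lift r t) \<le> CD (\<gamma> t) (\<gamma> (real n)) + CD (\<gamma> (real n)) (lift r t)"
      "CD (\<gamma> (real n)) (lift r t) \<le> CD (\<gamma> (real n)) (lift r (real n)) + CD (lift r (real n)) (lift r t)"
      by (intro CD_tri real_ray_CP[OF g] real_ray_CP[OF l] t of_nat_0_le_iff)+
    ultimately show ?thesis using K[of n] lift_of_nat[of r n] by simp
  qed
  then show "(\<gamma>, lift r) \<in> Asym" using g lift_ray[OF r] by (auto simp: asymptotic_iff)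
qed

lemma endpoint_eq_iff:
  assumes r: "H.ray r" and r': "H.ray r'"
  shows "endpoint r = endpoint r' \<longleftrightarrow> H.asym r r'"
proof -
  have "CD (lift r (real n)) (vertex (r' n)) = real (dist_S (r n) (r' n))" for n
    using CD_vertex H.rayD(1)[OF r] H.rayD(1)[OF r'] by simp
  then have "endpoint r = endpoint r' \<longleftrightarrow> (\<exists>K. \<forall>n. real (dist_S (r n) (r' n)) \<le> K)"
    unfolding endpoint_def class_eq_iff[OF lift_ray[OF r] lift_ray[OF r']]
      asymptotic_lift_iff[OF lift_ray[OF r] r'] by simp
  also have "\<dots> \<longleftrightarrow> H.asym r r'"
  proof
    assume "\<exists>K. \<forall>n. real (dist_S (r n) (r' n)) \<le> K"
    then obtain K where "\<And>n. real (dist_S (r n) (r' n)) \<le> K" by blast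
    then have "dist_S (r n) (r' n) \<le> nat \<lceil>K\<rceil>" for n by (meson le_nat_iff real_nat_ceiling_ge of_nat_le_iff order_trans)
    then show "H.asym r r'" by (auto simp: H.asym_def)
  next
    assume "H.asym r r'"
    then obtain K where "\<And>n. dist_S (r n) (r' n) \<le> K" by (auto simp: H.asym_def)
    then show "\<exists>K. \<forall>n. real (dist_S (r n) (r' n)) \<le> K" by (intro exI[of _ "real K"]) simp
  qed
  finally show ?thesis .
qed

lemma endpoint_eqI:
  assumes "\<gamma> \<in> Rays" "H.ray r" "\<And>n. CD (\<gamma> (real n)) (vertex (r n)) \<le> K"
  shows "endpoint r = Asym `` {\<gamma>}"
  using class_eq_iff[OF assms(1) lift_ray[OF assms(2)]] asymptotic_lift_iff[OF assms(1,2)] assms(3)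
  by (auto simp: endpoint_def)

lemma endpoint_in_Z: "H.ray r \<Longrightarrow> endpoint r \<in> Z"
  by (simp add: endpoint_def gromov_boundary_def quotientI lift_ray)

text \<open>The bound is uniform over all rays that start close to the vertex \<open>p\<close>. This uniformity is what the
  limit argument in \<open>closed_prefix_condition\<close> rests on.\<close>

lemma real_ray_shadowed:
  assumes p: "p \<in> carrier G"
  shows "\<exists>K. \<forall>\<gamma>\<in>Rays. CD (vertex p) (\<gamma> 0) \<le> C \<longrightarrow>
    (\<exists>r. H.ray r \<and> r 0 = p \<and> (\<forall>n. CD (\<gamma> (real n)) (vertex (r n)) \<le> K))"
proof -
  obtain K where K: "\<And>q v. q \<in> carrier G \<Longrightarrow> (\<forall>n. v n \<in> carrier G) \<Longrightarrow> dist_S q (v 0) \<le> nat \<lceil>C + 1\<rceil> \<Longrightarrow>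
      (\<forall>i j. i \<le> j \<longrightarrow> dist_S (v i) (v j) \<le> (j - i) + 2 \<and> j - i \<le> dist_S (v i) (v j) + 2) \<Longrightarrow>
      \<exists>r. H.ray r \<and> r 0 = q \<and> (\<forall>t. dist_S (r t) (v t) \<le> K)"
    using H.quasi_ray_shadowed[of "nat \<lceil>C + 1\<rceil>" 2] by blast
  have "\<exists>r. H.ray r \<and> r 0 = p \<and> (\<forall>n. CD (\<gamma> (real n)) (vertex (r n)) \<le> real K + 1)"
    if g: "\<gamma> \<in> Rays" and C: "CD (vertex p) (\<gamma> 0) \<le> C" for \<gamma>
  proof -
    have gCP: "\<gamma> (real n) \<in> CP" for n using real_ray_CP[OF g] by simp
    have "\<forall>n. \<exists>x\<in>carrier G. CD (\<gamma> (real n)) (vertex x) \<le> 1" using CD_near_vertex[OF gCP] by blast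
    then obtain v where v: "\<And>n. v n \<in> carrier G" "\<And>n. CD (\<gamma> (real n)) (vertex (v n)) \<le> 1" by metis
    have vCP: "vertex (v n) \<in> CP" for n using vertex_in_CP v(1) by blast
    have q: "dist_S (v i) (v j) \<le> (j - i) + 2 \<and> j - i \<le> dist_S (v i) (v j) + 2" if "i \<le> j" for i j
    proof -
      have "CD (\<gamma> (real i)) (\<gamma> (real j)) = real (j - i)" using real_ray_dist[OF g] that by simp
      moreover have "CD (vertex (v i)) (vertex (v j)) \<le> CD (vertex (v i)) (\<gamma> (real i)) + CD (\<gamma> (real i)) (vertex (v j))"
        "CD (\<gamma> (real i)) (vertex (v j)) \<le> CD (\<gamma> (real i)) (\<gamma> (real j)) + CD (\<gamma> (real j)) (vertex (v j))"
        "CD (\<gamma> (real i)) (\<gamma> (real j)) \<le> CD (\<gamma> (real i)) (vertex (v i)) + CD (vertex (v i)) (\<gamma> (real j))"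
        "CD (vertex (v i)) (\<gamma> (real j)) \<le> CD (vertex (v i)) (vertex (v j)) + CD (vertex (v j)) (\<gamma> (real j))"
        using CD_tri gCP vCP by blast+
      moreover have "CD (vertex (v i)) (\<gamma> (real i)) = CD (\<gamma> (real i)) (vertex (v i))"
        "CD (vertex (v j)) (\<gamma> (real j)) = CD (\<gamma> (real j)) (vertex (v j))" by (rule cc_dist_sym)+
      ultimately have "real (dist_S (v i) (v j)) \<le> real (j - i) + 2 \<and> real (j - i) \<le> real (dist_S (v i) (v j)) + 2"
        using v(2)[of i] v(2)[of j] CD_vertex[OF v(1)[of i] v(1)[of j]] by linarith
      then show ?thesis by linarith
    qed
    have "real (dist_S p (v 0)) \<le> C + 1"
      using CD_tri[OF vertex_in_CP[OF p] gCP[of 0] vCP[of 0]] v(2)[of 0] C CD_vertex[OF p v(1)[of 0]] by simp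
    then have "dist_S p (v 0) \<le> nat \<lceil>C + 1\<rceil>" by linarith
    with K[OF p, of v] v(1) q obtain r where r: "H.ray r" "r 0 = p" "\<And>t. dist_S (r t) (v t) \<le> K" by blast
    have "CD (\<gamma> (real n)) (vertex (r n)) \<le> real K + 1" for n
    proof -
      have "CD (vertex (v n)) (vertex (r n)) \<le> real K"
        using CD_vertex[OF v(1) H.rayD(1)[OF r(1)], of n n] r(3)[of n] W.d_sym[of "r n" "v n"] by simp
      then show ?thesis using CD_tri[OF gCP vCP vertex_ray_CP[OF r(1)], of n n n] v(2)[of n] by linarith
    qed
    then show ?thesis using r by blast
  qed
  then show ?thesis by blast
qed

lemma ex_ray_to:
  assumes "\<xi> \<in> Z" "p \<in> carrier G"
  shows "\<exists>r. H.ray r \<and> r 0 = p \<and> endpoint r = \<xi>"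
proof -
  obtain \<gamma> where g: "\<gamma> \<in> Rays" "\<xi> = Asym `` {\<gamma>}" using assms(1) by (auto simp: gromov_boundary_def quotient_def)
  obtain K where "\<forall>\<beta>\<in>Rays. CD (vertex p) (\<beta> 0) \<le> CD (vertex p) (\<gamma> 0) \<longrightarrow>
      (\<exists>r. H.ray r \<and> r 0 = p \<and> (\<forall>n. CD (\<beta> (real n)) (vertex (r n)) \<le> K))"
    using real_ray_shadowed[OF assms(2)] by (rule exE)
  from bspec[OF this g(1)] obtain r where "H.ray r" "r 0 = p" "\<And>n. CD (\<gamma> (real n)) (vertex (r n)) \<le> K"
    by auto
  then show ?thesis using endpoint_eqI[OF g(1)] g(2) by blast
qed

lemma mult_ray:
  assumes "g \<in> carrier G" "H.ray r"
  shows "H.ray (\<lambda>i. g \<otimes> r i)"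
  using assms H.rayD[OF assms(2)] by (auto simp: H.ray_def word_dist_mult)

definition act_ray :: "'g \<Rightarrow> (real \<Rightarrow> 'g \<Rightarrow> real) \<Rightarrow> real \<Rightarrow> 'g \<Rightarrow> real" where
  "act_ray g \<gamma> = restrict (\<lambda>t. cayley_action G g (\<gamma> t)) {0..}"

lemma act_ray_Rays: "g \<in> carrier G \<Longrightarrow> \<gamma> \<in> Rays \<Longrightarrow> act_ray g \<gamma> \<in> Rays"
proof -
  assume g: "g \<in> carrier G" and r: "\<gamma> \<in> Rays"
  have "CD (act_ray g \<gamma> s) (act_ray g \<gamma> t) = \<bar>s - t\<bar>" if "0 \<le> s" "0 \<le> t" for s t
    using act_CD[OF g real_ray_CP[OF r that(1)] real_ray_CP[OF r that(2)]] real_ray_dist[OF r that] that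
    by (simp add: act_ray_def)
  moreover have "act_ray g \<gamma> \<in> {0..} \<rightarrow>\<^sub>E CP"
    using act_CP[OF g real_ray_CP[OF r]] by (simp add: act_ray_def)
  ultimately show "act_ray g \<gamma> \<in> Rays" by (simp add: geodesic_rays_def)
qed

lemma act_ray_inv: "g \<in> carrier G \<Longrightarrow> \<gamma> \<in> Rays \<Longrightarrow> act_ray (inv g) (act_ray g \<gamma>) = \<gamma>"
  using real_ray_CP[of \<gamma>] act_inv by (auto simp: act_ray_def geodesic_rays_def PiE_def extensional_def fun_eq_iff)

lemma act_ray_Asym: "g \<in> carrier G \<Longrightarrow> (\<gamma>, \<gamma>') \<in> Asym \<Longrightarrow> (act_ray g \<gamma>, act_ray g \<gamma>') \<in> Asym"
  using act_ray_Rays act_CD real_ray_CP by (simp add: asymptotic_iff) (simp add: act_ray_def)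

lemma act_class:
  assumes g: "g \<in> carrier G" and r: "\<gamma> \<in> Rays"
  shows "boundary_action G g (Asym `` {\<gamma>}) = Asym `` {act_ray g \<gamma>}"
proof -
  have "boundary_action G g (Asym `` {\<gamma>}) = act_ray g ` (Asym `` {\<gamma>})"
    by (simp add: boundary_action_def act_ray_def[abs_def])
  also have "\<dots> = Asym `` {act_ray g \<gamma>}"
  proof (intro equalityI subsetI)
    fix \<beta> assume b: "\<beta> \<in> Asym `` {act_ray g \<gamma>}"
    then have bR: "\<beta> \<in> Rays" by (auto simp: asymptotic_iff)
    have "(act_ray (inv g) (act_ray g \<gamma>), act_ray (inv g) \<beta>) \<in> Asym"
      by (rule act_ray_Asym) (use b g in auto)
    then have "act_ray (inv g) \<beta> \<in> Asym `` {\<gamma>}" using act_ray_inv[OF g r] by simp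
    moreover have "act_ray g (act_ray (inv g) \<beta>) = \<beta>" using act_ray_inv[of "inv g" \<beta>] g bR by simp
    ultimately show "\<beta> \<in> act_ray g ` (Asym `` {\<gamma>})" by (metis imageI)
  qed (use act_ray_Asym[OF g] in auto)
  finally show ?thesis .
qed

lemma act_endpoint:
  assumes g: "g \<in> carrier G" and r: "H.ray r"
  shows "boundary_action G g (endpoint r) = endpoint (\<lambda>i. g \<otimes> r i)"
proof -
  have "act_ray g (lift r) = lift (\<lambda>i. g \<otimes> r i)"
    using act_edge_point[OF g H.rayD(1)[OF r] H.rayD(1)[OF r]]
    by (auto simp: act_ray_def lift_def interp_def restrict_def fun_eq_iff)
  then show ?thesis by (simp add: endpoint_def act_class[OF g lift_ray[OF r]])
qed

lemma act_Z: "g \<in> carrier G \<Longrightarrow> \<xi> \<in> Z \<Longrightarrow> boundary_action G g \<xi> \<in> Z"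
  using ex_ray_to[OF _ one_closed] act_endpoint endpoint_in_Z mult_ray by metis

lemma act_one: "\<xi> \<in> Z \<Longrightarrow> boundary_action G \<one> \<xi> = \<xi>"
proof -
  assume "\<xi> \<in> Z"
  then obtain r where r: "H.ray r" "endpoint r = \<xi>" using ex_ray_to one_closed by blast
  then have "(\<lambda>i. \<one> \<otimes> r i) = r" using H.rayD(1)[OF r(1)] by auto
  then show ?thesis using act_endpoint[OF one_closed r(1)] r(2) by simp
qed

lemma act_mult:
  assumes "g \<in> carrier G" "h \<in> carrier G" "\<xi> \<in> Z"
  shows "boundary_action G g (boundary_action G h \<xi>) = boundary_action G (g \<otimes> h) \<xi>"
proof -
  obtain r where r: "H.ray r" "endpoint r = \<xi>" using ex_ray_to assms(3) one_closed by blast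
  have "boundary_action G g (boundary_action G h (endpoint r)) = endpoint (\<lambda>i. g \<otimes> (h \<otimes> r i))"
    using act_endpoint mult_ray assms r(1) by simp
  also have "\<dots> = endpoint (\<lambda>i. (g \<otimes> h) \<otimes> r i)"
    using H.rayD(1)[OF r(1)] assms by (simp add: m_assoc)
  finally show ?thesis using act_endpoint[of "g \<otimes> h" r] assms r by simp
qed

abbreviation "gopen \<equiv> gromov_open CP CD (vertex \<one>)"

text \<open>Rays of vertices with the same initial segment interpolate to rays that agree on an interval
  \<open>{0..T}\<close>.\<close>

lemma gopen_cylinder:
  assumes U: "gopen U" and r: "H.ray r" "r 0 = \<one>" "endpoint r \<in> U"
  shows "\<exists>n. \<forall>r'. H.ray r' \<longrightarrow> (\<forall>i<n. r' i = r i) \<longrightarrow> endpoint r' \<in> U"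
proof -
  have open_at: "\<forall>\<gamma>\<in>Rays. \<gamma> 0 = vertex \<one> \<and> Asym `` {\<gamma>} \<in> U \<longrightarrow> (\<exists>T. \<exists>\<epsilon>>0. \<forall>\<gamma>'\<in>Rays.
      \<gamma>' 0 = vertex \<one> \<and> (\<forall>t\<in>{0..T}. CD (\<gamma> t) (\<gamma>' t) < \<epsilon>) \<longrightarrow> Asym `` {\<gamma>'} \<in> U)"
    using U unfolding gromov_open_def by (rule conjunct2)
  have "lift r 0 = vertex \<one> \<and> Asym `` {lift r} \<in> U" using r(2,3) by (simp add: endpoint_def)
  from mp[OF bspec[OF open_at lift_ray[OF r(1)]] this] obtain T \<epsilon> where T: "\<epsilon> > 0"
    "\<forall>\<gamma>'\<in>Rays. \<gamma>' 0 = vertex \<one> \<and> (\<forall>t\<in>{0..T}. CD (lift r t) (\<gamma>' t) < \<epsilon>) \<longrightarrow> Asym `` {\<gamma>'} \<in> U"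
    by (elim exE conjE) (rule that)
  \<comment> \<open>At time \<open>t\<close> the interpolation depends on the vertices number \<open>\<lfloor>t\<rfloor>\<close> and \<open>\<lfloor>t\<rfloor> + 1\<close>.\<close>
  define n where "n = nat \<lceil>\<bar>T\<bar>\<rceil> + 2"
  have "endpoint r' \<in> U" if r': "H.ray r'" "\<forall>i<n. r' i = r i" for r'
    unfolding endpoint_def
  proof (rule bspec[OF T(2) lift_ray[OF r'(1)], THEN mp, OF conjI])
    have "0 < n" by (simp add: n_def)
    then show "lift r' 0 = vertex \<one>" using r'(2) r(2) by simp
    show "\<forall>t\<in>{0..T}. CD (lift r t) (lift r' t) < \<epsilon>"
    proof
      fix t assume t: "t \<in> {0..T}"
      then have "Suc (nat \<lfloor>t\<rfloor>) < n" unfolding n_def by simp linarith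
      then have "lift r' t = lift r t" using r'(2) by (simp add: lift_def interp_def restrict_def)
      then show "CD (lift r t) (lift r' t) < \<epsilon>"
        using cc_dist_refl[OF real_ray_CP[OF lift_ray[OF r(1)]]] t T(1) by simp
    qed
  qed
  then show ?thesis by blast
qed

text \<open>Suppose that points of this set come arbitrarily close to the class of \<open>\<gamma>\<close>. They are reached by rays
  from \<open>p\<close> with the given initial condition, and these follow \<open>\<gamma>\<close> for longer and longer times within a
  distance \<open>L\<close> that does not depend on the point. A limit of these rays by Koenig's lemma satisfies the
  initial condition and follows \<open>\<gamma>\<close> forever, so the class of \<open>\<gamma>\<close> belongs to the set.\<close>

lemma closed_prefix_condition:
  assumes p: "p \<in> carrier G"
  shows "gopen (Z - {\<xi>. \<exists>r. H.ray r \<and> r 0 = p \<and> Q (map r [0..<n]) \<and> endpoint r = \<xi>})" (is "gopen (Z - ?C)")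
proof -
  obtain K where K': "\<forall>\<gamma>\<in>Rays. CD (vertex \<one>) (\<gamma> 0) \<le> 0 \<longrightarrow>
      (\<exists>r. H.ray r \<and> r 0 = \<one> \<and> (\<forall>n. CD (\<gamma> (real n)) (vertex (r n)) \<le> K))"
    using real_ray_shadowed[OF one_closed] by (rule exE)
  have K: "\<exists>r. H.ray r \<and> r 0 = \<one> \<and> (\<forall>n. CD (\<gamma> (real n)) (vertex (r n)) \<le> K)"
    if "\<gamma> \<in> Rays" "\<gamma> 0 = vertex \<one>" for \<gamma>
    using bspec[OF K' that(1)] that(2) cc_dist_refl[OF vertex_in_CP[OF one_closed]] by simp
  \<comment> \<open>Steps from \<open>\<gamma>\<close> to a nearby ray, to a ray of vertices from \<open>\<one>\<close>, and to one from \<open>p\<close>.\<close>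
  define L where "L = 1 + K + real (3 * dist_S \<one> p + 8 * \<delta>)"
  have "\<exists>T. \<exists>\<epsilon>>0. \<forall>\<gamma>'\<in>Rays. \<gamma>' 0 = vertex \<one> \<and> (\<forall>t\<in>{0..T}. CD (\<gamma> t) (\<gamma>' t) < \<epsilon>) \<longrightarrow> Asym `` {\<gamma>'} \<in> Z - ?C"
    if g: "\<gamma> \<in> Rays" "\<gamma> 0 = vertex \<one>" and notC: "Asym `` {\<gamma>} \<in> Z - ?C" for \<gamma>
  proof (rule ccontr)
    assume neg: "\<not> ?thesis"
    have "\<exists>r. H.ray r \<and> r 0 = p \<and> Q (map r [0..<n]) \<and> (\<forall>i\<le>m. CD (\<gamma> (real i)) (vertex (r i)) \<le> L)" for m
    proof -
      have "\<exists>\<gamma>'\<in>Rays. \<gamma>' 0 = vertex \<one> \<and> (\<forall>t\<in>{0..real m}. CD (\<gamma> t) (\<gamma>' t) < 1) \<and> Asym `` {\<gamma>'} \<notin> Z - ?C"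
        using neg zero_less_one by blast
      then obtain \<gamma>' where g': "\<gamma>' \<in> Rays" "\<gamma>' 0 = vertex \<one>" "\<forall>t\<in>{0..real m}. CD (\<gamma> t) (\<gamma>' t) < 1"
          "Asym `` {\<gamma>'} \<notin> Z - ?C" by blast
      have "Asym `` {\<gamma>'} \<in> Z" using g'(1) by (simp add: gromov_boundary_def quotientI)
      then obtain r where r: "H.ray r" "r 0 = p" "Q (map r [0..<n])" "endpoint r = Asym `` {\<gamma>'}" using g'(4) by blast
      obtain q where q: "H.ray q" "q 0 = \<one>" "\<And>n. CD (\<gamma>' (real n)) (vertex (q n)) \<le> K" using K[OF g'(1,2)] by blast
      have "endpoint q = endpoint r" using endpoint_eqI[OF g'(1) q(1,3)] r(4) by simp
      then have "H.asym q r" using endpoint_eq_iff q(1) r(1) by blast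
      then have qr: "dist_S (q i) (r i) \<le> 3 * dist_S \<one> p + 8 * \<delta>" for i
        using H.asym_fellow[OF q(1) r(1)] q(2) r(2) by simp
      have "CD (\<gamma> (real i)) (vertex (r i)) \<le> L" if "i \<le> m" for i
      proof -
        have "CD (\<gamma> (real i)) (\<gamma>' (real i)) < 1" using g'(3) that by simp
        moreover have "CD (vertex (q i)) (vertex (r i)) \<le> real (3 * dist_S \<one> p + 8 * \<delta>)"
          unfolding CD_vertex[OF H.rayD(1)[OF q(1)] H.rayD(1)[OF r(1)]] using qr[of i] by (rule of_nat_mono)
        moreover have "CD (\<gamma> (real i)) (vertex (r i)) \<le> CD (\<gamma> (real i)) (\<gamma>' (real i)) + CD (\<gamma>' (real i)) (vertex (r i))"
          "CD (\<gamma>' (real i)) (vertex (r i)) \<le> CD (\<gamma>' (real i)) (vertex (q i)) + CD (vertex (q i)) (vertex (r i))"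
          using CD_tri real_ray_CP[OF g(1)] real_ray_CP[OF g'(1)] vertex_ray_CP[OF q(1)] vertex_ray_CP[OF r(1)]
          by simp_all
        ultimately show ?thesis using q(3)[of i] unfolding L_def by linarith
      qed
      then show ?thesis using r by blast
    qed
    then obtain r where r: "\<And>m. H.ray (r m)" "\<And>m. r m 0 = p" "\<And>m. Q (map (r m) [0..<n])"
        "\<And>m i. i \<le> m \<Longrightarrow> CD (\<gamma> (real i)) (vertex (r m i)) \<le> L" by metis
    have "finite (range (\<lambda>m. r m t))" for t
    proof (rule finite_subset[OF _ H.finite_ball[OF p, of t]])
      have "dist_S p (r m t) = t" for m using H.rayD(2)[OF r(1), of 0 t m] r(2) by simp
      then show "range (\<lambda>m. r m t) \<subseteq> {y \<in> carrier G. dist_S p y \<le> t}" using H.rayD(1)[OF r(1)] by auto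
    qed
    from koenig_diagonal[of r, OF this] obtain f where f: "\<And>t. infinite {m. \<forall>i\<le>t. r m i = f i}" by blast
    have ex: "\<exists>m\<ge>t. \<forall>i\<le>t. r m i = f i" for t
      using f[of t] unfolding infinite_nat_iff_unbounded_le by blast
    have fr: "H.ray f"
      unfolding H.ray_def
    proof (intro conjI allI impI)
      fix i show "f i \<in> carrier G" using ex[of i] H.rayD(1)[OF r(1)] by (metis order_refl)
    next
      fix i j :: nat assume "i \<le> j"
      then show "dist_S (f i) (f j) = j - i" using ex[of j] H.rayD(2)[OF r(1)] by (metis order_refl)
    qed
    have f0: "f 0 = p" using ex[of 0] r(2) by auto
    obtain m where "\<forall>i\<le>n. r m i = f i" using ex[of n] by blast
    then have "map (r m) [0..<n] = map f [0..<n]" by simp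
    then have fQ: "Q (map f [0..<n])" using r(3)[of m] by (rule subst)
    have "CD (\<gamma> (real i)) (vertex (f i)) \<le> L" for i
      using ex[of i] r(4) by (metis order_refl)
    then have "endpoint f = Asym `` {\<gamma>}" by (rule endpoint_eqI[OF g(1) fr])
    then show False using notC fr f0 fQ by blast
  qed
  then show ?thesis unfolding gromov_open_def by blast
qed

end

section \<open>Standard Borel spaces from codes\<close>

lemma completely_metrizable_nat_seq: "completely_metrizable_space (euclidean :: (nat \<Rightarrow> nat) topology)"
proof -
  have "(euclidean :: nat topology) = discrete_topology UNIV"
    by (simp add: topology_eq open_discrete)
  then have "completely_metrizable_space (euclidean :: nat topology)"
    by (metis completely_metrizable_space_discrete_topology)
  then have "completely_metrizable_space (product_topology (\<lambda>_::nat. euclidean :: nat topology) UNIV)"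
    by (simp add: completely_metrizable_space_product_topology)
  then show ?thesis by (simp add: euclidean_product_topology)
qed

lemma second_countable_euclidean_class:
  "second_countable (euclidean :: 'a :: second_countable_topology topology)"
proof -
  obtain B :: "'a set set" where B: "countable B" "topological_basis B"
    using ex_countable_basis by blast
  then show ?thesis
    unfolding second_countable_def by (metis open_openin topological_basis_def topological_basisE)
qed

lemma open_cylinder: "open {y :: nat \<Rightarrow> nat. \<forall>i<n. y i = x i}"
proof -
  have "open ((\<lambda>y. y i) -` {x i} :: (nat \<Rightarrow> nat) set)" for i
    by (rule open_vimage[OF open_discrete continuous_on_product_coordinates])
  then have "open (\<Inter>i\<in>{..<n}. (\<lambda>y. y i) -` {x i} :: (nat \<Rightarrow> nat) set)"
    by (intro open_INT) auto
  moreover have "(\<Inter>i\<in>{..<n}. (\<lambda>y. y i) -` {x i}) = {y. \<forall>i<n. y i = x i}" by auto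
  ultimately show ?thesis by simp
qed

lemma relatively_open_by_cylinders:
  fixes L X :: "(nat \<Rightarrow> nat) set"
  assumes "L \<subseteq> X" and "\<And>x. x \<in> L \<Longrightarrow> \<exists>n. \<forall>y\<in>X. (\<forall>i<n. y i = x i) \<longrightarrow> y \<in> L"
  shows "\<exists>U. open U \<and> U \<inter> X = L"
proof -
  obtain n where n: "\<And>x y. x \<in> L \<Longrightarrow> y \<in> X \<Longrightarrow> (\<forall>i<n x. y i = x i) \<Longrightarrow> y \<in> L"
    using assms(2) by metis
  have "open (\<Union>x\<in>L. {y. \<forall>i<n x. y i = x i})" using open_cylinder by blast
  moreover have "(\<Union>x\<in>L. {y. \<forall>i<n x. y i = x i}) \<inter> X = L" using n assms(1) by blast
  ultimately show ?thesis by blast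
qed

text \<open>The first condition says that \<open>X\<close> is closed, the second that each \<open>L k\<close> is relatively open in \<open>X\<close>. So
  the intersection is a \<open>G\<^sub>\<delta>\<close> set.\<close>

lemma completely_metrizable_by_cylinders:
  fixes X :: "(nat \<Rightarrow> nat) set"
  assumes X: "\<And>x. x \<notin> X \<Longrightarrow> \<exists>n. \<forall>y. (\<forall>i<n. y i = x i) \<longrightarrow> y \<notin> X"
    and L: "\<And>k. L k \<subseteq> X" "\<And>k x. x \<in> L k \<Longrightarrow> \<exists>n. \<forall>y\<in>X. (\<forall>i<n. y i = x i) \<longrightarrow> y \<in> L (k :: nat)"
  shows "completely_metrizable_space (subtopology euclidean (\<Inter>k. L k))"
proof -
  have "\<exists>U. open U \<and> U \<inter> UNIV = - X"
    by (rule relatively_open_by_cylinders) (use X in auto)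
  then have "closed X" by (simp add: closed_def)
  then have GX: "gdelta_in euclidean X"
    by (intro closed_imp_gdelta_in completely_metrizable_imp_metrizable_space completely_metrizable_nat_seq) simp
  have "\<exists>U. open U \<and> U \<inter> X = L k" for k
    by (rule relatively_open_by_cylinders[OF L])
  then obtain U where U: "\<And>k. open (U k)" "\<And>k. U k \<inter> X = L k" by metis
  have "gdelta_in euclidean (\<Inter>(range U))"
    by (rule gdelta_in_Inter) (use U(1) in \<open>auto intro: open_imp_gdelta_in\<close>)
  then have "gdelta_in euclidean (\<Inter>(range U) \<inter> X)" by (rule gdelta_in_Int[OF _ GX])
  moreover have "\<Inter>(range U) \<inter> X = (\<Inter>k. L k)" using U(2) by blast
  ultimately show ?thesis
    using completely_metrizable_space_gdelta_in[OF completely_metrizable_nat_seq] by simp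
qed

lemma sets_borel_of: "sets (borel_of T) = sigma_sets (topspace T) {U. openin T U}"
  and space_borel_of: "space (borel_of T) = topspace T"
  unfolding borel_of_def using openin_subset by (subst sets_measure_of space_measure_of; auto)+

text \<open>The topology that \<open>c\<close> pulls back from sequences of natural numbers is finer than the one generated by
  the sets in \<open>\<U>\<close>, but has the same Borel sets, as it is generated by countably many Borel sets.\<close>

lemma standard_borel_by_code:
  fixes c :: "'a \<Rightarrow> nat \<Rightarrow> nat"
  assumes M: "sets M = sigma_sets (space M) \<U>"
    and inj: "inj_on c (space M)"
    and meas: "\<And>i. (\<lambda>x. c x i) \<in> measurable M (count_space UNIV)"
    and sub: "\<And>U. U \<in> \<U> \<Longrightarrow> U \<subseteq> space M"
    and cyl: "\<And>U x. U \<in> \<U> \<Longrightarrow> x \<in> U \<Longrightarrow> \<exists>n. \<forall>y\<in>space M. (\<forall>i<n. c y i = c x i) \<longrightarrow> y \<in> U"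
    and polish: "completely_metrizable_space (subtopology euclidean (c ` space M))"
  shows "standard_borel M"
proof -
  define T where "T = pullback_topology (space M) c euclidean"
  have top: "topspace T = space M" by (simp add: T_def topspace_pullback_topology)
  have op: "openin T U \<longleftrightarrow> (\<exists>V. open V \<and> U = c -` V \<inter> space M)" for U
    by (simp add: T_def openin_pullback_topology)
  have "homeomorphic_map T (subtopology euclidean (c ` space M)) c"
  proof (rule bijective_open_imp_homeomorphic_map)
    show "continuous_map T (subtopology euclidean (c ` space M)) c"
      unfolding continuous_map_def top
    proof (intro conjI allI impI)
      fix U assume "openin (subtopology euclidean (c ` space M)) U"
      then obtain V where "open V" "U = V \<inter> c ` space M" by (auto simp: openin_subtopology)
      then show "openin T {x \<in> space M. c x \<in> U}" unfolding op by (intro exI[of _ V]) auto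
    qed auto
    show "open_map T (subtopology euclidean (c ` space M)) c"
      unfolding open_map_def
    proof (intro allI impI)
      fix U assume "openin T U"
      then obtain V where V: "open V" "U = c -` V \<inter> space M" unfolding op by blast
      then have "c ` U = V \<inter> c ` space M" by auto
      then show "openin (subtopology euclidean (c ` space M)) (c ` U)"
        using V(1) by (auto simp: openin_subtopology)
    qed
  qed (use inj in \<open>auto simp: top\<close>)
  then have hom: "T homeomorphic_space (subtopology euclidean (c ` space M))"
    by (rule homeomorphic_map_imp_homeomorphic_space)
  have "completely_metrizable_space T"
    using homeomorphic_completely_metrizable_space[OF hom] polish by blast
  moreover have "second_countable T"
    using homeomorphic_space_second_countability[OF hom]
      second_countable_subtopology[OF second_countable_euclidean_class] by blast
  moreover have "sets M = sets (borel_of T)"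
  proof
    have cm: "c \<in> borel_measurable M"
    proof (rule measurable_coordinatewise_then_product)
      fix i show "(\<lambda>x. c x i) \<in> borel_measurable M"
        using meas[of i] by (rule measurable_compose) simp
    qed
    show "sets (borel_of T) \<subseteq> sets M"
      unfolding sets_borel_of top
    proof (rule sets.sigma_sets_subset, rule subsetI)
      fix U assume "U \<in> {U. openin T U}"
      then obtain V where "open V" "U = c -` V \<inter> space M" unfolding op by blast
      then show "U \<in> sets M" using measurable_sets[OF cm, of V] by simp
    qed
    show "sets M \<subseteq> sets (borel_of T)"
      unfolding sets_borel_of M top
    proof (rule sigma_sets_mono, rule subsetI)
      fix U assume U: "U \<in> \<U>"
      then obtain n where n: "\<And>x y. x \<in> U \<Longrightarrow> y \<in> space M \<Longrightarrow> (\<forall>i<n x. c y i = c x i) \<Longrightarrow> y \<in> U"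
        using cyl[OF U] by metis
      have "open (\<Union>x\<in>U. {z. \<forall>i<n x. z i = c x i})" using open_cylinder by blast
      moreover have "U = c -` (\<Union>x\<in>U. {z. \<forall>i<n x. z i = c x i}) \<inter> space M"
        using n sub[OF U] by auto
      ultimately have "openin T U" unfolding op by blast
      then show "U \<in> sigma_sets (space M) {U. openin T U}" by (simp add: sigma_sets.Basic)
    qed
  qed
  ultimately show ?thesis unfolding standard_borel_def using top by metis
qed

text \<open>A largest set of pairwise unrelated points is related to every point.\<close>

lemma finite_transversal:
  fixes R :: "'a \<Rightarrow> 'a \<Rightarrow> bool"
  assumes refl: "\<And>x. R x x" and sym: "\<And>x y. R x y \<Longrightarrow> R y x"
    and bound: "\<And>F. finite F \<Longrightarrow> F \<subseteq> A \<Longrightarrow> K < card F \<Longrightarrow> \<exists>x\<in>F. \<exists>y\<in>F. x \<noteq> y \<and> R x y"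
  shows "\<exists>W. finite W \<and> W \<subseteq> A \<and> (\<forall>y\<in>A. \<exists>w\<in>W. R w y)"
proof -
  define P where "P F \<longleftrightarrow> finite F \<and> F \<subseteq> A \<and> (\<forall>x\<in>F. \<forall>y\<in>F. R x y \<longrightarrow> x = y)" for F
  have "\<exists>W. P W \<and> (\<forall>F. P F \<longrightarrow> card F \<le> card W)"
  proof (rule ex_has_greatest_nat[where P = P and f = card and k = "{}" and b = "Suc K"])
    show "\<forall>F. P F \<longrightarrow> card F < Suc K"
    proof (intro allI impI, rule ccontr)
      fix F assume F: "P F" "\<not> card F < Suc K"
      then have "K < card F" by simp
      with F(1) bound[of F] show False unfolding P_def by blast
    qed
  qed (simp add: P_def)
  then obtain W where W: "P W" "\<And>F. P F \<Longrightarrow> card F \<le> card W" by blast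
  have hit: "\<exists>w\<in>W. R w y" if y: "y \<in> A" for y
  proof (rule ccontr)
    assume no: "\<not> (\<exists>w\<in>W. R w y)"
    then have "y \<notin> W" using refl by blast
    moreover have "P (insert y W)"
      unfolding P_def
    proof (intro conjI ballI impI)
      fix u v assume uv: "u \<in> insert y W" "v \<in> insert y W" and R: "R u v"
      have "\<not> R w y" "\<not> R y w" if "w \<in> W" for w using no that sym by blast+
      moreover have "u = v" if "u \<in> W" "v \<in> W" using W(1) R that by (simp add: P_def)
      ultimately show "u = v" using uv R by blast
    qed (use W(1) y in \<open>simp_all add: P_def\<close>)
    ultimately show False using W(2)[of "insert y W"] W(1) unfolding P_def by simp
  qed
  have "finite W" "W \<subseteq> A" using W(1) by (simp_all add: P_def)
  then show ?thesis by (intro exI[of _ W] conjI ballI hit)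
qed

section \<open>The boundary as a standard Borel space\<close>

context hyperbolic_cayley
begin

abbreviation "act \<equiv> boundary_action G"

lemma countable_carrier: "countable (carrier G)"
proof -
  have "carrier G = (\<Union>n. {y \<in> carrier G. dist_S \<one> y \<le> n})" by auto
  moreover have "countable \<dots>"
    using H.finite_ball[OF one_closed] by (intro countable_UN) (auto intro: countable_finite)
  ultimately show ?thesis by simp
qed

definition enc :: "'g \<Rightarrow> nat" where "enc = to_nat_on (carrier G)"
definition dec :: "nat \<Rightarrow> 'g" where "dec = from_nat_into (carrier G)"

lemma dec_enc [simp]: "g \<in> carrier G \<Longrightarrow> dec (enc g) = g"
  by (simp add: dec_def enc_def countable_carrier)

lemma dec_closed [simp]: "dec k \<in> carrier G"
  unfolding dec_def by (rule from_nat_into) (use one_closed in blast)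

text \<open>The words that encode initial segments of rays from the neutral element to \<open>\<xi>\<close>. The least infinite
  branch of this tree is again a ray to \<open>\<xi>\<close>, since rays to \<open>\<xi>\<close> stay uniformly close to each other
  (\<open>least_ray\<close>).\<close>

definition ray_prefix :: "(real \<Rightarrow> 'g \<Rightarrow> real) set \<Rightarrow> nat list \<Rightarrow> bool" where
  "ray_prefix \<xi> w \<longleftrightarrow> (\<exists>r. H.ray r \<and> r 0 = \<one> \<and> map (\<lambda>i. enc (r i)) [0..<length w] = w \<and> endpoint r = \<xi>)"

definition code :: "(real \<Rightarrow> 'g \<Rightarrow> real) set \<Rightarrow> nat \<Rightarrow> nat list" where
  "code \<xi> n = lexmin (ray_prefix \<xi>) n"

definition coord :: "(real \<Rightarrow> 'g \<Rightarrow> real) set \<Rightarrow> nat \<Rightarrow> nat" where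
  "coord \<xi> i = code \<xi> (Suc i) ! i"

definition least_ray :: "(real \<Rightarrow> 'g \<Rightarrow> real) set \<Rightarrow> nat \<Rightarrow> 'g" where
  "least_ray \<xi> i = dec (coord \<xi> i)"

lemma ray_prefixI:
  assumes "H.ray r" "r 0 = \<one>" "endpoint r = \<xi>"
  shows "ray_prefix \<xi> (map (\<lambda>i. enc (r i)) [0..<n])"
  using assms by (auto simp: ray_prefix_def)

lemma ray_prefix_code: "\<xi> \<in> Z \<Longrightarrow> ray_prefix \<xi> (code \<xi> n)"
  unfolding code_def
proof (rule lexmin_holds)
  assume "\<xi> \<in> Z"
  then show "ray_prefix \<xi> []" using ex_ray_to[OF _ one_closed] by (auto simp: ray_prefix_def)
next
  fix w assume "ray_prefix \<xi> w"
  then obtain r where r: "H.ray r" "r 0 = \<one>" "map (\<lambda>i. enc (r i)) [0..<length w] = w" "endpoint r = \<xi>"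
    by (auto simp: ray_prefix_def)
  have "ray_prefix \<xi> (map (\<lambda>i. enc (r i)) [0..<Suc (length w)])" using ray_prefixI r by blast
  then show "\<exists>a. ray_prefix \<xi> (w @ [a])" using r(3) by auto
qed

lemma code_nth: "i < n \<Longrightarrow> code \<xi> n ! i = coord \<xi> i"
  using take_lexmin[of "Suc i" n "ray_prefix \<xi>"] by (metis Suc_leI code_def coord_def lessI nth_take)

lemma code_eq_map: "code \<xi> n = map (coord \<xi>) [0..<n]"
proof (rule nth_equalityI)
  show "length (code \<xi> n) = length (map (coord \<xi>) [0..<n])" by (simp add: code_def)
  fix i assume "i < length (code \<xi> n)"
  then have "i < n" by (simp add: code_def)
  then show "code \<xi> n ! i = map (coord \<xi>) [0..<n] ! i" by (simp add: code_nth)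
qed

lemma code_approx:
  assumes "\<xi> \<in> Z"
  shows "\<exists>r. H.ray r \<and> r 0 = \<one> \<and> endpoint r = \<xi> \<and> (\<forall>i<n. r i = least_ray \<xi> i \<and> enc (r i) = coord \<xi> i)"
proof -
  have len: "length (code \<xi> n) = n" by (simp add: code_def)
  obtain r where r: "H.ray r" "r 0 = \<one>" "map (\<lambda>i. enc (r i)) [0..<n] = code \<xi> n" "endpoint r = \<xi>"
    using ray_prefix_code[OF assms, of n] unfolding ray_prefix_def len by blast
  have "enc (r i) = coord \<xi> i" if "i < n" for i
    using arg_cong[OF r(3), of "\<lambda>w. w ! i"] that by (simp add: code_nth)
  then show ?thesis using r H.rayD(1)[OF r(1)] unfolding least_ray_def by (intro exI[of _ r]) (metis dec_enc)
qed

lemma least_ray: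
  assumes x: "\<xi> \<in> Z"
  shows "H.ray (least_ray \<xi>)" "least_ray \<xi> 0 = \<one>" "endpoint (least_ray \<xi>) = \<xi>" "enc (least_ray \<xi> i) = coord \<xi> i"
proof -
  have "\<forall>n. \<exists>r. H.ray r \<and> r 0 = \<one> \<and> endpoint r = \<xi> \<and> (\<forall>i<n. r i = least_ray \<xi> i \<and> enc (r i) = coord \<xi> i)"
    using code_approx[OF x] by blast
  then obtain r where r: "\<And>n. H.ray (r n)" "\<And>n. r n 0 = \<one>" "\<And>n. endpoint (r n) = \<xi>"
    "\<And>n i. i < n \<Longrightarrow> r n i = least_ray \<xi> i" "\<And>n i. i < n \<Longrightarrow> enc (r n i) = coord \<xi> i" by metis
  show ray: "H.ray (least_ray \<xi>)"
    unfolding H.ray_def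
  proof (intro conjI allI impI)
    fix i show "least_ray \<xi> i \<in> carrier G" by (simp add: least_ray_def)
  next
    fix i j :: nat assume "i \<le> j"
    then show "dist_S (least_ray \<xi> i) (least_ray \<xi> j) = j - i"
      using H.rayD(2)[OF r(1), of i j "Suc j"] r(4)[of i "Suc j"] r(4)[of j "Suc j"] by simp
  qed
  show "least_ray \<xi> 0 = \<one>" using r(2)[of 1] r(4)[of 0 1] by simp
  show "enc (least_ray \<xi> i) = coord \<xi> i" using r(4,5)[of i "Suc i"] by simp
  have "H.asym (r n) (r 0)" for n using endpoint_eq_iff[OF r(1) r(1)] r(3) by metis
  then have "dist_S (r n t) (r 0 t) \<le> 8 * \<delta>" for n t
    using H.asym_fellow[OF r(1) r(1), of n 0 t] r(2) by simp
  then have "dist_S (least_ray \<xi> t) (r 0 t) \<le> 8 * \<delta>" for t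
    using r(4)[of t "Suc t"] by (metis lessI)
  then have "H.asym (least_ray \<xi>) (r 0)" unfolding H.asym_def by blast
  then show "endpoint (least_ray \<xi>) = \<xi>" using endpoint_eq_iff[OF ray r(1)] r(3) by blast
qed

lemma coord_inj: "inj_on coord Z"
proof (rule inj_onI)
  fix \<xi> \<eta> assume "\<xi> \<in> Z" "\<eta> \<in> Z" "coord \<xi> = coord \<eta>"
  then show "\<xi> = \<eta>" using least_ray(3) by (metis least_ray_def ext)
qed

lemma coord_finite: "finite ((\<lambda>\<xi>. coord \<xi> n) ` Z)"
proof (rule finite_subset)
  show "(\<lambda>\<xi>. coord \<xi> n) ` Z \<subseteq> enc ` {y \<in> carrier G. dist_S \<one> y \<le> n}"
  proof
    fix k assume "k \<in> (\<lambda>\<xi>. coord \<xi> n) ` Z"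
    then obtain \<xi> where x: "\<xi> \<in> Z" "k = coord \<xi> n" by blast
    have "dist_S \<one> (least_ray \<xi> n) = n" using H.rayD(2)[OF least_ray(1)[OF x(1)], of 0 n] least_ray(2)[OF x(1)] by simp
    then show "k \<in> enc ` {y \<in> carrier G. dist_S \<one> y \<le> n}"
      using least_ray(4)[OF x(1), of n] x(2) H.rayD(1)[OF least_ray(1)[OF x(1)]] by (intro image_eqI[of _ _ "least_ray \<xi> n"]) auto
  qed
qed (use H.finite_ball[OF one_closed] in simp)

abbreviation "BM \<equiv> borel_of (group_boundary G S)"

lemma space_BM: "space BM = Z"
  by (simp add: space_borel_of group_boundary_def topspace_gromov_topology)

lemma sets_BM: "sets BM = sigma_sets Z {U. gopen U}"
  by (simp add: sets_borel_of group_boundary_def topspace_gromov_topology openin_gromov_topology)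

lemma gopen_sub: "gopen U \<Longrightarrow> U \<subseteq> Z"
  by (simp add: gromov_open_def)

text \<open>Rays from the neutral element to \<open>g \<xi>\<close> are the translates by \<open>g\<close> of rays from \<open>g\<inverse>\<close> to \<open>\<xi>\<close>. So this is a
  closed condition on \<open>\<xi>\<close>, and one proof settles that the code and that the action are Borel.\<close>

lemma ray_prefix_act_meas:
  assumes g: "g \<in> carrier G"
  shows "Measurable.pred BM (\<lambda>\<xi>. ray_prefix (act g \<xi>) w)"
proof -
  define Q where "Q ys \<longleftrightarrow> map (\<lambda>y. enc (g \<otimes> y)) ys = w" for ys
  define C where "C = {\<xi>. \<exists>r. H.ray r \<and> r 0 = inv g \<and> Q (map r [0..<length w]) \<and> endpoint r = \<xi>}"
  have "ray_prefix (act g \<xi>) w \<longleftrightarrow> \<xi> \<in> C" if x: "\<xi> \<in> Z" for \<xi>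
  proof
    assume "ray_prefix (act g \<xi>) w"
    then obtain r where r: "H.ray r" "r 0 = \<one>" "map (\<lambda>i. enc (r i)) [0..<length w] = w" "endpoint r = act g \<xi>"
      by (auto simp: ray_prefix_def)
    have "g \<otimes> (inv g \<otimes> r i) = r i" for i
      using g H.rayD(1)[OF r(1)] by (simp add: m_assoc[symmetric])
    then have "Q (map (\<lambda>i. inv g \<otimes> r i) [0..<length w])" using r(3) by (simp add: Q_def comp_def)
    moreover have "endpoint (\<lambda>i. inv g \<otimes> r i) = \<xi>"
      using act_endpoint[OF inv_closed[OF g] r(1)] r(4) act_mult[OF inv_closed[OF g] g x] act_one[OF x] g by simp
    ultimately show "\<xi> \<in> C"
      unfolding C_def using mult_ray[OF inv_closed[OF g] r(1)] r(2) g by (intro CollectI exI[of _ "\<lambda>i. inv g \<otimes> r i"]) simp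
  next
    assume "\<xi> \<in> C"
    then obtain r where r: "H.ray r" "r 0 = inv g" "Q (map r [0..<length w])" "endpoint r = \<xi>" by (auto simp: C_def)
    then show "ray_prefix (act g \<xi>) w"
      unfolding ray_prefix_def using mult_ray[OF g r(1)] act_endpoint[OF g r(1)] g
      by (intro exI[of _ "\<lambda>i. g \<otimes> r i"]) (simp add: Q_def comp_def)
  qed
  then have "{\<xi> \<in> space BM. ray_prefix (act g \<xi>) w} = Z - (Z - C)" by (auto simp: space_BM)
  moreover have "Z - C \<in> sets BM"
    unfolding sets_BM C_def by (rule sigma_sets.Basic) (use closed_prefix_condition[OF inv_closed[OF g]] in simp)
  then have "Z - (Z - C) \<in> sets BM" using sets.compl_sets[of "Z - C" BM] by (simp add: space_BM)
  ultimately show ?thesis by (simp add: pred_def)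
qed

lemma ray_prefix_meas: "Measurable.pred BM (\<lambda>\<xi>. ray_prefix \<xi> w)"
proof -
  have "ray_prefix (act \<one> \<xi>) w = ray_prefix \<xi> w" if "\<xi> \<in> space BM" for \<xi> using act_one that by (simp add: space_BM)
  from iffD1[OF measurable_cong[OF this] ray_prefix_act_meas[OF one_closed]] show ?thesis .
qed

lemma coord_cylinder:
  assumes U: "gopen U" and x: "\<xi> \<in> U"
  shows "\<exists>n. \<forall>\<zeta>\<in>Z. (\<forall>i<n. coord \<zeta> i = coord \<xi> i) \<longrightarrow> \<zeta> \<in> U"
proof -
  have xZ: "\<xi> \<in> Z" using gopen_sub[OF U] x by blast
  obtain n where n: "\<forall>r'. H.ray r' \<longrightarrow> (\<forall>i<n. r' i = least_ray \<xi> i) \<longrightarrow> endpoint r' \<in> U"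
    using gopen_cylinder[OF U least_ray(1,2)[OF xZ]] least_ray(3)[OF xZ] x by auto
  have "\<zeta> \<in> U" if z: "\<zeta> \<in> Z" "\<forall>i<n. coord \<zeta> i = coord \<xi> i" for \<zeta>
  proof -
    have "\<forall>i<n. least_ray \<zeta> i = least_ray \<xi> i" using z(2) by (simp add: least_ray_def)
    then show ?thesis using n least_ray(1,3)[OF z(1)] by metis
  qed
  then show ?thesis by blast
qed

lemma measurable_into_boundary:
  assumes sp: "\<And>x. x \<in> space N \<Longrightarrow> f x \<in> Z"
    and P: "\<And>w. Measurable.pred N (\<lambda>x. ray_prefix (f x) w)"
  shows "f \<in> measurable N BM"
proof (rule measurable_sigma_sets[OF sets_BM[folded space_BM]])
  show "{U. gopen U} \<subseteq> Pow (space BM)" using gopen_sub by (auto simp: space_BM)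
  show "f \<in> space N \<rightarrow> space BM" using sp by (auto simp: space_BM)
  fix U assume "U \<in> {U. gopen U}"
  then have U: "gopen U" by simp
  define I where "I = {w. \<forall>\<zeta>\<in>Z. code \<zeta> (length w) = w \<longrightarrow> \<zeta> \<in> U}"
  have "f -` U \<inter> space N = (\<Union>w\<in>I. {x \<in> space N. code (f x) (length w) = w})"
  proof (intro equalityI subsetI)
    fix x assume x: "x \<in> f -` U \<inter> space N"
    then obtain n where n: "\<forall>\<zeta>\<in>Z. (\<forall>i<n. coord \<zeta> i = coord (f x) i) \<longrightarrow> \<zeta> \<in> U"
      using coord_cylinder[OF U, of "f x"] by blast
    have "code (f x) n \<in> I"
      unfolding I_def
    proof (intro CollectI ballI impI)
      fix \<zeta> assume "\<zeta> \<in> Z" "code \<zeta> (length (code (f x) n)) = code (f x) n"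
      then show "\<zeta> \<in> U" using n by (simp add: code_eq_map)
    qed
    then show "x \<in> (\<Union>w\<in>I. {x \<in> space N. code (f x) (length w) = w})"
      using x by (intro UN_I[of "code (f x) n"]) (auto simp: code_def)
  qed (use sp in \<open>auto simp: I_def\<close>)
  moreover have "{x \<in> space N. code (f x) (length w) = w} \<in> sets N" for w
  proof -
    have "(\<lambda>x. code (f x) (length w)) \<in> measurable N (count_space UNIV)"
      unfolding code_def by (rule measurable_lexmin[OF P])
    from measurable_sets[OF this, of "{w}"] show ?thesis
      by (simp add: vimage_def Int_def conj_commute)
  qed
  ultimately show "f -` U \<inter> space N \<in> sets N" by auto
qed

lemma act_meas: "g \<in> carrier G \<Longrightarrow> act g \<in> measurable BM BM"
  by (rule measurable_into_boundary) (auto simp: space_BM act_Z ray_prefix_act_meas)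

lemma coord_meas: "(\<lambda>\<xi>. coord \<xi> i) \<in> measurable BM (count_space UNIV)"
proof -
  have "(\<lambda>\<xi>. code \<xi> (Suc i)) \<in> measurable BM (count_space UNIV)"
    unfolding code_def by (rule measurable_lexmin[OF ray_prefix_meas])
  from measurable_compose[OF this, of "\<lambda>w. w ! i" "count_space UNIV"] show ?thesis
    by (simp add: coord_def)
qed

text \<open>The codes of rays from the neutral element form a closed set. Such a code is the least one for its
  boundary point if, for every \<open>k\<close>, no ray to the same boundary point has a code that agrees with it
  before \<open>k\<close> and has a smaller entry at \<open>k\<close>. For each \<open>k\<close> this excludes finitely many closed
  conditions.\<close>

lemma coord_image_polish: "completely_metrizable_space (subtopology euclidean (coord ` Z))"
proof -
  define X where "X = {x :: nat \<Rightarrow> nat. H.ray (\<lambda>i. dec (x i)) \<and> dec (x 0) = \<one> \<and> (\<forall>i. enc (dec (x i)) = x i)}"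
  define L where "L k = {x \<in> X. \<forall>a<x k. \<not> ray_prefix (endpoint (\<lambda>i. dec (x i))) (map x [0..<k] @ [a])}" for k
  have "coord ` Z = (\<Inter>k. L k)"
  proof (intro equalityI subsetI)
    fix x assume "x \<in> coord ` Z"
    then obtain \<xi> where x: "\<xi> \<in> Z" "x = coord \<xi>" by blast
    have r: "(\<lambda>i. dec (x i)) = least_ray \<xi>" by (simp add: x(2) least_ray_def fun_eq_iff)
    have "enc (dec (x i)) = x i" for i using least_ray(4)[OF x(1), of i] by (simp add: least_ray_def x(2))
    then have "x \<in> X" unfolding X_def r using least_ray(1,2)[OF x(1)] by (simp add: r[symmetric])
    moreover have "\<not> ray_prefix \<xi> (map x [0..<k] @ [a])" if "a < x k" for k a
    proof -
      have "x k = (LEAST a. ray_prefix \<xi> (code \<xi> k @ [a]))"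
        by (simp add: x(2) coord_def code_def nth_append)
      then show ?thesis using not_less_Least[of a "\<lambda>a. ray_prefix \<xi> (code \<xi> k @ [a])"] that by (simp add: code_eq_map x(2))
    qed
    moreover have "endpoint (\<lambda>i. dec (x i)) = \<xi>" by (simp add: r least_ray(3)[OF x(1)])
    ultimately have "x \<in> L k" for k by (simp add: L_def)
    then show "x \<in> (\<Inter>k. L k)" by blast
  next
    fix x assume x: "x \<in> (\<Inter>k. L k)"
    define r where "r = (\<lambda>i. dec (x i))"
    have xX: "x \<in> X" using x unfolding L_def by blast
    then have r: "H.ray r" "r 0 = \<one>" "\<And>i. enc (r i) = x i" by (auto simp: X_def r_def)
    have min: "\<not> ray_prefix (endpoint r) (map x [0..<k] @ [a])" if "a < x k" for k a
      using x that unfolding L_def r_def by blast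
    have "code (endpoint r) k = map x [0..<k]" for k
    proof (induction k)
      case (Suc k)
      have "ray_prefix (endpoint r) (map x [0..<k] @ [x k])"
        using ray_prefixI[OF r(1,2) HOL.refl, of "Suc k"] r(3) by simp
      then have "(LEAST a. ray_prefix (endpoint r) (map x [0..<k] @ [a])) = x k"
        using min by (intro Least_equality) (auto simp: not_less[symmetric])
      then show ?case using Suc by (simp add: code_def)
    qed (simp add: code_def)
    then have "coord (endpoint r) = x" by (simp add: coord_def fun_eq_iff nth_append del: upt_Suc)
    then show "x \<in> coord ` Z" using endpoint_in_Z[OF r(1)] by blast
  qed
  moreover have "completely_metrizable_space (subtopology euclidean (\<Inter>k. L k))"
  proof (rule completely_metrizable_by_cylinders[of X])
    fix x assume notX: "x \<notin> X"
    have "\<exists>n. \<forall>y. (\<forall>i<n. y i = x i) \<longrightarrow> \<not> (dec (y 0) = \<one> \<and> (\<forall>i. enc (dec (y i)) = y i) \<and> H.ray (\<lambda>i. dec (y i)))"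
    proof -
      consider "dec (x 0) \<noteq> \<one>" | i where "enc (dec (x i)) \<noteq> x i" | "\<not> H.ray (\<lambda>i. dec (x i))"
        using notX by (auto simp: X_def)
      then show ?thesis
      proof cases
        case 1
        then show ?thesis by (intro exI[of _ 1]) auto
      next
        case (2 i)
        then show ?thesis by (intro exI[of _ "Suc i"]) (metis lessI)
      next
        case 3
        then obtain i j where ij: "i \<le> j" "dist_S (dec (x i)) (dec (x j)) \<noteq> j - i"
          by (auto simp: H.ray_def)
        then show ?thesis by (intro exI[of _ "Suc j"]) (metis H.rayD(2) le_imp_less_Suc lessI)
      qed
    qed
    then show "\<exists>n. \<forall>y. (\<forall>i<n. y i = x i) \<longrightarrow> y \<notin> X" unfolding X_def by blast
  next
    show "L k \<subseteq> X" for k unfolding L_def by blast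
  next
    fix k x assume x: "x \<in> L k"
    define r where "r = (\<lambda>i. dec (x i))"
    have r: "H.ray r" "r 0 = \<one>" using x by (auto simp: L_def X_def r_def)
    have "\<exists>n. \<forall>r'. H.ray r' \<longrightarrow> (\<forall>i<n. r' i = r i) \<longrightarrow> \<not> ray_prefix (endpoint r') (map x [0..<k] @ [a])" if a: "a < x k" for a
    proof -
      define w where "w = map x [0..<k] @ [a]"
      define U where "U = Z - {\<xi>. \<exists>r. H.ray r \<and> r 0 = \<one> \<and> (map enc (map r [0..<length w]) = w) \<and> endpoint r = \<xi>}"
      have U: "gopen U" unfolding U_def by (rule closed_prefix_condition[OF one_closed])
      have iff: "\<xi> \<in> U \<longleftrightarrow> \<xi> \<in> Z \<and> \<not> ray_prefix \<xi> w" for \<xi>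
        by (auto simp: U_def ray_prefix_def comp_def)
      have "endpoint r \<in> U" unfolding iff using endpoint_in_Z[OF r(1)] x a by (auto simp: L_def r_def w_def)
      from gopen_cylinder[OF U r this] show ?thesis unfolding iff w_def[symmetric] by blast
    qed
    then obtain n where n: "\<And>a r'. a < x k \<Longrightarrow> H.ray r' \<Longrightarrow> (\<forall>i<n a. r' i = r i) \<Longrightarrow> \<not> ray_prefix (endpoint r') (map x [0..<k] @ [a])"
      by metis
    define m where "m = Max (insert (Suc k) (n ` {..<x k}))"
    have m: "Suc k \<le> m" "\<And>a. a < x k \<Longrightarrow> n a \<le> m" unfolding m_def by auto
    have "y \<in> L k" if y: "y \<in> X" "\<forall>i<m. y i = x i" for y
    proof -
      have e: "y k = x k" "map y [0..<k] = map x [0..<k]" using y(2) m(1) by auto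
      have ry: "H.ray (\<lambda>i. dec (y i))" using y(1) by (simp add: X_def)
      have "\<not> ray_prefix (endpoint (\<lambda>i. dec (y i))) (map x [0..<k] @ [a])" if "a < x k" for a
        by (rule n[OF that ry]) (use y(2) m(2)[OF that] in \<open>simp add: r_def\<close>)
      moreover have "y \<in> L k \<longleftrightarrow> y \<in> X \<and> (\<forall>a<y k. \<not> ray_prefix (endpoint (\<lambda>i. dec (y i))) (map y [0..<k] @ [a]))"
        by (simp add: L_def)
      ultimately show ?thesis unfolding e using y(1) by blast
    qed
    then show "\<exists>n. \<forall>y\<in>X. (\<forall>i<n. y i = x i) \<longrightarrow> y \<in> L k" by blast
  qed
  ultimately show ?thesis by simp
qed

lemma standard_borel_BM: "standard_borel BM"
proof (rule standard_borel_by_code[where c = coord and \<U> = "{U. gopen U}"])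
  show "sets BM = sigma_sets (space BM) {U. gopen U}" by (simp add: sets_BM space_BM)
  show "U \<in> {U. gopen U} \<Longrightarrow> U \<subseteq> space BM" for U using gopen_sub by (simp add: space_BM)
  show "\<exists>n. \<forall>y\<in>space BM. (\<forall>i<n. coord y i = coord x i) \<longrightarrow> y \<in> U"
    if "U \<in> {U. gopen U}" "x \<in> U" for U x
    using coord_cylinder[of U x] that by (simp add: space_BM)
qed (simp_all add: space_BM coord_inj coord_meas coord_image_polish)

section \<open>The shift on the boundary\<close>

lemma orbit_rel_eq:
  "orbit_rel G Z act = {(x, y) \<in> Z \<times> Z. \<exists>j. act (dec j) x = y}"
proof -
  have "(\<exists>g\<in>carrier G. act g x = y) \<longleftrightarrow> (\<exists>j. act (dec j) x = y)" for x y
    using dec_enc dec_closed by metis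
  then show ?thesis by (simp add: orbit_rel_def)
qed

lemma equiv_orbit_rel: "equiv Z (orbit_rel G Z act)"
proof (rule equivI)
  show "refl_on Z (orbit_rel G Z act)"
    using act_one one_closed by (auto simp: refl_on_def orbit_rel_def)
  show "sym (orbit_rel G Z act)"
  proof (rule symI)
    fix a b assume "(a, b) \<in> orbit_rel G Z act"
    then obtain g where "a \<in> Z" "b \<in> Z" "g \<in> carrier G" "act g a = b" by (auto simp: orbit_rel_def)
    moreover from this have "act (inv g) b = a" using act_mult[of "inv g" g a] act_one by simp
    ultimately show "(b, a) \<in> orbit_rel G Z act" unfolding orbit_rel_def using inv_closed by blast
  qed
  show "trans (orbit_rel G Z act)"
  proof (rule transI)
    fix a b c assume "(a, b) \<in> orbit_rel G Z act" "(b, c) \<in> orbit_rel G Z act"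
    then obtain g h where "a \<in> Z" "c \<in> Z" "g \<in> carrier G" "h \<in> carrier G" "act h (act g a) = c"
      by (auto simp: orbit_rel_def)
    moreover from this have "act (h \<otimes> g) a = c" using act_mult[of h g a] by simp
    ultimately show "(a, c) \<in> orbit_rel G Z act" unfolding orbit_rel_def using m_closed by blast
  qed
qed (auto simp: orbit_rel_def)

sublocale B: countable_borel_family BM "\<lambda>j. act (dec j)" coord
  by unfold_locales
    (use standard_borel_BM act_meas[OF dec_closed] coord_meas coord_inj coord_finite equiv_orbit_rel
      in \<open>simp_all add: space_BM orbit_rel_eq\<close>)

definition shift :: "(real \<Rightarrow> 'g \<Rightarrow> real) set \<Rightarrow> (real \<Rightarrow> 'g \<Rightarrow> real) set" where
  "shift \<xi> = act (inv (dec (coord \<xi> H.stride))) \<xi>"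

lemma shift_meas: "shift \<in> measurable BM BM"
  unfolding shift_def
  by (rule measurable_compose_countable[OF _ coord_meas]) (rule act_meas[OF inv_closed[OF dec_closed]])

text \<open>The orbit of \<open>g\<inverse> \<xi>\<close> under \<open>shift\<close>, seen from the fixed boundary point \<open>\<xi>\<close>: the base point moves
  instead of the boundary point (\<open>shift_walk\<close>).\<close>

primrec walk :: "(real \<Rightarrow> 'g \<Rightarrow> real) set \<Rightarrow> 'g \<Rightarrow> nat \<Rightarrow> 'g" where
  "walk \<xi> g 0 = g"
| "walk \<xi> g (Suc k) = walk \<xi> g k \<otimes> least_ray (act (inv (walk \<xi> g k)) \<xi>) H.stride"

lemma walk_closed: "g \<in> carrier G \<Longrightarrow> walk \<xi> g k \<in> carrier G"
  by (induction k) (auto simp: least_ray_def)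

lemma shift_walk:
  assumes x: "\<xi> \<in> Z" and g: "g \<in> carrier G"
  shows "(shift ^^ k) (act (inv g) \<xi>) = act (inv (walk \<xi> g k)) \<xi>"
proof (induction k)
  case (Suc k)
  define p where "p = walk \<xi> g k"
  define s where "s = least_ray (act (inv p) \<xi>) H.stride"
  have V: "p \<in> carrier G" "s \<in> carrier G" using walk_closed[OF g] by (auto simp: p_def s_def least_ray_def)
  have "shift (act (inv p) \<xi>) = act (inv s) (act (inv p) \<xi>)"
    by (simp add: shift_def s_def least_ray_def)
  then have "(shift ^^ Suc k) (act (inv g) \<xi>) = act (inv s) (act (inv p) \<xi>)"
    using Suc by (simp add: p_def)
  also have "\<dots> = act (inv (p \<otimes> s)) \<xi>"
    using act_mult[of "inv s" "inv p" \<xi>] V x by (simp add: inv_mult_group)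
  finally show ?case by (simp add: p_def s_def)
qed simp

lemma walk_trajectory:
  assumes x: "\<xi> \<in> Z" and g: "g \<in> carrier G"
  shows "H.trajectory (least_ray \<xi>) (walk \<xi> g)"
  unfolding H.trajectory_def
proof
  fix k
  define p where "p = walk \<xi> g k"
  have p: "p \<in> carrier G" using walk_closed[OF g] by (simp add: p_def)
  define q where "q = least_ray (act (inv p) \<xi>)"
  have aZ: "act (inv p) \<xi> \<in> Z" using act_Z x p by simp
  have q: "H.ray q" "q 0 = \<one>" "endpoint q = act (inv p) \<xi>" using least_ray[OF aZ] by (auto simp: q_def)
  have "endpoint (\<lambda>i. p \<otimes> q i) = \<xi>"
    using act_endpoint[OF p q(1)] q(3) act_mult[of p "inv p" \<xi>] p x act_one by simp
  then have "H.asym (\<lambda>i. p \<otimes> q i) (least_ray \<xi>)"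
    using endpoint_eq_iff[OF mult_ray[OF p q(1)] least_ray(1)[OF x]] least_ray(3)[OF x] by simp
  then show "\<exists>q. H.ray q \<and> q 0 = walk \<xi> g k \<and> q H.stride = walk \<xi> g (Suc k) \<and> H.asym q (least_ray \<xi>)"
    using mult_ray[OF p q(1)] q(2) p by (intro exI[of _ "\<lambda>i. p \<otimes> q i"]) (simp add: p_def q_def)
qed

text \<open>Different points \<open>g\<inverse> \<xi>\<close> of the orbit give different walks towards \<open>\<xi>\<close>, and if two walks share a point,
  then iterates of \<open>shift\<close> at the two points coincide.\<close>

lemma finite_tail_index:
  assumes x: "\<xi> \<in> Z"
  shows "\<exists>W. finite W \<and> W \<subseteq> B.E `` {\<xi>} \<and> (\<forall>y\<in>B.E `` {\<xi>}. \<exists>w\<in>W. B.tail_rel shift w y)"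
proof -
  obtain K where K: "\<forall>r P. H.ray r \<longrightarrow> finite P \<longrightarrow> (\<forall>p\<in>P. H.trajectory r p) \<longrightarrow> K < card P \<longrightarrow>
      (\<exists>p\<in>P. \<exists>p'\<in>P. p \<noteq> p' \<and> (\<exists>i j. p i = p' j))"
    using H.trajectories_merge by (rule exE)
  show ?thesis
  proof (rule finite_transversal[where K = K])
    show "B.tail_rel shift y y" for y by (rule B.tail_rel_refl)
    show "B.tail_rel shift y z \<Longrightarrow> B.tail_rel shift z y" for y z by (rule B.tail_rel_sym)
    fix F assume F: "finite F" "F \<subseteq> B.E `` {\<xi>}" "K < card F"
    have "\<exists>g. g \<in> carrier G \<and> act (inv g) \<xi> = y" if y: "y \<in> F" for y
    proof -
      obtain j where "act (dec j) \<xi> = y" using F(2) y by (auto simp: B.E_def)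
      then show ?thesis by (intro exI[of _ "inv (dec j)"]) simp
    qed
    then obtain g where g: "\<And>y. y \<in> F \<Longrightarrow> g y \<in> carrier G" "\<And>y. y \<in> F \<Longrightarrow> act (inv (g y)) \<xi> = y" by metis
    have inj: "inj_on (\<lambda>y. walk \<xi> (g y)) F"
    proof (rule inj_onI)
      fix y z assume yz: "y \<in> F" "z \<in> F" "walk \<xi> (g y) = walk \<xi> (g z)"
      have "walk \<xi> (g y) 0 = walk \<xi> (g z) 0" using yz(3) by (rule fun_cong)
      then have "g y = g z" by (simp only: walk.simps)
      then show "y = z" using g(2)[OF yz(1)] g(2)[OF yz(2)] by (metis (no_types))
    qed
    have "\<exists>p\<in>(\<lambda>y. walk \<xi> (g y)) ` F. \<exists>p'\<in>(\<lambda>y. walk \<xi> (g y)) ` F. p \<noteq> p' \<and> (\<exists>i j. p i = p' j)"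
    proof (rule K[THEN spec, THEN spec, THEN mp, THEN mp, THEN mp, THEN mp, OF least_ray(1)[OF x]])
      show "\<forall>p\<in>(\<lambda>y. walk \<xi> (g y)) ` F. H.trajectory (least_ray \<xi>) p" using walk_trajectory[OF x] g(1) by blast
      show "K < card ((\<lambda>y. walk \<xi> (g y)) ` F)" using card_image[OF inj] F(3) by simp
    qed (use F(1) in simp)
    then obtain y z i j where yz: "y \<in> F" "z \<in> F" "walk \<xi> (g y) \<noteq> walk \<xi> (g z)" "walk \<xi> (g y) i = walk \<xi> (g z) j"
      by blast
    then have "(shift ^^ i) y = (shift ^^ j) z"
      using shift_walk[OF x g(1)[OF yz(1)], of i] shift_walk[OF x g(1)[OF yz(2)], of j] g(2) by simp
    then have "B.tail_rel shift y z" unfolding B.tail_rel_def by (intro exI)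
    moreover have "y \<noteq> z" using yz(3) by blast
    ultimately show "\<exists>y\<in>F. \<exists>z\<in>F. y \<noteq> z \<and> B.tail_rel shift y z" using yz(1,2) by (intro bexI conjI)
  qed
qed

theorem hyperfinite_boundary_action: "hyperfinite_action G BM act"
proof -
  have "hyperfinite BM B.E"
  proof (rule B.hyperfinite_if_finite_tail_index[OF shift_meas])
    show "(\<xi>, shift \<xi>) \<in> B.E" if "\<xi> \<in> space BM" for \<xi>
    proof -
      define g where "g = inv (dec (coord \<xi> H.stride))"
      have g: "g \<in> carrier G" by (simp add: g_def)
      have "shift \<xi> = act g \<xi>" by (simp add: shift_def g_def)
      moreover have "act (dec (enc g)) \<xi> = act g \<xi>" "act g \<xi> \<in> Z"
        using g act_Z[OF g] that by (simp_all add: space_BM)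
      ultimately have "\<exists>j. act (dec j) \<xi> = shift \<xi>" "shift \<xi> \<in> Z" "\<xi> \<in> Z"
        using that by (auto simp: space_BM intro!: exI[of _ "enc g"])
      then show ?thesis by (simp add: B.E_def space_BM)
    qed
  qed (rule finite_tail_index, simp add: space_BM)
  moreover have "B.E = orbit_rel G (space BM) act"
    by (simp add: B.E_def orbit_rel_eq space_BM)
  ultimately show ?thesis by (simp add: hyperfinite_action_def)
qed

end

theorem corollary1p2:
  fixes G :: "('g, 'm) monoid_scheme"
    and X :: "('i, 'x) cube_family"
    and \<phi> :: "'g \<Rightarrow> 'x \<Rightarrow> 'x"
    and S :: "'g set"
  assumes "hyperbolic_group G"
    and "CAT0_cube_complex X"
    and "geometric_cubical_action G X \<phi>"
    and "finite_generating_set G S"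
  shows "hyperfinite_action G (borel_of (group_boundary G S)) (boundary_action G)"
proof -
  obtain S' where G: "group G" and S': "finite_generating_set G S'"
      "hyperbolic_space (cc_points (cayley_graph G S')) (cc_dist (cayley_graph G S'))"
    using assms(1) by (auto simp: hyperbolic_group_def)
  interpret A: finitely_generated G S
    using G assms(4) by (simp add: finitely_generated_def finitely_generated_axioms_def)
  interpret A': finitely_generated G S'
    using G S'(1) by (simp add: finitely_generated_def finitely_generated_axioms_def)
  obtain \<delta>' where \<delta>': "A'.W.thin_triangles \<delta>'" using A'.thin_of_hyperbolic_space[OF S'(2)] by blast
  obtain L where L: "\<forall>x\<in>carrier G. \<forall>y\<in>carrier G. word_dist G S' x y \<le> L * word_dist G S x y"
    using A.word_dist_Lipschitz[OF S'(1)] by blast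
  obtain L' where L': "\<forall>x\<in>carrier G. \<forall>y\<in>carrier G. word_dist G S x y \<le> L' * word_dist G S' x y"
    using A'.word_dist_Lipschitz[OF assms(4)] by blast
  have "\<exists>\<delta>. A.W.thin_triangles \<delta>"
  proof (rule A.W.thin_bilipschitz[OF A'.W.discrete_geodesic_axioms \<delta>'])
    fix x y assume xy: "x \<in> carrier G" "y \<in> carrier G"
    show "word_dist G S' x y \<le> (L + L') * word_dist G S x y"
      using L xy by (meson le_add1 le_trans mult_le_mono1)
    show "word_dist G S x y \<le> (L + L') * word_dist G S' x y"
      using L' xy by (meson le_add2 le_trans mult_le_mono1)
  qed
  then obtain \<delta> where "A.W.thin_triangles \<delta>" ..
  then interpret C: hyperbolic_cayley G S \<delta>
    by unfold_locales
  show ?thesis by (rule C.hyperfinite_boundary_action)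
qed

end
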